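(* Let $\Omega$ be a bounded Lipschitz domain in $\mathbb{R}^N$, and let $\lambda_1^s(\Omega)$ denote the first Dirichlet eigenvalue of $(-\Delta)^s$ on $\Omega$ for $s \in (0,1)$. Then $$\lambda_1^L(\Omega) = \frac{d}{ds}\Big|_{s=0} \lambda_1^s(\Omega),\qquad\text{i.e.}\qquad \lambda_1^L(\Omega)=\lim_{s\to0^+}\frac{\lambda_1^s(\Omega)-1}{s}.$$ Moreover, if $u_s$ is the unique nonnegative $L^2$-normalized Dirichlet eigenfunction of $(-\Delta)^s$ corresponding to $\lambda_1^s(\Omega)$, then $u_s \to \xi_1$ in $L^2(\Omega)$ as $s\to0^+$, where $\xi_1$ is the unique nonnegative $L^2$-normalized eigenfunction of $L_\Delta$ corresponding to $\lambda_1^L(\Omega)$.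
   Context: $N\ge1$; $c_N= \pi^{-N/2}\Gamma(N/2)$, $\rho_N=2 \log 2 + \psi(\frac{N}{2}) -\gamma$, with $\psi=\Gamma'/\Gamma$ and $\gamma=-\Gamma'(1)$. $L^2(\Omega)$ is identified with the functions in $L^2(\mathbb{R}^N)$ vanishing on $\mathbb{R}^N\setminus\Omega$. Fractional Laplacian: for $s\in(0,1)$ let $c_{N,s}=2^{2s}\pi^{-\frac N2}s\,\frac{\Gamma(\frac{N+2s}{2})}{\Gamma(1-s)}$ and $\mathcal{E}_s(u,v)=\frac{c_{N,s}}{2}\int_{\mathbb{R}^N}\int_{\mathbb{R}^N}\frac{(u(x)-u(y))(v(x)-v(y))}{|x-y|^{N+2s}}\,dx\,dy$. Then $\lambda_1^s(\Omega)=\inf\{\mathcal{E}_s(u,u): u\in C^2_c(\Omega),\ \|u\|_{L^2}=1\}$. A Dirichlet eigenfunction corresponding to $\lambda_1^s(\Omega)$ is a nonzero $u\in H^s(\mathbb{R}^N)$ with $u=0$ a.e. in $\mathbb{R}^N\setminus\Omega$ and $\mathcal{E}_s(u,v)=\lambda_1^s(\Omega)\int_\Omega uv\,dx$ for all $v\in H^s(\mathbb{R}^N)$ vanishing a.e. in $\mathbb{R}^N\setminus\Omega$. Logarithmic Laplacian $L_\Delta$: $\mathbb{H}(\Omega)$ is the space of measurable $u:\mathbb{R}^N\to\mathbb{R}$ with $u\equiv0$ on $\mathbb{R}^N\setminus\Omega$ and $\iint_{|x-y|\le1}\frac{(u(x)-u(y))^2}{|x-y|^N}\,dx\,dy<\infty$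 (it is contained in $L^2(\Omega)$), and on $\mathbb{H}(\Omega)$ $$\mathcal{E}(u,w)=\frac{c_N}{2}\iint_{|x-y|\le1}\frac{(u(x)-u(y))(w(x)-w(y))}{|x-y|^N}\,dx\,dy,\quad \mathcal{E}_L(u,w)=\mathcal{E}(u,w)-c_N\iint_{|x-y|\ge1}\frac{u(x)w(y)}{|x-y|^N}\,dx\,dy+\rho_N\int_{\mathbb{R}^N}uw\,dx .$$ $\lambda_1^L(\Omega)=\min\{\mathcal{E}_L(u,u):u\in\mathbb{H}(\Omega),\ \|u\|_{L^2(\Omega)}=1\}$ is the first eigenvalue; $u\in\mathbb{H}(\Omega)\setminus\{0\}$ is an eigenfunction corresponding to it if $\mathcal{E}_L(u,\phi)=\lambda_1^L(\Omega)\int_\Omega u\phi\,dx$ for all $\phi\in\mathbb{H}(\Omega)$. It is known that this eigenvalue is attained and simple and has a nonnegative eigenfunction. *)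

theory Defs
  imports "HOL-Analysis.Analysis"
begin

text \<open>
  The space $R^N$ is rendered as an arbitrary type \<open>'a\<close> of class \<open>euclidean_space\<close>, with
  $N$ = \<open>DIM('a)\<close> (so $N \ge 1$ automatically). Functions are total, real-valued and Lebesgue
  measurable. Double integrals are Lebesgue integrals over the product space \<open>'a \<times> 'a\<close>; the
  kernels take the value 0 on the diagonal (division by zero), which is a null set.
\<close>

subsection \<open>Bounded Lipschitz domains\<close>

text \<open>
  Near a boundary point the domain lies on one side of the graph of a Lipschitz function \<open>g\<close> defined
  on the hyperplane orthogonal to a unit vector \<open>e\<close>; \<open>x - (x \<bullet> e) *\<^sub>R e\<close> is the projection of \<open>x\<close> onto
  that hyperplane. For \<open>DIM('a) = 1\<close> the hyperplane is \<open>{0}\<close>.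
\<close>

definition lipschitz_boundary :: "'a::euclidean_space set \<Rightarrow> bool" where
  "lipschitz_boundary \<Omega> \<longleftrightarrow>
     (\<forall>p\<in>frontier \<Omega>. \<exists>r>0. \<exists>e g L. norm e = 1 \<and> L-lipschitz_on {y. y \<bullet> e = 0} (g :: 'a \<Rightarrow> real) \<and>
        \<Omega> \<inter> ball p r = {x \<in> ball p r. x \<bullet> e > g (x - (x \<bullet> e) *\<^sub>R e)})"

definition bounded_lipschitz_domain :: "'a::euclidean_space set \<Rightarrow> bool" where
  "bounded_lipschitz_domain \<Omega> \<longleftrightarrow>
     open \<Omega> \<and> connected \<Omega> \<and> \<Omega> \<noteq> {} \<and> bounded \<Omega> \<and> lipschitz_boundary \<Omega>"

subsection \<open>Function spaces\<close>

definition L2_norm_on :: "'a::euclidean_space set \<Rightarrow> ('a \<Rightarrow> real) \<Rightarrow> real" where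
  "L2_norm_on S u = sqrt (LINT x:S|lebesgue. (u x)\<^sup>2)"

definition C2_function :: "('a::euclidean_space \<Rightarrow> real) \<Rightarrow> bool" where
  "C2_function u \<longleftrightarrow>
     (\<exists>(Du :: 'a \<Rightarrow> 'a \<Rightarrow>\<^sub>L real) (D2u :: 'a \<Rightarrow> 'a \<Rightarrow>\<^sub>L ('a \<Rightarrow>\<^sub>L real)).
        (\<forall>x. (u has_derivative blinfun_apply (Du x)) (at x)) \<and>
        (\<forall>x. (Du has_derivative blinfun_apply (D2u x)) (at x)) \<and>
        continuous_on UNIV D2u)"

text \<open>Elements of $C^2_c(\Omega)$ are extended by zero to the whole space.\<close>

definition C2c :: "'a::euclidean_space set \<Rightarrow> ('a \<Rightarrow> real) set" where
  "C2c \<Omega> = {u. C2_function u \<and> compact (closure {x. u x \<noteq> 0}) \<and> closure {x. u x \<noteq> 0} \<subseteq> \<Omega>}"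

definition Hs_space :: "real \<Rightarrow> ('a::euclidean_space \<Rightarrow> real) set" where
  "Hs_space s = {u. u \<in> borel_measurable lebesgue \<and>
     integrable lebesgue (\<lambda>x. (u x)\<^sup>2) \<and>
     integrable lebesgue (\<lambda>(x::'a, y::'a). (u x - u y)\<^sup>2 / norm (x - y) powr (real DIM('a) + 2 * s))}"

text \<open>The functions in $H^s(R^N)$ that vanish almost everywhere outside \<open>\<Omega>\<close>.\<close>

definition Hs0_space :: "real \<Rightarrow> 'a::euclidean_space set \<Rightarrow> ('a \<Rightarrow> real) set" where
  "Hs0_space s \<Omega> = {u \<in> Hs_space s. AE x in lebesgue. x \<notin> \<Omega> \<longrightarrow> u x = 0}"

definition HL_space :: "'a::euclidean_space set \<Rightarrow> ('a \<Rightarrow> real) set" where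
  "HL_space \<Omega> = {u. u \<in> borel_measurable lebesgue \<and> (\<forall>x. x \<notin> \<Omega> \<longrightarrow> u x = 0) \<and>
     set_integrable lebesgue {(x::'a, y::'a). norm (x - y) \<le> 1}
       (\<lambda>(x, y). (u x - u y)\<^sup>2 / norm (x - y) ^ DIM('a))}"

subsection \<open>Fractional Laplacian\<close>

definition frac_const :: "nat \<Rightarrow> real \<Rightarrow> real" where
  "frac_const N s =
     2 powr (2 * s) * pi powr (- (real N / 2)) * s * Gamma ((real N + 2 * s) / 2) / Gamma (1 - s)"

definition frac_form ::
  "real \<Rightarrow> ('a::euclidean_space \<Rightarrow> real) \<Rightarrow> ('a \<Rightarrow> real) \<Rightarrow> real" where
  "frac_form s u v = frac_const DIM('a) s / 2 *
     (LINT (x::'a, y::'a)|lebesgue.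
        (u x - u y) * (v x - v y) / norm (x - y) powr (real DIM('a) + 2 * s))"

definition frac_eigenvalue1 :: "real \<Rightarrow> 'a::euclidean_space set \<Rightarrow> real" where
  "frac_eigenvalue1 s \<Omega> = Inf {frac_form s u u | u. u \<in> C2c \<Omega> \<and> L2_norm_on UNIV u = 1}"

definition frac_eigenfunction1 ::
  "real \<Rightarrow> 'a::euclidean_space set \<Rightarrow> ('a \<Rightarrow> real) \<Rightarrow> bool" where
  "frac_eigenfunction1 s \<Omega> u \<longleftrightarrow>
     u \<in> Hs0_space s \<Omega> \<and> \<not> (AE x in lebesgue. u x = 0) \<and>
     (\<forall>v\<in>Hs0_space s \<Omega>.
        frac_form s u v = frac_eigenvalue1 s \<Omega> * (LINT x:\<Omega>|lebesgue. u x * v x))"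

subsection \<open>Logarithmic Laplacian\<close>

definition log_const :: "nat \<Rightarrow> real" where
  "log_const N = pi powr (- (real N / 2)) * Gamma (real N / 2)"

definition log_rho :: "nat \<Rightarrow> real" where
  "log_rho N = 2 * ln 2 + Digamma (real N / 2) - euler_mascheroni"

definition log_form_local ::
  "('a::euclidean_space \<Rightarrow> real) \<Rightarrow> ('a \<Rightarrow> real) \<Rightarrow> real" where
  "log_form_local u w = log_const DIM('a) / 2 *
     (LINT (x, y):{(x::'a, y::'a). norm (x - y) \<le> 1}|lebesgue.
        (u x - u y) * (w x - w y) / norm (x - y) ^ DIM('a))"

definition log_form ::
  "('a::euclidean_space \<Rightarrow> real) \<Rightarrow> ('a \<Rightarrow> real) \<Rightarrow> real" where
  "log_form u w = log_form_local u w
     - log_const DIM('a) *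
         (LINT (x, y):{(x::'a, y::'a). norm (x - y) \<ge> 1}|lebesgue.
            u x * w y / norm (x - y) ^ DIM('a))
     + log_rho DIM('a) * (LINT x|lebesgue. u x * w x)"

text \<open>The infimum is in fact attained, so this is the minimum.\<close>

definition log_eigenvalue1 :: "'a::euclidean_space set \<Rightarrow> real" where
  "log_eigenvalue1 \<Omega> = Inf {log_form u u | u. u \<in> HL_space \<Omega> \<and> L2_norm_on \<Omega> u = 1}"

definition log_eigenfunction1 :: "'a::euclidean_space set \<Rightarrow> ('a \<Rightarrow> real) \<Rightarrow> bool" where
  "log_eigenfunction1 \<Omega> u \<longleftrightarrow>
     u \<in> HL_space \<Omega> \<and> \<not> (AE x in lebesgue. u x = 0) \<and>
     (\<forall>\<phi>\<in>HL_space \<Omega>.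
        log_form u \<phi> = log_eigenvalue1 \<Omega> * (LINT x:\<Omega>|lebesgue. u x * \<phi> x))"

definition nonneg_normalized_on :: "'a::euclidean_space set \<Rightarrow> ('a \<Rightarrow> real) \<Rightarrow> bool" where
  "nonneg_normalized_on \<Omega> u \<longleftrightarrow> (AE x in lebesgue. 0 \<le> u x) \<and> L2_norm_on \<Omega> u = 1"

end

theory Submission
  imports Defs
begin

text \<open>
  Since $\int_{|z|>1} |z|^{-N-2s}\,dz = 1/(s\,c_N)$, the fractional form of a function supported in
  $\Omega$ is $\kappa(s)\,(\|u\|^2 + s\,(\frac{c_N}{2} A_s(u) - c_N B_s(u)))$, where $A_s$ and $B_s$
  collect the pairs at distance at most and above $1$, and $\kappa(0) = 1$, $\kappa'(0) = \rho_N$. Here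
  $A_s \ge A_0$, and $|B_s - B_0|$ is small uniformly because $\Omega$ is bounded; this yields the
  lower bound for $(\lambda_1^s - 1)/s$ without any compactness. For the upper bound,
  $A_s \le A_0 + 2s A_{1/2}$ on $C^2_c(\Omega)$, which is dense in energy: truncate, cut off near the
  Lipschitz boundary, and mollify.

  For the eigenfunctions, passing from $w$ to $|w|$ lowers the logarithmic energy by at least a
  multiple of $\|w\|_1^2 - (\int w)^2$. As the energy deficit of $u_s$ is unchanged by subtracting
  multiples of $\xi_1$, choosing the multiple $t$ with $\int (u_s - t \xi_1) = 0$ gives
  $u_s - t \xi_1 \to 0$ in $L^1$, and the non-integrable kernel upgrades this to $L^2$.
\<close>

section \<open>Radial integrals\<close>

text \<open>The two infima run over different classes: \<open>C2c\<close> for the fractional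
  eigenvalue, all of \<open>form_domain\<close> for the logarithmic one. As \<open>C2c\<close> is
  the smaller class, only the upper bound has to approximate, and there L2 convergence together with
  an upper bound on the near energies is enough, since the far energy is L2 continuous on a bounded
  set. Truncation (a contraction of values) and mollification (an average of translates) never raise
  the near energy. Only the cutoff costs something, and the logarithmic kernel is so weak that a
  strip of volume O(eps) pays for a slope of 1/eps.

  For the eigenfunctions the usual route extracts a limit by compact embedding and identifies it by
  simplicity of the eigenvalue. Here a quantitative simplicity does both jobs: the kernel is bounded
  below on pairs of points of a bounded set, so a change of sign costs energy in proportion to the
  product of the masses of the two signs. Nonnegativity and normalization then turn closeness of u_s
  to the line spanned by the limit into closeness to the limit itself.\<close>

lemma distr_norm_lborel:
  "distr (lborel :: 'a::euclidean_space measure) borel norm =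
     density lborel (\<lambda>r. ennreal (real DIM('a) * unit_ball_vol DIM('a) * r ^ (DIM('a) - 1)) * indicator {0..} r)"
\<comment> \<open>The half-lines form an intersection-stable generator; on \<open>{..a}\<close> the
  left measure is the volume of a ball and the right one an elementary integral.\<close>
proof (rule measure_eqI_generator_eq[where E = "range atMost" and \<Omega> = UNIV and A = "\<lambda>n. {..real n}"])
  fix X :: "real set"
  assume "X \<in> range atMost"
  then obtain a where X: "X = {..a}" by auto
  let ?c = "unit_ball_vol DIM('a)"
  have *: "norm -` {..a} = cball (0::'a) a"
    by auto
  have lhs: "emeasure (distr (lborel :: 'a measure) borel norm) X = emeasure lborel (cball (0::'a) a)"
    unfolding X by (subst emeasure_distr) (auto simp: *)
  have rhs: "emeasure (density lborel (\<lambda>r. ennreal (real DIM('a) * ?c * r ^ (DIM('a) - 1)) * indicator {0..} r)) X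
     = (\<integral>\<^sup>+r. ennreal (real DIM('a) * ?c * r ^ (DIM('a) - 1)) * indicator {0..a} r \<partial>lborel)"
    unfolding X by (subst emeasure_density) (auto intro!: nn_integral_cong simp: indicator_def)
  show "emeasure (distr (lborel :: 'a measure) borel norm) X =
     emeasure (density lborel (\<lambda>r. ennreal (real DIM('a) * ?c * r ^ (DIM('a) - 1)) * indicator {0..} r)) X"
  proof (cases "a \<ge> 0")
    case True
    have "(\<integral>\<^sup>+r. ennreal (real DIM('a) * ?c * r ^ (DIM('a) - 1)) * indicator {0..a} r \<partial>lborel)
      = ennreal (?c * a ^ DIM('a) - ?c * 0 ^ DIM('a))"
      by (rule nn_integral_FTC_Icc[where F = "\<lambda>r. ?c * r ^ DIM('a)"])
         (use True in \<open>auto intro!: derivative_eq_intros\<close>)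
    then show ?thesis
      unfolding lhs rhs by (simp add: emeasure_cball True zero_power)
  next
    case False
    then show ?thesis unfolding lhs rhs by simp
  qed
next
  show "(\<Union>n. {..real n}) = UNIV"
    by (auto simp: real_arch_simple)
next
  fix n
  have "norm -` {..real n} = cball (0::'a) (real n)"
    by auto
  then show "emeasure (distr (lborel :: 'a measure) borel norm) {..real n} \<noteq> \<infinity>"
    by (subst emeasure_distr) (auto simp: emeasure_cball)
qed (auto simp: Int_stable_def borel_eq_atMost)

lemma nn_integral_radial:
  fixes f :: "real \<Rightarrow> ennreal"
  assumes [measurable]: "f \<in> borel_measurable borel"
  shows "(\<integral>\<^sup>+x. f (norm (x::'a::euclidean_space)) \<partial>lborel) =
    (\<integral>\<^sup>+r. ennreal (real DIM('a) * unit_ball_vol DIM('a) * r ^ (DIM('a) - 1)) * indicator {0..} r * f r \<partial>lborel)"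
proof -
  have "(\<integral>\<^sup>+x. f (norm (x::'a)) \<partial>lborel) = (\<integral>\<^sup>+r. f r \<partial>distr (lborel :: 'a measure) borel norm)"
    by (subst nn_integral_distr) auto
  also have "\<dots> = (\<integral>\<^sup>+r. ennreal (real DIM('a) * unit_ball_vol DIM('a) * r ^ (DIM('a) - 1)) * indicator {0..} r * f r \<partial>lborel)"
    unfolding distr_norm_lborel by (subst nn_integral_density) auto
  finally show ?thesis .
qed

text \<open>So \<open>log_const\<close> is 2 divided by the surface area of the unit sphere. Radial
  integrals carry that area as a factor, and this identity trades it for
  \<open>log_const\<close>.\<close>

lemma unit_ball_vol_log_const:
  "real DIM('a::euclidean_space) * unit_ball_vol DIM('a) * log_const DIM('a) = 2"
proof -
  have "Gamma (real DIM('a) / 2 + 1) = real DIM('a) / 2 * Gamma (real DIM('a) / 2)"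
    by (rule Gamma_plus1) (use DIM_positive[where 'a='a] in \<open>auto dest: nonpos_Ints_nonpos\<close>)
  moreover have "Gamma (real DIM('a) / 2) > 0"
    by (rule Gamma_real_pos) auto
  moreover have "pi powr (real DIM('a) / 2) * pi powr (-(real DIM('a) / 2)) = 1"
    by (simp flip: powr_add)
  moreover have "real DIM('a) * (p / (real DIM('a) / 2 * g)) * (q * g) = 2 * (p * q)"
    if "g > 0" for p q g :: real
    using that by (simp add: field_simps)
  ultimately show ?thesis
    by (simp only: unit_ball_vol_def log_const_def)
qed

lemma log_const_pos: "N > 0 \<Longrightarrow> log_const N > 0"
  by (auto simp: log_const_def intro!: mult_pos_pos Gamma_real_pos)

text \<open>The mass of the kernel tail blows up like \<open>1 / a\<close>. Multiplied by
  \<open>frac_const\<close>, which is of order \<open>s\<close>, it survives as the zero-order term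
  of the fractional form when \<open>s\<close> tends to 0.\<close>

lemma nn_integral_radial_powr:
  assumes "a > 0"
  shows "(\<integral>\<^sup>+x. ennreal (indicator {1<..} (norm (x::'a::euclidean_space)) * norm x powr (- (real DIM('a) + 2 * a))) \<partial>lborel)
    = ennreal (1 / (a * log_const DIM('a)))"
proof -
  let ?N = "DIM('a)"
  let ?C = "real ?N * unit_ball_vol ?N"
  have N: "?N > 0" by simp
  have C: "?C \<ge> 0" by (simp add: unit_ball_vol_nonneg)
  have "(\<integral>\<^sup>+x. ennreal (indicator {1<..} (norm (x::'a)) * norm x powr (- (real ?N + 2 * a))) \<partial>lborel)
    = (\<integral>\<^sup>+r. ennreal (?C * r ^ (?N - 1)) * indicator {0..} r * ennreal (indicator {1<..} r * r powr (- (real ?N + 2 * a))) \<partial>lborel)"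
    by (subst nn_integral_radial[where f = "\<lambda>r. ennreal (indicator {1<..} r * r powr (- (real ?N + 2 * a)))"]) auto
  also have "\<dots> = (\<integral>\<^sup>+r. ennreal (?C * r powr (- 2 * a - 1)) * indicator {1..} r \<partial>lborel)"
  proof (rule nn_integral_cong_AE)
    \<comment> \<open>The fundamental theorem on a half-line, applied below, wants a closed
      interval; the endpoint that is added is a null set.\<close>
    have "AE r in lborel. r \<noteq> (1::real)" by (rule AE_lborel_singleton)
    then show "AE r in lborel. ennreal (?C * r ^ (?N - 1)) * indicator {0..} r * ennreal (indicator {1<..} r * r powr (- (real ?N + 2 * a)))
      = ennreal (?C * r powr (- 2 * a - 1)) * indicator {1..} r"
    proof eventually_elim
      case (elim r)
      show ?case
      proof (cases "r > 1")
        case True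
        have "r ^ (?N - 1) * r powr (- (real ?N + 2 * a)) = r powr ((real ?N - 1) + (- (real ?N + 2 * a)))"
          using True N by (simp only: powr_add) (simp add: powr_realpow[symmetric] of_nat_diff)
        also have "(real ?N - 1) + (- (real ?N + 2 * a)) = - 2 * a - 1"
          by simp
        finally have "r ^ (?N - 1) * r powr (- (real ?N + 2 * a)) = r powr (- 2 * a - 1)" .
        then show ?thesis using True C
          by (simp add: ennreal_mult[symmetric] mult.assoc)
      next
        case False
        then show ?thesis using elim by (auto simp: indicator_def)
      qed
    qed
  qed
  also have "\<dots> = ennreal (0 - (- ?C / (2 * a) * 1 powr (- 2 * a)))"
  proof (rule nn_integral_FTC_atLeast[where F = "\<lambda>r. - ?C / (2 * a) * r powr (- 2 * a)"])
    fix x :: real assume "1 \<le> x"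
    then show "((\<lambda>r. - ?C / (2 * a) * r powr (- 2 * a)) has_real_derivative ?C * x powr (- 2 * a - 1)) (at x)"
      using assms by (auto intro!: derivative_eq_intros simp: field_simps)
    show "0 \<le> ?C * x powr (- 2 * a - 1)" using C by simp
  next
    have "((\<lambda>r. r powr (- 2 * a)) \<longlongrightarrow> 0) at_top"
      using assms by (intro tendsto_neg_powr filterlim_ident) auto
    then show "((\<lambda>r. - ?C / (2 * a) * r powr (- 2 * a)) \<longlongrightarrow> 0) at_top"
      by (rule tendsto_mult_right_zero)
  qed auto
  also have "0 - (- ?C / (2 * a) * 1 powr (- 2 * a)) = 1 / (a * log_const ?N)"
    using unit_ball_vol_log_const[where 'a='a] log_const_pos[OF N] assms by (simp add: field_simps)
  finally show ?thesis .
qed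

text \<open>Used with \<open>a = 1/2\<close> for the error of the boundary cutoff and with
  \<open>a = 1\<close> for the energy of exponent \<open>1/2\<close> of a Lipschitz
  function.\<close>

lemma integrable_radial_powr_cball:
  assumes "a > 0"
  shows "integrable lborel (\<lambda>x::'a::euclidean_space. indicator {..1} (norm x) * norm x powr (a - real DIM('a)))"
proof (rule integrableI_bounded)
  let ?N = "DIM('a)"
  let ?C = "real ?N * unit_ball_vol ?N"
  have N: "?N > 0" by simp
  have C: "?C \<ge> 0" by (simp add: unit_ball_vol_nonneg)
  have "(\<integral>\<^sup>+x. ennreal (norm (indicator {..1} (norm (x::'a)) * norm x powr (a - real ?N))) \<partial>lborel)
    = (\<integral>\<^sup>+x. ennreal (indicator {..1} (norm (x::'a)) * norm x powr (a - real ?N)) \<partial>lborel)"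
    by (intro nn_integral_cong) auto
  also have "\<dots> = (\<integral>\<^sup>+r. ennreal (?C * r ^ (?N - 1)) * indicator {0..} r * ennreal (indicator {..1} r * r powr (a - real ?N)) \<partial>lborel)"
    by (subst nn_integral_radial[where f = "\<lambda>r. ennreal (indicator {..1} r * r powr (a - real ?N))"]) auto
  also have "\<dots> = (\<integral>\<^sup>+r. ennreal (?C * (indicator {0..1} r * r powr (a - 1))) \<partial>lborel)"
  proof (rule nn_integral_cong)
    fix r :: real
    show "ennreal (?C * r ^ (?N - 1)) * indicator {0..} r * ennreal (indicator {..1} r * r powr (a - real ?N))
      = ennreal (?C * (indicator {0..1} r * r powr (a - 1)))"
    proof (cases "0 < r \<and> r \<le> 1")
      case True
      have "r ^ (?N - 1) * r powr (a - real ?N) = r powr (a - 1)"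
        using True N by (simp add: powr_realpow[symmetric] powr_add[symmetric] of_nat_diff)
      then show ?thesis using True C
        by (simp add: ennreal_mult[symmetric] mult.assoc)
    next
      case False
      then show ?thesis by (cases "r = 0") (auto simp: indicator_def)
    qed
  qed
  also have "\<dots> = ennreal ?C * (\<integral>\<^sup>+r. ennreal (indicator {0..1} r * r powr (a - 1)) \<partial>lborel)"
    using C by (subst nn_integral_cmult[symmetric]) (auto simp: ennreal_mult[symmetric])
  also have "\<dots> < \<infinity>"
  proof -
    have "(\<lambda>r. r powr (a - 1)) integrable_on {0..1::real}"
      by (rule integrable_on_powr_from_0) (use assms in auto)
    then have "((\<lambda>r. r powr (a - 1)) has_integral (integral {0..1} (\<lambda>r. r powr (a - 1)))) {0..1::real}"
      by blast
    then have "((\<lambda>r. indicator {0..1} r * r powr (a - 1)) has_integral (integral {0..1} (\<lambda>r. r powr (a - 1)))) (UNIV::real set)"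
      by (subst (asm) has_integral_restrict_UNIV[symmetric]) (simp add: indicator_def of_bool_def if_distrib[where f = "\<lambda>c. c * _"] cong: if_cong)
    from nn_integral_has_integral_lborel[OF _ _ this]
    have "(\<integral>\<^sup>+r. ennreal (indicator {0..1} r * r powr (a - 1)) \<partial>lborel) = ennreal (integral {0..1} (\<lambda>r. r powr (a - 1)))"
      by auto
    then show ?thesis by (simp add: ennreal_mult_less_top)
  qed
  finally show "(\<integral>\<^sup>+x. ennreal (norm (indicator {..1} (norm (x::'a)) * norm x powr (a - real ?N))) \<partial>lborel) < \<infinity>" .
qed measurable

text \<open>The logarithm records that the kernel with \<open>s = 0\<close> only just fails to be
  integrable at the origin. Its growth as \<open>d\<close> shrinks is what
  \<open>sqnorm_le_L1\<close> exploits.\<close>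

lemma nn_integral_radial_annulus:
  assumes "0 < d" "d \<le> 1"
  shows "(\<integral>\<^sup>+x. ennreal (indicator {d..1} (norm (x::'a::euclidean_space)) * norm x powr (- real DIM('a))) \<partial>lborel)
    = ennreal (2 / log_const DIM('a) * ln (1 / d))"
proof -
  let ?N = "DIM('a)"
  let ?C = "real ?N * unit_ball_vol ?N"
  have N: "?N > 0" by simp
  have C: "?C \<ge> 0" by (simp add: unit_ball_vol_nonneg)
  have "(\<integral>\<^sup>+x. ennreal (indicator {d..1} (norm (x::'a)) * norm x powr (- real ?N)) \<partial>lborel)
    = (\<integral>\<^sup>+r. ennreal (?C * r ^ (?N - 1)) * indicator {0..} r * ennreal (indicator {d..1} r * r powr (- real ?N)) \<partial>lborel)"
    by (subst nn_integral_radial[where f = "\<lambda>r. ennreal (indicator {d..1} r * r powr (- real ?N))"]) auto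
  also have "\<dots> = (\<integral>\<^sup>+r. ennreal (?C * (1 / r)) * indicator {d..1} r \<partial>lborel)"
  proof (rule nn_integral_cong)
    fix r :: real
    show "ennreal (?C * r ^ (?N - 1)) * indicator {0..} r * ennreal (indicator {d..1} r * r powr (- real ?N))
      = ennreal (?C * (1 / r)) * indicator {d..1} r"
    proof (cases "d \<le> r \<and> r \<le> 1")
      case True
      have "r ^ (?N - 1) * r powr (- real ?N) = r powr (- 1)"
        using True N assms by (simp add: powr_realpow[symmetric] powr_add[symmetric] of_nat_diff)
      also have "\<dots> = 1 / r" using True assms by (simp add: powr_minus_divide)
      finally show ?thesis using True C assms
        by (simp add: ennreal_mult[symmetric] mult.assoc del: times_divide_eq_right)
    next
      case False
      then show ?thesis by (auto simp: indicator_def)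
    qed
  qed
  also have "\<dots> = ennreal (?C * ln 1 - ?C * ln d)"
    by (rule nn_integral_FTC_Icc[where F = "\<lambda>r. ?C * ln r"])
       (use assms C in \<open>auto intro!: derivative_eq_intros\<close>)
  also have "?C * ln 1 - ?C * ln d = 2 / log_const ?N * ln (1 / d)"
    using unit_ball_vol_log_const[where 'a='a] log_const_pos[OF N] assms by (simp add: ln_div field_simps)
  finally show ?thesis .
qed

section \<open>Near and far energies\<close>

lemma borel_measurable_compose_diff:
  assumes [measurable]: "u \<in> borel_measurable borel"
  shows "(\<lambda>p::'a::euclidean_space \<times> 'a. u (fst p - snd p)) \<in> borel_measurable borel"
  unfolding borel_prod[symmetric] by measurable

lemma measurable_swap_borel [measurable]:
  "(\<lambda>p::'a::euclidean_space \<times> 'a. (snd p, fst p)) \<in> borel \<rightarrow>\<^sub>M borel"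
  by (auto intro!: borel_measurable_continuous_onI continuous_intros)

lemma nn_integral_lborel_fst:
  fixes f :: "'a::euclidean_space \<times> 'a \<Rightarrow> ennreal"
  assumes [measurable]: "f \<in> borel_measurable borel"
  shows "(\<integral>\<^sup>+p. f p \<partial>lborel) = (\<integral>\<^sup>+x. (\<integral>\<^sup>+y. f (x, y) \<partial>lborel) \<partial>lborel)"
proof -
  have "f \<in> borel_measurable (lborel \<Otimes>\<^sub>M lborel)"
    unfolding lborel_prod by simp
  from lborel.nn_integral_fst[OF this, symmetric] show ?thesis
    unfolding lborel_prod .
qed

lemma nn_integral_lborel_snd:
  fixes f :: "'a::euclidean_space \<times> 'a \<Rightarrow> ennreal"
  assumes [measurable]: "f \<in> borel_measurable borel"
  shows "(\<integral>\<^sup>+p. f p \<partial>lborel) = (\<integral>\<^sup>+y. (\<integral>\<^sup>+x. f (x, y) \<partial>lborel) \<partial>lborel)"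
proof -
  have "(\<lambda>(x, y). f (x, y)) \<in> borel_measurable (lborel \<Otimes>\<^sub>M lborel)"
    unfolding lborel_prod by simp
  from lborel_pair.nn_integral_snd[OF this, symmetric] show ?thesis
    unfolding lborel_prod by simp
qed

lemma nn_integral_lborel_translate:
  fixes f :: "'a::euclidean_space \<Rightarrow> ennreal"
  assumes [measurable]: "f \<in> borel_measurable borel"
  shows "(\<integral>\<^sup>+x. f (c + x) \<partial>lborel) = (\<integral>\<^sup>+x. f x \<partial>lborel)"
proof -
  have "(\<integral>\<^sup>+x. f x \<partial>lborel) = (\<integral>\<^sup>+x. f x \<partial>distr lborel borel ((+) c))"
    by (simp add: lborel_distr_plus)
  also have "\<dots> = (\<integral>\<^sup>+x. f (c + x) \<partial>lborel)"
    by (subst nn_integral_distr) auto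
  finally show ?thesis by simp
qed

lemma nn_integral_lborel_swap:
  fixes f :: "'a::euclidean_space \<times> 'a \<Rightarrow> ennreal"
  assumes [measurable]: "f \<in> borel_measurable borel"
  shows "(\<integral>\<^sup>+p. f (snd p, fst p) \<partial>lborel) = (\<integral>\<^sup>+p. f p \<partial>lborel)"
proof -
  have "(\<lambda>p::'a \<times> 'a. f (snd p, fst p)) \<in> borel_measurable borel"
    using measurable_compose[OF measurable_swap_borel assms] by simp
  then show ?thesis
    by (subst nn_integral_lborel_fst, simp, subst nn_integral_lborel_snd) auto
qed

lemma lborel_swap:
  "distr lborel borel (\<lambda>p::'a::euclidean_space \<times> 'a. (snd p, fst p)) = lborel"
proof (rule measure_eqI)
  fix X :: "('a \<times> 'a) set"
  assume "X \<in> sets (distr lborel borel (\<lambda>p::'a \<times> 'a. (snd p, fst p)))"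
  then have [measurable]: "X \<in> sets borel" by simp
  have "emeasure (distr lborel borel (\<lambda>p::'a \<times> 'a. (snd p, fst p))) X
      = (\<integral>\<^sup>+p. indicator X (snd p, fst p) \<partial>lborel)"
    by (subst nn_integral_indicator[symmetric], simp, subst nn_integral_distr) auto
  also have "\<dots> = emeasure lborel X"
    by (subst nn_integral_lborel_swap) auto
  finally show "emeasure (distr lborel borel (\<lambda>p::'a \<times> 'a. (snd p, fst p))) X = emeasure lborel X" .
qed simp

lemma integral_lborel_swap:
  fixes f :: "'a::euclidean_space \<times> 'a \<Rightarrow> real"
  assumes [measurable]: "f \<in> borel_measurable borel"
  shows "(LBINT p. f (snd p, fst p)) = (LBINT p. f p)"
    and "integrable lborel (\<lambda>p. f (snd p, fst p)) \<longleftrightarrow> integrable lborel f"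
proof -
  show "(LBINT p. f (snd p, fst p)) = (LBINT p. f p)"
    by (subst (2) lborel_swap[symmetric], subst integral_distr) auto
  show "integrable lborel (\<lambda>p. f (snd p, fst p)) \<longleftrightarrow> integrable lborel f"
    by (subst (2) lborel_swap[symmetric], subst integrable_distr_eq) auto
qed

lemma nn_integral_radial_conv:
  fixes f :: "'a::euclidean_space \<Rightarrow> ennreal" and G :: "real \<Rightarrow> ennreal"
  assumes [measurable]: "f \<in> borel_measurable borel" "G \<in> borel_measurable borel"
  shows "(\<integral>\<^sup>+p. f (fst p) * G (norm (fst p - snd p)) \<partial>lborel)
    = (\<integral>\<^sup>+x. f x \<partial>lborel) * (\<integral>\<^sup>+z. G (norm (z::'a)) \<partial>lborel)"
proof -
  have [measurable]: "(\<lambda>p. f (fst p) * G (norm (fst p - snd p))) \<in> borel_measurable borel"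
    unfolding borel_prod[symmetric] by measurable
  have "(\<integral>\<^sup>+p. f (fst p) * G (norm (fst p - snd p)) \<partial>lborel)
    = (\<integral>\<^sup>+x. (\<integral>\<^sup>+y. f x * G (norm (- x + y)) \<partial>lborel) \<partial>lborel)"
    by (subst nn_integral_lborel_fst) (auto simp: norm_minus_commute)
  also have "\<dots> = (\<integral>\<^sup>+x. f x * (\<integral>\<^sup>+y. G (norm (- x + y)) \<partial>lborel) \<partial>lborel)"
    by (intro nn_integral_cong nn_integral_cmult) auto
  also have "\<dots> = (\<integral>\<^sup>+x. f x * (\<integral>\<^sup>+y. G (norm (y::'a)) \<partial>lborel) \<partial>lborel)"
    by (subst nn_integral_lborel_translate) auto
  also have "\<dots> = (\<integral>\<^sup>+x. f x \<partial>lborel) * (\<integral>\<^sup>+z. G (norm (z::'a)) \<partial>lborel)"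
    by (intro nn_integral_multc) auto
  finally show ?thesis .
qed

text \<open>Tonelli and translation invariance. Both positions of the weight are recorded because
  expanding the square of \<open>u x - u y\<close> produces a square in each variable.\<close>

lemma has_bochner_integral_radial_conv:
  fixes f :: "'a::euclidean_space \<Rightarrow> real" and G :: "real \<Rightarrow> real"
  assumes f: "integrable lborel f" "\<And>x. f x \<ge> 0"
    and [measurable]: "G \<in> borel_measurable borel"
    and G: "\<And>r. G r \<ge> 0" "(\<integral>\<^sup>+z. ennreal (G (norm (z::'a))) \<partial>lborel) = ennreal c" "c \<ge> 0"
  shows "has_bochner_integral lborel (\<lambda>p. f (fst p) * G (norm (fst p - snd p))) ((LBINT x. f x) * c)"
    and "has_bochner_integral lborel (\<lambda>p. f (snd p) * G (norm (fst p - snd p))) ((LBINT x. f x) * c)"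
proof -
  have [measurable]: "f \<in> borel_measurable borel"
    using f(1) by auto
  have [measurable]: "(\<lambda>p. f (fst p) * G (norm (fst p - snd p))) \<in> borel_measurable borel"
    unfolding borel_prod[symmetric] by measurable
  have "(\<integral>\<^sup>+p. ennreal (f (fst p) * G (norm (fst p - snd p))) \<partial>lborel)
     = (\<integral>\<^sup>+p. ennreal (f (fst p)) * ennreal (G (norm (fst p - snd p))) \<partial>lborel)"
    by (simp add: ennreal_mult f G)
  also have "\<dots> = (\<integral>\<^sup>+x. ennreal (f x) \<partial>lborel) * ennreal c"
    by (subst nn_integral_radial_conv[where f = "\<lambda>x. ennreal (f x)" and G = "\<lambda>r. ennreal (G r)"]) (auto simp: G)
  also have "\<dots> = ennreal ((LBINT x. f x) * c)"
    by (subst nn_integral_eq_integral) (auto simp: f G ennreal_mult integral_nonneg_AE)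
  finally show *: "has_bochner_integral lborel (\<lambda>p. f (fst p) * G (norm (fst p - snd p))) ((LBINT x. f x) * c)"
    by (intro has_bochner_integral_nn_integral) (auto simp: f G integral_nonneg_AE)
  show "has_bochner_integral lborel (\<lambda>p. f (snd p) * G (norm (fst p - snd p))) ((LBINT x. f x) * c)"
    using * unfolding has_bochner_integral_iff
    using integral_lborel_swap[where f = "\<lambda>p. f (fst p) * G (norm (fst p - snd p))"]
    by (simp add: norm_minus_commute)
qed

lemma has_bochner_integral_prod_lborel:
  fixes f g :: "'a::euclidean_space \<Rightarrow> real"
  assumes f: "integrable lborel f" and g: "integrable lborel g"
  shows "has_bochner_integral lborel (\<lambda>p. f (fst p) * g (snd p)) ((LBINT x. f x) * (LBINT x. g x))"
proof -
  have [measurable]: "f \<in> borel_measurable borel" "g \<in> borel_measurable borel"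
    using f g by auto
  have i: "integrable (lborel \<Otimes>\<^sub>M lborel) (\<lambda>p. f (fst p) * g (snd p))"
  proof (rule lborel_pair.Fubini_integrable)
    show "(\<lambda>p. f (fst p) * g (snd p)) \<in> borel_measurable (lborel \<Otimes>\<^sub>M lborel)"
      by measurable
    show "integrable lborel (\<lambda>x. LBINT y. norm (f (fst (x, y)) * g (snd (x, y))))"
      using f by (simp add: abs_mult)
    show "AE x in lborel. integrable lborel (\<lambda>y. f (fst (x, y)) * g (snd (x, y)))"
      using g by simp
  qed
  have "(\<integral>p. f (fst p) * g (snd p) \<partial>(lborel \<Otimes>\<^sub>M lborel)) = (LBINT x. f x) * (LBINT x. g x)"
    by (subst lborel_pair.integral_fst'[OF i, symmetric]) simp
  then show ?thesis
    using i unfolding has_bochner_integral_iff lborel_prod by simp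
qed

text \<open>With a negative \<open>powr\<close> the value at the origin is 0, which agrees with the
  division by zero on the diagonal in the forms. The case \<open>s = 0\<close> is the logarithmic
  kernel.\<close>

definition rkern :: "real \<Rightarrow> 'a::euclidean_space \<Rightarrow> real" where
  "rkern s z = norm z powr (- (real DIM('a) + 2 * s))"

definition near_density :: "real \<Rightarrow> ('a::euclidean_space \<Rightarrow> real) \<Rightarrow> 'a \<times> 'a \<Rightarrow> real" where
  "near_density s u p = indicator {..1} (norm (fst p - snd p)) * (u (fst p) - u (snd p))\<^sup>2 * rkern s (fst p - snd p)"

text \<open>The strict inequality makes near and far a partition of all pairs, whereas the two
  regions in \<open>log_form\<close> overlap where the distance is exactly 1, a null set.\<close>

definition far_density :: "real \<Rightarrow> ('a::euclidean_space \<Rightarrow> real) \<Rightarrow> ('a \<Rightarrow> real) \<Rightarrow> 'a \<times> 'a \<Rightarrow> real" where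
  "far_density s u w p = indicator {1<..} (norm (fst p - snd p)) * (u (fst p) * w (snd p)) * rkern s (fst p - snd p)"

definition near_energy :: "real \<Rightarrow> ('a::euclidean_space \<Rightarrow> real) \<Rightarrow> real" where
  "near_energy s u = (LBINT p. near_density s u p)"

definition far_energy :: "real \<Rightarrow> ('a::euclidean_space \<Rightarrow> real) \<Rightarrow> ('a \<Rightarrow> real) \<Rightarrow> real" where
  "far_energy s u w = (LBINT p. far_density s u w p)"

lemma rkern_nonneg [simp]: "rkern s z \<ge> 0"
  by (simp add: rkern_def)

lemma rkern_minus_commute: "rkern s (x - y) = rkern s (y - x)"
  by (simp add: rkern_def norm_minus_commute)

lemma borel_measurable_rkern [measurable]: "rkern s \<in> borel_measurable borel"
  unfolding rkern_def by measurable

lemma near_density_nonneg: "near_density s u p \<ge> 0"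
  by (simp add: near_density_def)

lemma near_energy_nonneg: "near_energy s u \<ge> 0"
  by (simp add: near_energy_def near_density_nonneg integral_nonneg_AE)

lemma borel_measurable_near_density [measurable]:
  assumes [measurable]: "u \<in> borel_measurable borel"
  shows "near_density s u \<in> borel_measurable borel"
  unfolding near_density_def borel_prod[symmetric] by measurable

lemma borel_measurable_far_density [measurable]:
  assumes [measurable]: "u \<in> borel_measurable borel" "w \<in> borel_measurable borel"
  shows "far_density s u w \<in> borel_measurable borel"
  unfolding far_density_def borel_prod[symmetric] by measurable

lemma far_kernel_bounds:
  assumes "0 \<le> s"
  shows "0 \<le> indicator {1<..} (norm z) * rkern s z" "indicator {1<..} (norm z) * rkern s z \<le> 1"
proof -
  show "0 \<le> indicator {1<..} (norm z) * rkern s z" by simp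
  show "indicator {1<..} (norm z) * rkern s z \<le> 1"
  proof (cases "norm z > 1")
    case True
    then have "norm z powr (- (real DIM('a) + 2 * s)) \<le> norm z powr 0"
      using assms by (intro powr_mono) auto
    then show ?thesis using True by (cases "z = 0") (auto simp: rkern_def)
  qed simp
qed

lemma integrable_far_density:
  assumes "0 \<le> s" "integrable lborel u" "integrable lborel w"
  shows "integrable lborel (far_density s u w)"
proof (rule Bochner_Integration.integrable_bound)
  have [measurable]: "u \<in> borel_measurable borel" "w \<in> borel_measurable borel" using assms by auto
  show "integrable lborel (\<lambda>p. \<bar>u (fst p) * w (snd p)\<bar>)"
    using has_bochner_integral_prod_lborel[of u w] assms by (intro integrable_abs) (auto simp: has_bochner_integral_iff)
  show "far_density s u w \<in> borel_measurable lborel" by simp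
  show "AE p in lborel. norm (far_density s u w p) \<le> norm \<bar>u (fst p) * w (snd p)\<bar>"
  proof (rule AE_I2)
    fix p :: "'a \<times> 'a"
    have "norm (far_density s u w p) = \<bar>u (fst p) * w (snd p)\<bar> * (indicator {1<..} (norm (fst p - snd p)) * rkern s (fst p - snd p))"
      by (simp add: far_density_def abs_mult)
    also have "\<dots> \<le> \<bar>u (fst p) * w (snd p)\<bar> * 1"
      by (intro mult_left_mono far_kernel_bounds assms) auto
    finally show "norm (far_density s u w p) \<le> norm \<bar>u (fst p) * w (snd p)\<bar>" by simp
  qed
qed

lemma far_energy_swap:
  assumes [measurable]: "u \<in> borel_measurable borel" "w \<in> borel_measurable borel"
  shows "far_energy s u w = far_energy s w u"
proof -
  have "(LBINT p. far_density s u w (snd p, fst p)) = far_energy s u w"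
    unfolding far_energy_def by (rule integral_lborel_swap) simp
  moreover have "far_density s u w (snd p, fst p) = far_density s w u p" for p
    by (simp add: far_density_def rkern_minus_commute[of s "snd p" "fst p"] norm_minus_commute mult.commute)
  ultimately show ?thesis by (simp add: far_energy_def)
qed

lemma far_energy_linear:
  assumes s: "0 \<le> s" and u: "integrable lborel u" and v: "integrable lborel v" and w: "integrable lborel w"
  shows "far_energy s (\<lambda>x. a * u x + b * v x) w = a * far_energy s u w + b * far_energy s v w"
proof -
  have "far_density s (\<lambda>x. a * u x + b * v x) w = (\<lambda>p. a * far_density s u w p + b * far_density s v w p)"
    by (rule ext) (simp add: far_density_def algebra_simps)
  then show ?thesis
    unfolding far_energy_def using integrable_far_density[OF s u w] integrable_far_density[OF s v w] by simp
qed

lemma far_energy_linear2: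
  assumes s: "0 \<le> s" and u: "integrable lborel u" and v: "integrable lborel v" and w: "integrable lborel w"
  shows "far_energy s w (\<lambda>x. a * u x + b * v x) = a * far_energy s w u + b * far_energy s w v"
proof -
  have "far_density s w (\<lambda>x. a * u x + b * v x) = (\<lambda>p. a * far_density s w u p + b * far_density s w v p)"
    by (rule ext) (simp add: far_density_def algebra_simps)
  then show ?thesis
    unfolding far_energy_def using integrable_far_density[OF s w u] integrable_far_density[OF s w v] by simp
qed

lemma abs_far_energy_le:
  assumes s: "0 \<le> s" and u: "integrable lborel u" and w: "integrable lborel w"
  shows "\<bar>far_energy s u w\<bar> \<le> (LBINT x. \<bar>u x\<bar>) * (LBINT x. \<bar>w x\<bar>)"
proof -
  have hb: "has_bochner_integral lborel (\<lambda>p. \<bar>u (fst p)\<bar> * \<bar>w (snd p)\<bar>) ((LBINT x. \<bar>u x\<bar>) * (LBINT x. \<bar>w x\<bar>))"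
    using u w by (intro has_bochner_integral_prod_lborel) auto
  have "\<bar>far_energy s u w\<bar> \<le> (LBINT p. \<bar>far_density s u w p\<bar>)"
    unfolding far_energy_def by (rule integral_abs_bound)
  also have "\<dots> \<le> (LBINT p. \<bar>u (fst p)\<bar> * \<bar>w (snd p)\<bar>)"
  proof (rule integral_mono)
    show "integrable lborel (\<lambda>p. \<bar>far_density s u w p\<bar>)"
      using integrable_far_density[OF s u w] by simp
    show "integrable lborel (\<lambda>p. \<bar>u (fst p)\<bar> * \<bar>w (snd p)\<bar>)"
      using hb by (simp add: has_bochner_integral_iff)
    fix p :: "'a \<times> 'a"
    have "\<bar>far_density s u w p\<bar> = \<bar>u (fst p)\<bar> * \<bar>w (snd p)\<bar> * (indicator {1<..} (norm (fst p - snd p)) * rkern s (fst p - snd p))"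
      by (simp add: far_density_def abs_mult)
    also have "\<dots> \<le> \<bar>u (fst p)\<bar> * \<bar>w (snd p)\<bar> * 1"
      by (intro mult_left_mono far_kernel_bounds s) auto
    finally show "\<bar>far_density s u w p\<bar> \<le> \<bar>u (fst p)\<bar> * \<bar>w (snd p)\<bar>" by simp
  qed
  also have "\<dots> = (LBINT x. \<bar>u x\<bar>) * (LBINT x. \<bar>w x\<bar>)"
    using hb by (simp add: has_bochner_integral_iff)
  finally show ?thesis .
qed

lemma rkern_mono_near:
  assumes "s \<le> t" "norm z \<le> 1"
  shows "rkern s z \<le> rkern t z"
proof (cases "z = 0")
  case False
  with assms show ?thesis unfolding rkern_def by (intro powr_mono') auto
qed (simp add: rkern_def)

lemma near_density_mono:
  assumes "s \<le> t"
  shows "near_density s u p \<le> near_density t u p"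
  unfolding near_density_def
  by (auto simp: indicator_def intro!: mult_left_mono rkern_mono_near assms)

lemma integrable_near_density_mono:
  assumes "s \<le> t" "integrable lborel (near_density t u)" and [measurable]: "u \<in> borel_measurable borel"
  shows "integrable lborel (near_density s u)" "near_energy s u \<le> near_energy t u"
proof -
  show *: "integrable lborel (near_density s u)"
    by (rule Bochner_Integration.integrable_bound[OF assms(2)])
       (use near_density_mono[OF assms(1), of u] in \<open>auto simp: near_density_nonneg\<close>)
  show "near_energy s u \<le> near_energy t u"
    unfolding near_energy_def by (rule integral_mono[OF * assms(2)]) (rule near_density_mono[OF assms(1)])
qed

text \<open>For fixed \<open>z\<close> the kernel is an exponential function of \<open>s\<close>,
  hence convex, and \<open>s\<close> lies at the fraction \<open>2 * s\<close> of the way from 0 to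
  \<open>1/2\<close>.\<close>

lemma rkern_le_convex:
  assumes "0 \<le> s" "s \<le> 1/2"
  shows "rkern s z \<le> (1 - 2 * s) * rkern 0 z + 2 * s * rkern (1/2) z"
proof (cases "z = 0")
  case False
  then have pos: "norm z > 0" by simp
  let ?f = "\<lambda>t. exp (- (real DIM('a) + 2 * t) * ln (norm z))"
  have "exp ((1 - 2 * s) *\<^sub>R (- real DIM('a) * ln (norm z)) + (2 * s) *\<^sub>R (- (real DIM('a) + 1) * ln (norm z)))
     \<le> (1 - 2 * s) * exp (- real DIM('a) * ln (norm z)) + 2 * s * exp (- (real DIM('a) + 1) * ln (norm z))"
    by (rule convex_onD[OF exp_convex]) (use assms in auto)
  then show ?thesis using pos unfolding rkern_def powr_def by (simp add: algebra_simps)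
qed (simp add: rkern_def)

lemma near_energy_le_convex:
  assumes "0 \<le> s" "s \<le> 1/2" "integrable lborel (near_density (1/2) u)" and [measurable]: "u \<in> borel_measurable borel"
  shows "near_energy s u \<le> near_energy 0 u + 2 * s * near_energy (1/2) u"
proof -
  note i0 = integrable_near_density_mono(1)[of 0 "1/2", OF _ assms(3,4)]
  note i1 = integrable_near_density_mono(1)[OF assms(2,3,4)]
  have "near_density s u p \<le> near_density 0 u p + 2 * s * near_density (1/2) u p" for p
  proof -
    let ?z = "fst p - snd p"
    let ?c = "indicator {..1} (norm ?z) * (u (fst p) - u (snd p))\<^sup>2"
    have "rkern s ?z \<le> (1 - 2 * s) * rkern 0 ?z + 2 * s * rkern (1/2) ?z"
      by (rule rkern_le_convex[OF assms(1,2)])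
    also have "\<dots> \<le> rkern 0 ?z + 2 * s * rkern (1/2) ?z"
      using assms by (intro add_right_mono mult_left_le_one_le) auto
    finally have "?c * rkern s ?z \<le> ?c * (rkern 0 ?z + 2 * s * rkern (1/2) ?z)"
      by (intro mult_left_mono) auto
    then show ?thesis by (simp add: near_density_def algebra_simps)
  qed
  then have "near_energy s u \<le> (LBINT p. near_density 0 u p + 2 * s * near_density (1/2) u p)"
    unfolding near_energy_def using assms(3) i0 i1 by (intro integral_mono) auto
  also have "\<dots> = near_energy 0 u + 2 * s * near_energy (1/2) u"
    unfolding near_energy_def using assms(3) i0 by simp
  finally show ?thesis .
qed

section \<open>Borel versions of Lebesgue measurable functions\<close>

lemma measurable_lebesgue_AE:
  fixes f g :: "'b::euclidean_space \<Rightarrow> real"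
  assumes g: "g \<in> borel_measurable borel" and eq: "AE x in lborel. f x = g x"
  shows "f \<in> borel_measurable lebesgue"
proof (rule measurableI)
  fix A :: "real set"
  assume A: "A \<in> sets borel"
  have "g -` A \<in> sets borel"
    using measurable_sets[OF g A] by simp
  then have *: "g -` A \<in> sets lebesgue"
    by simp
  have "AE x in lebesgue. x \<in> g -` A \<longleftrightarrow> x \<in> f -` A"
    using AE_completion[OF eq] by eventually_elim auto
  from completion.in_sets_AE[OF this *] show "f -` A \<inter> space lebesgue \<in> sets lebesgue"
    by simp
qed simp

text \<open>The bridge between the definitions, which integrate over \<open>lebesgue\<close>, and
  the proof, which works with product measures and therefore with Borel functions over
  \<open>lborel\<close>.\<close>

lemma lebesgue_integral_AE_borel:
  fixes f g :: "'b::euclidean_space \<Rightarrow> real"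
  assumes g: "g \<in> borel_measurable borel" and eq: "AE x in lborel. f x = g x"
  shows "(LINT x|lebesgue. f x) = (LBINT x. g x)"
    and "integrable lebesgue f \<longleftrightarrow> integrable lborel g"
proof -
  note f = measurable_lebesgue_AE[OF assms]
  have g': "g \<in> borel_measurable lebesgue" "g \<in> borel_measurable lborel" using g by (auto intro: measurable_completion)
  show "(LINT x|lebesgue. f x) = (LBINT x. g x)"
    using integral_cong_AE[OF f g'(1) AE_completion[OF eq]] integral_completion[OF g'(2)] by simp
  show "integrable lebesgue f \<longleftrightarrow> integrable lborel g"
    using integrable_cong_AE[OF f g'(1) AE_completion[OF eq]] integrable_completion[OF g'(2)] by simp
qed

text \<open>A null set of points spoils only a null set of pairs, so double integrals do not see the
  choice of a version.\<close>

lemma AE_lborel_pair: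
  fixes P :: "'a::euclidean_space \<Rightarrow> bool"
  assumes "AE x in lborel. P x"
  shows "AE p in (lborel :: ('a \<times> 'a) measure). P (fst p) \<and> P (snd p)"
proof -
  obtain N where N: "\<And>x. x \<in> space lborel - N \<Longrightarrow> P x" "N \<in> null_sets (lborel :: 'a measure)"
    using AE_E3[OF assms] by blast
  have [measurable]: "N \<in> sets borel" using N(2) by auto
  have m: "{p \<in> space (lborel \<Otimes>\<^sub>M lborel). fst p \<notin> N \<and> snd p \<notin> N} \<in> sets (lborel \<Otimes>\<^sub>M (lborel :: 'a measure))"
    by measurable
  have "AE x in lborel. x \<notin> N" by (rule AE_not_in[OF N(2)])
  then have "AE x in lborel. AE y in lborel. fst (x, y) \<notin> N \<and> snd (x, y) \<notin> N"
    by eventually_elim (use AE_not_in[OF N(2)] in auto)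
  from lborel_pair.AE_pair_measure[OF m this]
  have "AE p in (lborel :: ('a \<times> 'a) measure). fst p \<notin> N \<and> snd p \<notin> N"
    unfolding lborel_prod .
  then show ?thesis by eventually_elim (use N(1) in auto)
qed

lemma AE_lborel_norm_diff_neq_1:
  "AE p in (lborel :: ('a::euclidean_space \<times> 'a) measure). norm (fst p - snd p) \<noteq> 1"
proof -
  have m: "{p \<in> space (lborel \<Otimes>\<^sub>M lborel). norm (fst p - snd p) \<noteq> 1} \<in> sets (lborel \<Otimes>\<^sub>M (lborel :: 'a measure))"
    by measurable
  have "AE y in lborel. norm (fst (x, y) - snd (x, y)) \<noteq> 1" for x :: 'a
  proof (rule AE_I')
    show "sphere x 1 \<in> null_sets lborel"
      using negligible_sphere[of x 1] by (auto simp: negligible_iff_null_sets null_sets_completion_iff)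
  qed (auto simp: dist_norm)
  then have "AE x in lborel. AE y in lborel. norm (fst (x, y) - snd (x, y :: 'a)) \<noteq> 1"
    by simp
  from lborel_pair.AE_pair_measure[OF m this] show ?thesis
    unfolding lborel_prod .
qed

lemma borel_version_vanishing:
  fixes u :: "'a::euclidean_space \<Rightarrow> real"
  assumes "u \<in> borel_measurable lebesgue" "AE x in lebesgue. x \<notin> \<Omega> \<longrightarrow> u x = 0" "open \<Omega>"
  obtains g where "g \<in> borel_measurable borel" "\<And>x. x \<notin> \<Omega> \<Longrightarrow> g x = 0" "AE x in lborel. u x = g x"
proof -
  obtain g where g: "g \<in> borel_measurable lborel" "AE x in lborel. u x = g x"
    using completion_ex_borel_measurable_real[OF assms(1)] by auto
  have [measurable]: "g \<in> borel_measurable borel" "\<Omega> \<in> sets borel" using g assms by auto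
  show thesis
  proof
    \<comment> \<open>The indicator turns vanishing almost everywhere outside the domain into
      vanishing at every point there, and changes \<open>g\<close> only on a null set.\<close>
    show "(\<lambda>x. indicator \<Omega> x * g x) \<in> borel_measurable borel" by measurable
    show "AE x in lborel. u x = indicator \<Omega> x * g x"
      using g(2) assms(2)[unfolded AE_completion_iff] by eventually_elim (auto simp: indicator_def)
  qed auto
qed

text \<open>Representatives that are Borel and vanish at every point outside the domain. Each
  normalized function in the two variational problems agrees almost everywhere with one of
  them.\<close>

definition L2_zero :: "'a::euclidean_space set \<Rightarrow> ('a \<Rightarrow> real) set" where
  "L2_zero \<Omega> = {u. u \<in> borel_measurable borel \<and> (\<forall>x. x \<notin> \<Omega> \<longrightarrow> u x = 0) \<and> integrable lborel (\<lambda>x. (u x)\<^sup>2)}"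

definition sqnorm :: "('a::euclidean_space \<Rightarrow> real) \<Rightarrow> real" where
  "sqnorm u = (LBINT x. (u x)\<^sup>2)"

definition near_cross :: "('a::euclidean_space \<Rightarrow> real) \<Rightarrow> ('a \<Rightarrow> real) \<Rightarrow> 'a \<times> 'a \<Rightarrow> real" where
  "near_cross u w p = indicator {..1} (norm (fst p - snd p)) * ((u (fst p) - u (snd p)) * (w (fst p) - w (snd p))) * rkern 0 (fst p - snd p)"

text \<open>The factor called kappa in the overview: the fractional constant times the mass
  \<open>1 / (s * log_const N)\<close> of the kernel tail.\<close>

definition frac_ratio :: "nat \<Rightarrow> real \<Rightarrow> real" where
  "frac_ratio N s = frac_const N s / (s * log_const N)"

lemma near_cross_self: "near_cross u u = near_density 0 u"
  by (rule ext) (simp add: near_cross_def near_density_def power2_eq_square)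

lemma borel_measurable_near_cross [measurable]:
  assumes [measurable]: "u \<in> borel_measurable borel" "w \<in> borel_measurable borel"
  shows "near_cross u w \<in> borel_measurable borel"
  unfolding near_cross_def borel_prod[symmetric] by measurable

lemma sqnorm_nonneg: "sqnorm u \<ge> 0"
  by (simp add: sqnorm_def integral_nonneg_AE)

lemma abs_mult_le_sum_squares: "\<bar>a * b :: real\<bar> \<le> a\<^sup>2 + b\<^sup>2"
proof -
  have "2 * (\<bar>a\<bar> * \<bar>b\<bar>) \<le> a\<^sup>2 + b\<^sup>2"
    using sum_squares_bound[of "\<bar>a\<bar>" "\<bar>b\<bar>"] by (simp add: mult.assoc)
  moreover have "0 \<le> \<bar>a\<bar> * \<bar>b\<bar>" by simp
  ultimately show ?thesis unfolding abs_mult by linarith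
qed

lemma integrable_near_cross:
  assumes "integrable lborel (near_density 0 u)" "integrable lborel (near_density 0 w)"
    and [measurable]: "u \<in> borel_measurable borel" "w \<in> borel_measurable borel"
  shows "integrable lborel (near_cross u w)"
proof (rule Bochner_Integration.integrable_bound)
  show "integrable lborel (\<lambda>p. near_density 0 u p + near_density 0 w p)"
    using assms by simp
  show "AE p in lborel. norm (near_cross u w p) \<le> norm (near_density 0 u p + near_density 0 w p)"
  proof (rule AE_I2)
    fix p :: "'a \<times> 'a"
    let ?a = "u (fst p) - u (snd p)" and ?b = "w (fst p) - w (snd p)"
    let ?c = "indicator {..1} (norm (fst p - snd p)) * rkern 0 (fst p - snd p)"
    have "\<bar>?a * ?b\<bar> \<le> ?a\<^sup>2 + ?b\<^sup>2"
      by (rule abs_mult_le_sum_squares)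
    then have "?c * \<bar>?a * ?b\<bar> \<le> ?c * (?a\<^sup>2 + ?b\<^sup>2)"
      by (intro mult_left_mono) auto
    moreover have "\<bar>near_cross u w p\<bar> = ?c * \<bar>?a * ?b\<bar>"
      by (simp add: near_cross_def abs_mult)
    moreover have "near_density 0 u p + near_density 0 w p = ?c * (?a\<^sup>2 + ?b\<^sup>2)"
      by (simp add: near_density_def algebra_simps)
    ultimately show "norm (near_cross u w p) \<le> norm (near_density 0 u p + near_density 0 w p)"
      by simp
  qed
qed measurable

lemma near_density_add_le:
  "near_density s (\<lambda>x. a * u x + b * w x) p \<le> 2 * a\<^sup>2 * near_density s u p + 2 * b\<^sup>2 * near_density s w p"
proof -
  let ?a = "a * (u (fst p) - u (snd p))" and ?b = "b * (w (fst p) - w (snd p))"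
  let ?c = "indicator {..1} (norm (fst p - snd p)) * rkern s (fst p - snd p)"
  have "(?a + ?b)\<^sup>2 \<le> 2 * ?a\<^sup>2 + 2 * ?b\<^sup>2"
    using sum_squares_bound[of ?a ?b] by (simp add: power2_sum)
  then have "?c * (?a + ?b)\<^sup>2 \<le> ?c * (2 * ?a\<^sup>2 + 2 * ?b\<^sup>2)"
    by (intro mult_left_mono) auto
  moreover have "a * u (fst p) + b * w (fst p) - (a * u (snd p) + b * w (snd p)) = ?a + ?b"
    by (simp add: algebra_simps)
  then have "near_density s (\<lambda>x. a * u x + b * w x) p = ?c * (?a + ?b)\<^sup>2"
    by (simp add: near_density_def)
  moreover have "2 * a\<^sup>2 * near_density s u p + 2 * b\<^sup>2 * near_density s w p = ?c * (2 * ?a\<^sup>2 + 2 * ?b\<^sup>2)"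
    by (simp add: near_density_def power_mult_distrib distrib_left mult_ac)
  ultimately show ?thesis by simp
qed

lemma integrable_near_density_linear:
  assumes "integrable lborel (near_density s u)" "integrable lborel (near_density s w)"
    and [measurable]: "u \<in> borel_measurable borel" "w \<in> borel_measurable borel"
  shows "integrable lborel (near_density s (\<lambda>x. a * u x + b * w x))"
proof (rule Bochner_Integration.integrable_bound)
  show "integrable lborel (\<lambda>p. 2 * a\<^sup>2 * near_density s u p + 2 * b\<^sup>2 * near_density s w p)"
    using assms by simp
  show "AE p in lborel. norm (near_density s (\<lambda>x. a * u x + b * w x) p)
      \<le> norm (2 * a\<^sup>2 * near_density s u p + 2 * b\<^sup>2 * near_density s w p)"
    using near_density_add_le[of s a u b w] by (intro AE_I2) (simp add: near_density_nonneg)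
qed measurable

lemma near_energy_mult: "near_energy s (\<lambda>x. a * u x) = a\<^sup>2 * near_energy s u"
proof -
  have "near_density s (\<lambda>x. a * u x) = (\<lambda>p. a\<^sup>2 * near_density s u p)"
  proof
    fix p :: "'a \<times> 'a"
    have "a * u (fst p) - a * u (snd p) = a * (u (fst p) - u (snd p))" by (simp add: algebra_simps)
    then show "near_density s (\<lambda>x. a * u x) p = a\<^sup>2 * near_density s u p"
      by (simp add: near_density_def power_mult_distrib)
  qed
  then show ?thesis by (simp add: near_energy_def)
qed

section \<open>Square integrable functions on a bounded open set\<close>

locale bounded_open_set =
  fixes \<Omega> :: "'a::euclidean_space set"
  assumes open_dom: "open \<Omega>" and bounded_dom: "bounded \<Omega>" and nonempty_dom: "\<Omega> \<noteq> {}"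
begin

text \<open>The maximum with 1 keeps negative powers of \<open>diam\<close> at most 1, also on
  domains of small diameter.\<close>

definition "diam = max 1 (diameter \<Omega>)"
definition "vol = measure lborel \<Omega>"

lemma diam_ge_1: "diam \<ge> 1" by (simp add: diam_def)

lemma norm_diff_le_diam: "x \<in> \<Omega> \<Longrightarrow> y \<in> \<Omega> \<Longrightarrow> norm (x - y) \<le> diam"
  using diameter_bounded_bound[OF bounded_dom, of x y] by (simp add: diam_def dist_norm)

lemma sets_dom [measurable]: "\<Omega> \<in> sets borel" using open_dom by simp

lemma emeasure_dom: "emeasure lborel \<Omega> = ennreal vol"
  unfolding vol_def using emeasure_bounded_finite[OF bounded_dom] by (simp add: emeasure_eq_ennreal_measure)

lemma vol_pos: "vol > 0"
proof -
  have "emeasure lborel \<Omega> \<noteq> 0"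
    using open_dom nonempty_dom emeasure_lborel_ball_finite
    by (metis open_not_negligible negligible_iff_null_sets null_sets_completion_iff null_setsI sets_dom sets_lborel)
  then show ?thesis
    using emeasure_dom by (metis ennreal_0 measure_nonneg vol_def less_eq_real_def)
qed

lemma integrable_indicator_dom: "integrable lborel (indicator \<Omega> :: 'a \<Rightarrow> real)"
  using emeasure_dom by (intro integrable_real_indicator) auto

lemma L2_zeroD:
  assumes "u \<in> L2_zero \<Omega>"
  shows "u \<in> borel_measurable borel" "x \<notin> \<Omega> \<Longrightarrow> u x = 0" "integrable lborel (\<lambda>x. (u x)\<^sup>2)"
  using assms by (auto simp: L2_zero_def)

lemma L2_zero_dominated:
  assumes u: "u \<in> L2_zero \<Omega>" and [measurable]: "w \<in> borel_measurable borel" and le: "\<And>x. \<bar>w x\<bar> \<le> \<bar>u x\<bar>"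
  shows "w \<in> L2_zero \<Omega>"
proof -
  have "integrable lborel (\<lambda>x. (w x)\<^sup>2)"
    by (rule Bochner_Integration.integrable_bound[OF L2_zeroD(3)[OF u]]) (use le in \<open>auto simp: abs_le_square_iff\<close>)
  moreover have "w x = 0" if "x \<notin> \<Omega>" for x using le[of x] L2_zeroD(2)[OF u that] by simp
  ultimately show ?thesis by (auto simp: L2_zero_def)
qed

lemma L2_zero_linear:
  assumes u: "u \<in> L2_zero \<Omega>" and w: "w \<in> L2_zero \<Omega>"
  shows "(\<lambda>x. a * u x + b * w x) \<in> L2_zero \<Omega>"
proof -
  have [measurable]: "u \<in> borel_measurable borel" "w \<in> borel_measurable borel" using u w by (auto dest: L2_zeroD)
  have "integrable lborel (\<lambda>x. (a * u x + b * w x)\<^sup>2)"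
  proof (rule Bochner_Integration.integrable_bound)
    show "integrable lborel (\<lambda>x. 2 * a\<^sup>2 * (u x)\<^sup>2 + 2 * b\<^sup>2 * (w x)\<^sup>2)"
      using L2_zeroD(3)[OF u] L2_zeroD(3)[OF w] by simp
    have "(a * u x + b * w x)\<^sup>2 \<le> 2 * a\<^sup>2 * (u x)\<^sup>2 + 2 * b\<^sup>2 * (w x)\<^sup>2" for x
      using sum_squares_bound[of "a * u x" "b * w x"] by (simp add: power2_sum power_mult_distrib)
    then show "AE x in lborel. norm ((a * u x + b * w x)\<^sup>2) \<le> norm (2 * a\<^sup>2 * (u x)\<^sup>2 + 2 * b\<^sup>2 * (w x)\<^sup>2)"
      by (intro AE_I2) simp
  qed measurable
  then show ?thesis using u w by (auto simp: L2_zero_def)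
qed

lemma L2_zero_mult: "u \<in> L2_zero \<Omega> \<Longrightarrow> (\<lambda>x. a * u x) \<in> L2_zero \<Omega>"
  using L2_zero_linear[of u u a 0] by simp

lemma sqnorm_mult: "sqnorm (\<lambda>x. a * u x) = a\<^sup>2 * sqnorm u"
  by (simp add: sqnorm_def power_mult_distrib)

lemma integrable_prod:
  assumes u: "u \<in> L2_zero \<Omega>" and w: "w \<in> L2_zero \<Omega>"
  shows "integrable lborel (\<lambda>x. u x * w x)"
proof (rule Bochner_Integration.integrable_bound)
  have [measurable]: "u \<in> borel_measurable borel" "w \<in> borel_measurable borel" using u w by (auto dest: L2_zeroD)
  show "(\<lambda>x. u x * w x) \<in> borel_measurable lborel" by measurable
  show "integrable lborel (\<lambda>x. (u x)\<^sup>2 + (w x)\<^sup>2)"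
    using L2_zeroD(3)[OF u] L2_zeroD(3)[OF w] by simp
  have "\<bar>u x * w x\<bar> \<le> (u x)\<^sup>2 + (w x)\<^sup>2" for x
    by (rule abs_mult_le_sum_squares)
  then show "AE x in lborel. norm (u x * w x) \<le> norm ((u x)\<^sup>2 + (w x)\<^sup>2)"
    by (intro AE_I2) simp
qed

lemma indicator_L2_zero: "indicator \<Omega> \<in> L2_zero \<Omega>"
proof -
  have "(\<lambda>x. (indicator \<Omega> x :: real)\<^sup>2) = indicator \<Omega>" by (auto simp: indicator_def)
  then show ?thesis using integrable_indicator_dom by (auto simp: L2_zero_def)
qed

lemma L2_zero_integrable:
  assumes u: "u \<in> L2_zero \<Omega>"
  shows "integrable lborel u" "integrable lborel (\<lambda>x. \<bar>u x\<bar>)"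
proof -
  have "(\<lambda>x. u x * indicator \<Omega> x) = u" using L2_zeroD(2)[OF u] by (auto simp: fun_eq_iff indicator_def)
  with integrable_prod[OF u indicator_L2_zero] show "integrable lborel u" by simp
  then show "integrable lborel (\<lambda>x. \<bar>u x\<bar>)" by simp
qed

lemma L1_le_L2:
  assumes u: "u \<in> L2_zero \<Omega>"
  shows "(LBINT x. \<bar>u x\<bar>)\<^sup>2 \<le> vol * sqnorm u"
proof -
  let ?a = "LBINT x. \<bar>u x\<bar>"
  \<comment> \<open>The mean of \<open>\<bar>u\<bar>\<close> over the domain, hence its projection
    onto constants. That the residual has nonnegative norm is the Cauchy-Schwarz inequality.\<close>
  let ?t = "?a / vol"
  have eq: "(\<bar>u x\<bar> - ?t * indicator \<Omega> x)\<^sup>2 = (u x)\<^sup>2 - 2 * ?t * \<bar>u x\<bar> + ?t\<^sup>2 * indicator \<Omega> x" for x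
    using L2_zeroD(2)[OF u, of x] by (cases "x \<in> \<Omega>") (auto simp: power2_diff)
  have "0 \<le> (LBINT x. (\<bar>u x\<bar> - ?t * indicator \<Omega> x)\<^sup>2)"
    by (intro integral_nonneg_AE) auto
  also have "\<dots> = sqnorm u - 2 * ?t * ?a + ?t\<^sup>2 * vol"
    unfolding eq using L2_zeroD(3)[OF u] L2_zero_integrable[OF u] integrable_indicator_dom
    by (simp add: sqnorm_def vol_def)
  also have "\<dots> = sqnorm u - ?a\<^sup>2 / vol"
    using vol_pos by (simp add: field_simps power2_eq_square)
  finally show ?thesis using vol_pos by (simp add: field_simps)
qed

lemma abs_far_energy_le_sqnorm:
  assumes "u \<in> L2_zero \<Omega>" "0 \<le> s"
  shows "\<bar>far_energy s u u\<bar> \<le> vol * sqnorm u"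
  using abs_far_energy_le[OF assms(2), of u u] L1_le_L2[OF assms(1)] L2_zero_integrable[OF assms(1)]
  by (simp add: power2_eq_square)

text \<open>Only pairs at distance at most \<open>diam\<close> contribute, so the far kernels converge uniformly.\<close>

lemma far_energy_diff_le:
  assumes u: "u \<in> L2_zero \<Omega>" and s: "0 \<le> s"
  shows "\<bar>far_energy s u u - far_energy 0 u u\<bar> \<le> (1 - diam powr (- 2 * s)) * (vol * sqnorm u)"
proof -
  note iu = L2_zero_integrable[OF u]
  have [measurable]: "u \<in> borel_measurable borel" using L2_zeroD[OF u] by simp
  let ?c = "1 - diam powr (- 2 * s)"
  have c: "?c \<ge> 0" using powr_mono[of "- 2 * s" 0 diam] diam_ge_1 s by auto
  have hb: "has_bochner_integral lborel (\<lambda>p. \<bar>u (fst p)\<bar> * \<bar>u (snd p)\<bar>) ((LBINT x. \<bar>u x\<bar>) * (LBINT x. \<bar>u x\<bar>))"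
    by (intro has_bochner_integral_prod_lborel iu)
  note i0 = integrable_far_density[OF order.refl iu(1) iu(1)] and i1 = integrable_far_density[OF s iu(1) iu(1)]
  have "\<bar>far_energy s u u - far_energy 0 u u\<bar> = \<bar>LBINT p. far_density s u u p - far_density 0 u u p\<bar>"
    unfolding far_energy_def using i0 i1 by simp
  also have "\<dots> \<le> (LBINT p. \<bar>far_density s u u p - far_density 0 u u p\<bar>)"
    by (rule integral_abs_bound)
  also have "\<dots> \<le> (LBINT p. ?c * (\<bar>u (fst p)\<bar> * \<bar>u (snd p)\<bar>))"
  proof (rule integral_mono)
    show "integrable lborel (\<lambda>p. \<bar>far_density s u u p - far_density 0 u u p\<bar>)"
      using i0 i1 by simp
    show "integrable lborel (\<lambda>p. ?c * (\<bar>u (fst p)\<bar> * \<bar>u (snd p)\<bar>))"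
      using hb by (simp add: has_bochner_integral_iff)
    fix p :: "'a \<times> 'a"
    let ?z = "fst p - snd p"
    show "\<bar>far_density s u u p - far_density 0 u u p\<bar> \<le> ?c * (\<bar>u (fst p)\<bar> * \<bar>u (snd p)\<bar>)"
    proof (cases "fst p \<in> \<Omega> \<and> snd p \<in> \<Omega> \<and> norm ?z > 1")
      case True
      have nz0: "fst p \<noteq> snd p" using True by auto
      have nz: "norm ?z \<le> diam" using True norm_diff_le_diam by auto
      have "far_density s u u p - far_density 0 u u p = u (fst p) * u (snd p) * (rkern s ?z - rkern 0 ?z)"
        using True by (simp add: far_density_def algebra_simps)
      also have "\<bar>\<dots>\<bar> = \<bar>u (fst p)\<bar> * \<bar>u (snd p)\<bar> * \<bar>rkern s ?z - rkern 0 ?z\<bar>"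
        by (simp add: abs_mult)
      finally have abs_eq: "\<bar>far_density s u u p - far_density 0 u u p\<bar> = \<bar>u (fst p)\<bar> * \<bar>u (snd p)\<bar> * \<bar>rkern s ?z - rkern 0 ?z\<bar>" .
      have "\<bar>rkern s ?z - rkern 0 ?z\<bar> \<le> ?c"
      proof -
        have "rkern s ?z = rkern 0 ?z * norm ?z powr (- 2 * s)"
          unfolding rkern_def by (simp flip: powr_add)
        moreover have "rkern 0 ?z \<le> 1" "rkern 0 ?z \<ge> 0"
          using far_kernel_bounds(2)[of 0 ?z] True by auto
        moreover have "norm ?z powr (- 2 * s) \<le> 1" "diam powr (- 2 * s) \<le> norm ?z powr (- 2 * s)"
          using True s nz powr_mono[of "- 2 * s" 0 "norm ?z"] powr_mono2'[of "- 2 * s" "norm ?z" diam] nz0 by auto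
        moreover have "\<bar>rkern s ?z - rkern 0 ?z\<bar> = rkern 0 ?z * \<bar>1 - norm ?z powr (- 2 * s)\<bar>"
        proof -
          have "rkern s ?z - rkern 0 ?z = - (rkern 0 ?z * (1 - norm ?z powr (- 2 * s)))"
            using calculation(1) by (simp add: algebra_simps)
          then show ?thesis using calculation(3) by (simp add: abs_mult)
        qed
        ultimately show ?thesis
          using mult_mono[of "rkern 0 ?z" 1 "\<bar>1 - norm ?z powr (- 2 * s)\<bar>" ?c] by auto
      qed
      then have "\<bar>u (fst p)\<bar> * \<bar>u (snd p)\<bar> * \<bar>rkern s ?z - rkern 0 ?z\<bar> \<le> \<bar>u (fst p)\<bar> * \<bar>u (snd p)\<bar> * ?c"
        by (intro mult_left_mono) auto
      then show ?thesis unfolding abs_eq by (simp only: mult_ac)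
    next
      case False
      then have "far_density s u u p - far_density 0 u u p = 0"
        using L2_zeroD(2)[OF u] by (auto simp: far_density_def indicator_def)
      then show ?thesis using c by simp
    qed
  qed
  also have "\<dots> = ?c * (LBINT x. \<bar>u x\<bar>)\<^sup>2"
    using hb by (simp add: has_bochner_integral_iff power2_eq_square)
  also have "\<dots> \<le> ?c * (vol * sqnorm u)"
    by (intro mult_left_mono L1_le_L2 u c)
  finally show ?thesis .
qed

text \<open>The square is expanded only beyond distance 1, where the kernel is integrable: each of
  the two squares contributes \<open>sqnorm u / (s * log_const DIM('a))\<close> and the mixed term
  is a multiple of the far energy. Below distance 1 the square has to stay whole.\<close>

lemma frac_form_eq:
  assumes u: "u \<in> L2_zero \<Omega>" and s: "0 < s" and near: "integrable lborel (near_density s u)"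
  shows "frac_form s u u = frac_ratio DIM('a) s *
      (sqnorm u + s * (log_const DIM('a) / 2 * near_energy s u - log_const DIM('a) * far_energy s u u))"
    and "integrable lborel (\<lambda>p. (u (fst p) - u (snd p))\<^sup>2 * rkern s (fst p - snd p))"
proof -
  have [measurable]: "u \<in> borel_measurable borel" using L2_zeroD[OF u] by simp
  note iu = L2_zero_integrable[OF u]
  have c: "log_const DIM('a) > 0" by (simp add: log_const_pos)
  let ?k = "\<lambda>r. indicator {1<..} r * r powr (- (real DIM('a) + 2 * s))"
  have k: "(\<integral>\<^sup>+z. ennreal (?k (norm (z::'a))) \<partial>lborel) = ennreal (1 / (s * log_const DIM('a)))"
    by (rule nn_integral_radial_powr[OF s])
  have kc: "1 / (s * log_const DIM('a)) \<ge> 0" using s c by simp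
  have km: "?k \<in> borel_measurable borel" by measurable
  note hb = has_bochner_integral_radial_conv[OF L2_zeroD(3)[OF u] _ km _ k kc, simplified]
  let ?F = "\<lambda>p. (u (fst p) - u (snd p))\<^sup>2 * rkern s (fst p - snd p)"
  have split: "?F p = near_density s u p + ((u (fst p))\<^sup>2 * ?k (norm (fst p - snd p)) + (u (snd p))\<^sup>2 * ?k (norm (fst p - snd p)))
      - 2 * far_density s u u p" for p
    by (cases "norm (fst p - snd p) \<le> 1") (auto simp: near_density_def far_density_def rkern_def power2_diff algebra_simps)
  note ifar = integrable_far_density[OF less_imp_le[OF s] iu(1) iu(1)]
  show int: "integrable lborel ?F"
    unfolding split using near ifar hb by (simp add: has_bochner_integral_iff)
  have "(LBINT p. ?F p) = near_energy s u + (sqnorm u / (s * log_const DIM('a)) + sqnorm u / (s * log_const DIM('a))) - 2 * far_energy s u u"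
    unfolding split near_energy_def far_energy_def sqnorm_def using near ifar hb by (simp add: has_bochner_integral_iff)
  moreover have "frac_form s u u = frac_const DIM('a) s / 2 * (LBINT p. ?F p)"
  proof -
    have [measurable]: "?F \<in> borel_measurable borel" using int by auto
    have "(LINT (x::'a, y::'a)|lebesgue. (u x - u y) * (u x - u y) / norm (x - y) powr (real DIM('a) + 2 * s)) = (LINT p|lebesgue. ?F p)"
      by (rule Bochner_Integration.integral_cong) (auto simp: rkern_def powr_minus divide_inverse power2_eq_square simp del: minus_add_distrib)
    also have "\<dots> = (LBINT p. ?F p)"
      by (rule integral_completion) simp
    finally show ?thesis by (simp add: frac_form_def)
  qed
  ultimately have "frac_form s u u = frac_const DIM('a) s / 2 *
     (near_energy s u + (sqnorm u / (s * log_const DIM('a)) + sqnorm u / (s * log_const DIM('a))) - 2 * far_energy s u u)"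
    by simp
  also have "\<dots> = frac_ratio DIM('a) s *
      (sqnorm u + s * (log_const DIM('a) / 2 * near_energy s u - log_const DIM('a) * far_energy s u u))"
    using s c by (simp add: frac_ratio_def field_simps)
  finally show "frac_form s u u = \<dots>" .
qed

lemma log_form_eq:
  assumes u: "u \<in> L2_zero \<Omega>" and w: "w \<in> L2_zero \<Omega>"
    and ae: "AE x in lborel. u' x = u x" "AE x in lborel. w' x = w x"
  shows "log_form u' w' = log_const DIM('a) / 2 * (LBINT p. near_cross u w p)
     - log_const DIM('a) * far_energy 0 u w + log_rho DIM('a) * (LBINT x. u x * w x)"
proof -
  have m [measurable]: "u \<in> borel_measurable borel" "w \<in> borel_measurable borel" using L2_zeroD u w by auto
  note ae2 = AE_lborel_pair[OF ae(1)] AE_lborel_pair[OF ae(2)]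
  have "log_form_local u' w' = log_const DIM('a) / 2 * (LBINT p. near_cross u w p)"
  proof -
    have "AE p in lborel. indicator {(x::'a, y::'a). norm (x - y) \<le> 1} p *\<^sub>R
        (case p of (x, y) \<Rightarrow> (u' x - u' y) * (w' x - w' y) / norm (x - y) ^ DIM('a)) = near_cross u w p"
      using ae2
    proof eventually_elim
      case (elim p)
      then show ?case
        by (cases "fst p = snd p") (auto simp: near_cross_def rkern_def indicator_def powr_minus_divide powr_realpow split: prod.splits)
    qed
    then show ?thesis
      unfolding log_form_local_def set_lebesgue_integral_def
      by (subst lebesgue_integral_AE_borel(1)[where g = "near_cross u w"]) auto
  qed
  moreover have "(LINT (x, y):{(x::'a, y::'a). norm (x - y) \<ge> 1}|lebesgue. u' x * w' y / norm (x - y) ^ DIM('a)) = far_energy 0 u w"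
  proof -
    have "AE p in lborel. indicator {(x::'a, y::'a). norm (x - y) \<ge> 1} p *\<^sub>R
        (case p of (x, y) \<Rightarrow> u' x * w' y / norm (x - y) ^ DIM('a)) = far_density 0 u w p"
      using ae2 AE_lborel_norm_diff_neq_1
    proof eventually_elim
      case (elim p)
      then show ?case
        by (cases "fst p = snd p") (auto simp: far_density_def rkern_def indicator_def powr_minus_divide powr_realpow split: prod.splits)
    qed
    then show ?thesis
      unfolding set_lebesgue_integral_def far_energy_def
      by (subst lebesgue_integral_AE_borel(1)[where g = "far_density 0 u w"]) auto
  qed
  moreover have "(LINT x|lebesgue. u' x * w' x) = (LBINT x. u x * w x)"
    by (rule lebesgue_integral_AE_borel(1)) (use ae in \<open>auto elim: eventually_elim2\<close>)
  ultimately show ?thesis by (simp add: log_form_def)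
qed

definition log_energy :: "('a \<Rightarrow> real) \<Rightarrow> real" where
  "log_energy u = log_const DIM('a) / 2 * near_energy 0 u
     - log_const DIM('a) * far_energy 0 u u + log_rho DIM('a) * sqnorm u"

lemma log_form_self:
  assumes "u \<in> L2_zero \<Omega>" "AE x in lborel. u' x = u x"
  shows "log_form u' u' = log_energy u"
  using log_form_eq[OF assms(1) assms(1) assms(2) assms(2)]
  by (simp add: log_energy_def near_cross_self near_energy_def sqnorm_def power2_eq_square)

lemma log_energy_mult:
  assumes "u \<in> L2_zero \<Omega>"
  shows "log_energy (\<lambda>x. a * u x) = a\<^sup>2 * log_energy u"
proof -
  have "far_density 0 (\<lambda>x. a * u x) (\<lambda>x. a * u x) = (\<lambda>p. a\<^sup>2 * far_density 0 u u p)"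
    by (rule ext) (simp add: far_density_def power2_eq_square)
  then have "far_energy 0 (\<lambda>x. a * u x) (\<lambda>x. a * u x) = a\<^sup>2 * far_energy 0 u u"
    by (simp add: far_energy_def)
  then show ?thesis
    by (simp add: log_energy_def near_energy_mult sqnorm_mult algebra_simps)
qed

text \<open>The cross term is left as \<open>log_form\<close> so that the eigenvalue equation of
  \<open>\<xi>\<close> can evaluate it.\<close>

lemma log_energy_diff:
  assumes u: "u \<in> L2_zero \<Omega>" and x: "\<xi> \<in> L2_zero \<Omega>"
    and nu: "integrable lborel (near_density 0 u)" and nx: "integrable lborel (near_density 0 \<xi>)"
  shows "log_energy (\<lambda>x. u x - t * \<xi> x) = log_energy u - 2 * t * log_form \<xi> u + t\<^sup>2 * log_energy \<xi>"
proof -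
  have m [measurable]: "u \<in> borel_measurable borel" "\<xi> \<in> borel_measurable borel" using L2_zeroD u x by auto
  note iu = L2_zero_integrable[OF u] and ix = L2_zero_integrable[OF x]
  have lf: "log_form \<xi> u = log_const DIM('a) / 2 * (LBINT p. near_cross \<xi> u p)
     - log_const DIM('a) * far_energy 0 \<xi> u + log_rho DIM('a) * (LBINT x. \<xi> x * u x)"
    by (rule log_form_eq[OF x u]) auto
  have "near_density 0 (\<lambda>x. u x - t * \<xi> x) = (\<lambda>p. near_density 0 u p - 2 * t * near_cross \<xi> u p + t\<^sup>2 * near_density 0 \<xi> p)"
    by (rule ext) (simp add: near_density_def near_cross_def power2_eq_square algebra_simps)
  then have 1: "near_energy 0 (\<lambda>x. u x - t * \<xi> x) = near_energy 0 u - 2 * t * (LBINT p. near_cross \<xi> u p) + t\<^sup>2 * near_energy 0 \<xi>"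
    unfolding near_energy_def using nu nx integrable_near_cross[OF nx nu] by simp
  have "far_energy 0 (\<lambda>x. u x - t * \<xi> x) (\<lambda>x. u x - t * \<xi> x)
     = far_energy 0 u u - t * far_energy 0 u \<xi> - t * far_energy 0 \<xi> u + t\<^sup>2 * far_energy 0 \<xi> \<xi>"
  proof -
    have "far_density 0 (\<lambda>x. u x - t * \<xi> x) (\<lambda>x. u x - t * \<xi> x)
      = (\<lambda>p. far_density 0 u u p - t * far_density 0 u \<xi> p - t * far_density 0 \<xi> u p + t\<^sup>2 * far_density 0 \<xi> \<xi> p)"
      by (rule ext) (simp add: far_density_def power2_eq_square algebra_simps)
    then show ?thesis
      unfolding far_energy_def using integrable_far_density[OF order.refl iu(1) iu(1)] integrable_far_density[OF order.refl iu(1) ix(1)]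
        integrable_far_density[OF order.refl ix(1) iu(1)] integrable_far_density[OF order.refl ix(1) ix(1)] by simp
  qed
  then have 2: "far_energy 0 (\<lambda>x. u x - t * \<xi> x) (\<lambda>x. u x - t * \<xi> x)
     = far_energy 0 u u - 2 * t * far_energy 0 \<xi> u + t\<^sup>2 * far_energy 0 \<xi> \<xi>"
    using far_energy_swap[OF m] by simp
  have "(\<lambda>x. (u x - t * \<xi> x)\<^sup>2) = (\<lambda>x. (u x)\<^sup>2 - 2 * t * (\<xi> x * u x) + t\<^sup>2 * (\<xi> x)\<^sup>2)"
    by (rule ext) (simp add: power2_eq_square algebra_simps)
  then have 3: "sqnorm (\<lambda>x. u x - t * \<xi> x) = sqnorm u - 2 * t * (LBINT x. \<xi> x * u x) + t\<^sup>2 * sqnorm \<xi>"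
    unfolding sqnorm_def using L2_zeroD(3)[OF u] L2_zeroD(3)[OF x] integrable_prod[OF x u] by simp
  show ?thesis
    unfolding log_energy_def 1 2 3 lf by (simp add: algebra_simps)
qed

end

section \<open>Comparison of the two forms\<close>

text \<open>The factor \<open>s\<close> cancels and the right side is smooth at 0 with value 1. At
  \<open>s = 0\<close> itself \<open>frac_ratio\<close> is a division by zero and has the value
  0.\<close>

lemma frac_ratio_nonzero:
  assumes "s \<noteq> 0"
  shows "frac_ratio N s = 2 powr (2 * s) * Gamma (real N / 2 + s) / (Gamma (real N / 2) * Gamma (1 - s))"
proof -
  have eq: "real N / 2 + s = (real N + 2 * s) / 2" by (simp add: field_simps)
  show ?thesis
    using assms by (simp add: frac_ratio_def frac_const_def log_const_def eq[symmetric] mult.commute[of "Gamma (1 - s)"])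
qed

lemma frac_ratio_pos:
  assumes "0 < s" "s < 1" "N > 0"
  shows "frac_ratio N s > 0"
  using assms by (subst frac_ratio_nonzero) (auto intro!: divide_pos_pos mult_pos_pos Gamma_real_pos)

text \<open>This is where the constant \<open>log_rho\<close> comes from. It is the logarithmic
  derivative at 0 of the quotient of Gamma values: \<open>2 powr (2 * s)\<close> gives
  \<open>2 * ln 2\<close>, the Gamma value in the numerator gives
  \<open>Digamma (real N / 2)\<close>, and \<open>1 / Gamma (1 - s)\<close> gives
  \<open>Digamma 1\<close>, which is minus the Euler-Mascheroni constant.\<close>

lemma frac_ratio_tendsto:
  assumes N: "N > 0"
  shows "((\<lambda>s. (frac_ratio N s - 1) / s) \<longlongrightarrow> log_rho N) (at_right 0)"
    and "(frac_ratio N \<longlongrightarrow> 1) (at_right 0)"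
proof -
  let ?g = "\<lambda>s. 2 powr (2 * s) * Gamma (real N / 2 + s) / (Gamma (real N / 2) * Gamma (1 - s))"
  have G: "Gamma (real N / 2) > 0" using N by (intro Gamma_real_pos) auto
  have g0: "?g 0 = 1" using G by simp
  have p: "real N / 2 \<notin> \<int>\<^sub>\<le>\<^sub>0" "(1::real) \<notin> \<int>\<^sub>\<le>\<^sub>0"
    using N by (auto dest: nonpos_Ints_nonpos)
  have "(?g has_real_derivative log_rho N) (at 0)"
    unfolding log_rho_def
    by (rule derivative_eq_intros refl | use p G in \<open>simp add: field_simps\<close>)+
  then have lim: "((\<lambda>s. (?g s - 1) / s) \<longlongrightarrow> log_rho N) (at 0)"
    unfolding DERIV_def using g0 by simp
  then have lim': "((\<lambda>s. (?g s - 1) / s) \<longlongrightarrow> log_rho N) (at_right 0)"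
    by (rule tendsto_mono[rotated]) (simp add: at_le)
  show 1: "((\<lambda>s. (frac_ratio N s - 1) / s) \<longlongrightarrow> log_rho N) (at_right 0)"
    by (rule Lim_transform_eventually[OF lim'])
       (auto simp: eventually_at_filter frac_ratio_nonzero)
  have "((\<lambda>s. 1 + s * ((frac_ratio N s - 1) / s)) \<longlongrightarrow> 1 + 0 * log_rho N) (at_right 0)"
    by (intro tendsto_intros 1)
  then have "((\<lambda>s. 1 + s * ((frac_ratio N s - 1) / s)) \<longlongrightarrow> 1) (at_right 0)"
    by simp
  then show "(frac_ratio N \<longlongrightarrow> 1) (at_right 0)"
    by (rule Lim_transform_eventually) (auto simp: eventually_at_filter)
qed

section \<open>The form domain, the variational principle and the uniform comparison\<close>

context bounded_open_set
begin

definition form_domain :: "('a \<Rightarrow> real) set" where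
  "form_domain = {u \<in> L2_zero \<Omega>. integrable lborel (near_density 0 u)}"

lemma form_domainD:
  assumes "u \<in> form_domain"
  shows "u \<in> L2_zero \<Omega>" "integrable lborel (near_density 0 u)" "u \<in> borel_measurable borel"
  using assms by (auto simp: form_domain_def dest: L2_zeroD)

lemma form_domain_linear:
  "u \<in> form_domain \<Longrightarrow> w \<in> form_domain \<Longrightarrow> (\<lambda>x. a * u x + b * w x) \<in> form_domain"
  using integrable_near_density_linear[of 0 u w a b] L2_zero_linear[of u w a b]
  by (auto simp: form_domain_def dest: L2_zeroD)

lemma form_domain_mult: "u \<in> form_domain \<Longrightarrow> (\<lambda>x. a * u x) \<in> form_domain"
  using form_domain_linear[of u u a 0] by simp

lemma set_integrable_near_iff:
  assumes [measurable]: "u \<in> borel_measurable borel" and ae: "AE x in lborel. u' x = u x"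
  shows "set_integrable lebesgue {(x::'a, y::'a). norm (x - y) \<le> 1} (\<lambda>(x, y). (u' x - u' y)\<^sup>2 / norm (x - y) ^ DIM('a))
    \<longleftrightarrow> integrable lborel (near_density 0 u)"
proof -
  have "AE p in lborel. indicator {(x::'a, y::'a). norm (x - y) \<le> 1} p *\<^sub>R
      (case p of (x, y) \<Rightarrow> (u' x - u' y)\<^sup>2 / norm (x - y) ^ DIM('a)) = near_density 0 u p"
    using AE_lborel_pair[OF ae]
  proof eventually_elim
    case (elim p)
    then show ?case
      by (cases "fst p = snd p") (auto simp: near_density_def rkern_def indicator_def powr_minus_divide powr_realpow split: prod.splits)
  qed
  then show ?thesis
    unfolding set_integrable_def by (intro lebesgue_integral_AE_borel(2)) auto
qed

lemma form_domain_HL: "u \<in> form_domain \<Longrightarrow> u \<in> HL_space \<Omega>"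
  using set_integrable_near_iff[of u u] by (auto simp: HL_space_def form_domain_def L2_zero_def intro: measurable_completion)

lemma L2_norm_on_eq:
  assumes u: "u \<in> L2_zero \<Omega>" and ae: "AE x in lborel. u' x = u x"
  shows "L2_norm_on \<Omega> u' = sqrt (sqnorm u)" "L2_norm_on UNIV u' = sqrt (sqnorm u)"
proof -
  have [measurable]: "u \<in> borel_measurable borel" using L2_zeroD[OF u] by simp
  have "(LINT x:\<Omega>|lebesgue. (u' x)\<^sup>2) = sqnorm u"
    unfolding set_lebesgue_integral_def sqnorm_def
    by (rule lebesgue_integral_AE_borel(1)) (use ae L2_zeroD(2)[OF u] in \<open>auto elim!: eventually_mono simp: indicator_def\<close>)
  then show "L2_norm_on \<Omega> u' = sqrt (sqnorm u)" by (simp add: L2_norm_on_def)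
  have "(LINT x:UNIV|lebesgue. (u' x)\<^sup>2) = sqnorm u"
    unfolding set_lebesgue_integral_def sqnorm_def
    by (rule lebesgue_integral_AE_borel(1)) (use ae in \<open>auto elim!: eventually_mono\<close>)
  then show "L2_norm_on UNIV u' = sqrt (sqnorm u)" by (simp add: L2_norm_on_def)
qed

lemma L2_zero_version:
  assumes "u' \<in> borel_measurable lebesgue" "AE x in lebesgue. x \<notin> \<Omega> \<longrightarrow> u' x = 0" "L2_norm_on \<Omega> u' = 1"
  obtains u where "u \<in> L2_zero \<Omega>" "AE x in lborel. u' x = u x" "sqnorm u = 1"
proof -
  obtain u where u: "u \<in> borel_measurable borel" "\<And>x. x \<notin> \<Omega> \<Longrightarrow> u x = 0" "AE x in lborel. u' x = u x"
    using borel_version_vanishing[OF assms(1,2) open_dom] by metis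
  have [measurable]: "u \<in> borel_measurable borel" by fact
  have "(LINT x:\<Omega>|lebesgue. (u' x)\<^sup>2) = (LBINT x. (u x)\<^sup>2)"
    unfolding set_lebesgue_integral_def
    by (rule lebesgue_integral_AE_borel(1)) (use u in \<open>auto elim!: eventually_mono simp: indicator_def\<close>)
  then have 1: "(LBINT x. (u x)\<^sup>2) = 1"
    using assms(3) by (simp add: L2_norm_on_def)
  \<comment> \<open>A function that is not integrable has integral 0 by convention, so the norm 1
    forces integrability.\<close>
  then have "integrable lborel (\<lambda>x. (u x)\<^sup>2)"
    using not_integrable_integral_eq by fastforce
  with u 1 show thesis
    by (intro that[of u]) (auto simp: L2_zero_def sqnorm_def)
qed

lemma HL_version:
  assumes "u' \<in> HL_space \<Omega>" "L2_norm_on \<Omega> u' = 1"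
  obtains u where "u \<in> form_domain" "AE x in lborel. u' x = u x" "sqnorm u = 1"
proof -
  obtain u where u: "u \<in> L2_zero \<Omega>" "AE x in lborel. u' x = u x" "sqnorm u = 1"
    using L2_zero_version[of u'] assms by (auto simp: HL_space_def)
  moreover have "integrable lborel (near_density 0 u)"
    using assms set_integrable_near_iff[OF _ u(2)] L2_zeroD(1)[OF u(1)] by (auto simp: HL_space_def)
  ultimately show thesis using that by (auto simp: form_domain_def)
qed

lemma log_eigenvalue1_eq:
  "log_eigenvalue1 \<Omega> = Inf {log_energy u | u. u \<in> form_domain \<and> sqnorm u = 1}"
proof -
  have "{log_form u u | u. u \<in> HL_space \<Omega> \<and> L2_norm_on \<Omega> u = 1} = {log_energy u | u. u \<in> form_domain \<and> sqnorm u = 1}"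
  proof (intro equalityI subsetI)
    fix y assume "y \<in> {log_form u u | u. u \<in> HL_space \<Omega> \<and> L2_norm_on \<Omega> u = 1}"
    then obtain u' where u': "y = log_form u' u'" "u' \<in> HL_space \<Omega>" "L2_norm_on \<Omega> u' = 1" by auto
    obtain u where u: "u \<in> form_domain" "AE x in lborel. u' x = u x" "sqnorm u = 1"
      using HL_version[OF u'(2,3)] .
    then show "y \<in> {log_energy u | u. u \<in> form_domain \<and> sqnorm u = 1}"
      using log_form_self[OF form_domainD(1) u(2)] u' by auto
  next
    fix y assume "y \<in> {log_energy u | u. u \<in> form_domain \<and> sqnorm u = 1}"
    then obtain u where u: "y = log_energy u" "u \<in> form_domain" "sqnorm u = 1" by auto
    have "log_form u u = log_energy u" "L2_norm_on \<Omega> u = 1"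
      using log_form_self[of u u] L2_norm_on_eq[of u u] form_domainD(1)[OF u(2)] u(3) by auto
    then show "y \<in> {log_form u u | u. u \<in> HL_space \<Omega> \<and> L2_norm_on \<Omega> u = 1}"
      using u(1) form_domain_HL[OF u(2)] by (intro CollectI exI[of _ u]) simp
  qed
  then show ?thesis by (simp add: log_eigenvalue1_def)
qed

text \<open>A Garding inequality: the far energy and the zero-order term are controlled by the L2
  norm. Hence a bound on the logarithmic energy of normalized functions bounds their near
  energy.\<close>

lemma near_energy_le_log_energy:
  assumes "u \<in> L2_zero \<Omega>"
  shows "log_const DIM('a) / 2 * near_energy 0 u
    \<le> log_energy u + (log_const DIM('a) * vol + \<bar>log_rho DIM('a)\<bar>) * sqnorm u"
proof -
  let ?c = "log_const DIM('a)"
  have c: "?c > 0" by (simp add: log_const_pos)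
  have "?c * far_energy 0 u u \<le> ?c * (vol * sqnorm u)"
    using abs_far_energy_le_sqnorm[OF assms, of 0] c by (intro mult_left_mono) auto
  moreover have "- \<bar>log_rho DIM('a)\<bar> * sqnorm u \<le> log_rho DIM('a) * sqnorm u"
    by (intro mult_right_mono sqnorm_nonneg) auto
  ultimately show ?thesis by (simp add: log_energy_def algebra_simps)
qed

lemma log_energy_ge:
  assumes "u \<in> L2_zero \<Omega>"
  shows "- (log_const DIM('a) * vol + \<bar>log_rho DIM('a)\<bar>) * sqnorm u \<le> log_energy u"
proof -
  have "0 \<le> log_const DIM('a) / 2 * near_energy 0 u"
    using log_const_pos[of "DIM('a)"] by (intro mult_nonneg_nonneg near_energy_nonneg) auto
  with near_energy_le_log_energy[OF assms] show ?thesis by (simp add: algebra_simps)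
qed

lemma log_eigenvalue1_le:
  assumes u: "u \<in> form_domain"
  shows "log_eigenvalue1 \<Omega> * sqnorm u \<le> log_energy u"
proof (cases "sqnorm u = 0")
  case True
  then show ?thesis using log_energy_ge[OF form_domainD(1)[OF u]] by simp
next
  case False
  then have pos: "sqnorm u > 0" using sqnorm_nonneg[of u] by simp
  let ?a = "1 / sqrt (sqnorm u)"
  have a: "?a\<^sup>2 * sqnorm u = 1" using pos by (simp add: power_divide)
  have "log_energy (\<lambda>x. ?a * u x) \<in> {log_energy u | u. u \<in> form_domain \<and> sqnorm u = 1}"
    using form_domain_mult[OF u, of ?a] a sqnorm_mult[of ?a u] by auto
  moreover have "bdd_below {log_energy u | u. u \<in> form_domain \<and> sqnorm u = 1}"
    using log_energy_ge form_domainD(1) by (intro bdd_belowI[of _ "- (log_const DIM('a) * vol + \<bar>log_rho DIM('a)\<bar>)"]) force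
  ultimately have "log_eigenvalue1 \<Omega> \<le> log_energy (\<lambda>x. ?a * u x)"
    unfolding log_eigenvalue1_eq by (rule cInf_lower)
  also have "\<dots> = log_energy u / sqnorm u"
    using log_energy_mult[OF form_domainD(1)[OF u], of ?a] pos by (simp add: power_divide)
  finally show ?thesis using pos by (simp add: field_simps)
qed

text \<open>The constant in the quantitative simplicity below is this lower bound for the kernel off
  the diagonal, times \<open>log_const\<close>.\<close>

lemma rkern_0_ge:
  assumes "x \<in> \<Omega>" "y \<in> \<Omega>" "x \<noteq> y"
  shows "diam powr (- real DIM('a)) \<le> rkern 0 (x - y)"
  unfolding rkern_def using norm_diff_le_diam[OF assms(1,2)] assms(3)
  by (simp, intro powr_mono2') auto

text \<open>The difference of squares is four times the product of the masses of the positive and negative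
  parts of \<open>w\<close>: this quantifies the simplicity of the first eigenvalue.\<close>

lemma log_energy_abs:
  assumes w: "w \<in> form_domain"
  shows "(\<lambda>x. \<bar>w x\<bar>) \<in> form_domain"
    and "log_const DIM('a) * diam powr (- real DIM('a)) * ((LBINT x. \<bar>w x\<bar>)\<^sup>2 - (LBINT x. w x)\<^sup>2)
      \<le> log_energy w - log_energy (\<lambda>x. \<bar>w x\<bar>)"
proof -
  let ?v = "\<lambda>x. \<bar>w x\<bar>" and ?c = "log_const DIM('a)" and ?d = "diam powr (- real DIM('a))"
  note wD = form_domainD[OF w]
  have [measurable]: "w \<in> borel_measurable borel" by (rule wD)
  have v: "?v \<in> L2_zero \<Omega>" by (rule L2_zero_dominated[OF wD(1)]) auto
  have c: "?c > 0" by (simp add: log_const_pos)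
  have nv: "near_density 0 ?v p \<le> near_density 0 w p" for p
    unfolding near_density_def
    by (intro mult_right_mono mult_left_mono) (auto simp: abs_le_square_iff[symmetric])
  have iv: "integrable lborel (near_density 0 ?v)"
    by (rule Bochner_Integration.integrable_bound[OF wD(2)]) (use nv in \<open>auto simp: near_density_nonneg\<close>)
  with v show fd: "?v \<in> form_domain" by (simp add: form_domain_def)
  note iw1 = L2_zero_integrable[OF wD(1)]
  note far = integrable_far_density[OF order.refl iw1(1) iw1(1)] integrable_far_density[OF order.refl iw1(2) iw1(2)]
  note hb1 = has_bochner_integral_prod_lborel[OF iw1(1) iw1(1)] and hb2 = has_bochner_integral_prod_lborel[OF iw1(2) iw1(2)]
  have "?c * ?d * ((LBINT x. ?v x)\<^sup>2 - (LBINT x. w x)\<^sup>2)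
      = (LBINT p. ?c * ?d * (?v (fst p) * ?v (snd p) - w (fst p) * w (snd p)))"
    using hb1 hb2 by (simp add: has_bochner_integral_iff power2_eq_square)
  also have "\<dots> \<le> (LBINT p. ?c / 2 * (near_density 0 w p - near_density 0 ?v p) + ?c * (far_density 0 ?v ?v p - far_density 0 w w p))"
  proof (rule integral_mono)
    show "integrable lborel (\<lambda>p. ?c * ?d * (?v (fst p) * ?v (snd p) - w (fst p) * w (snd p)))"
      using hb1 hb2 by (simp add: has_bochner_integral_iff)
    show "integrable lborel (\<lambda>p. ?c / 2 * (near_density 0 w p - near_density 0 ?v p) + ?c * (far_density 0 ?v ?v p - far_density 0 w w p))"
      using far iv wD by simp
    fix p :: "'a \<times> 'a"
    let ?x = "fst p" and ?y = "snd p"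
    let ?e = "?v ?x * ?v ?y - w ?x * w ?y"
    have e: "?e \<ge> 0" by (simp add: abs_mult[symmetric])
    \<comment> \<open>Passing to the absolute value changes the near square by twice the amount by
      which it changes the far product. The factor \<open>1/2\<close> in front of the near energy
      compensates, so the integrand is \<open>?c * (rkern 0 (?x - ?y) * ?e)\<close> on both sides of
      distance 1.\<close>
    have sq: "(w ?x - w ?y)\<^sup>2 - (?v ?x - ?v ?y)\<^sup>2 = 2 * ?e"
      by (simp add: power2_diff)
    have "?c / 2 * (near_density 0 w p - near_density 0 ?v p) + ?c * (far_density 0 ?v ?v p - far_density 0 w w p)
      = ?c * (rkern 0 (?x - ?y) * ?e)"
    proof (cases "norm (?x - ?y) \<le> 1")
      case True
      then have "near_density 0 w p - near_density 0 ?v p = 2 * ?e * rkern 0 (?x - ?y)"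
        unfolding sq[symmetric] by (simp add: near_density_def algebra_simps)
      with True show ?thesis by (simp add: far_density_def)
    next
      case False
      then show ?thesis by (simp add: far_density_def near_density_def algebra_simps)
    qed
    moreover have "?c * (?d * ?e) \<le> ?c * (rkern 0 (?x - ?y) * ?e)"
    proof (cases "?x \<in> \<Omega> \<and> ?y \<in> \<Omega> \<and> ?x \<noteq> ?y")
      case True
      then show ?thesis using rkern_0_ge[of ?x ?y] e c by (intro mult_left_mono mult_right_mono) auto
    next
      case False
      then have "?e = 0" using L2_zeroD(2)[OF wD(1)] by (auto simp: abs_mult_self)
      then show ?thesis by simp
    qed
    ultimately show "?c * ?d * ?e \<le> ?c / 2 * (near_density 0 w p - near_density 0 ?v p) + ?c * (far_density 0 ?v ?v p - far_density 0 w w p)"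
      by (simp only: mult.assoc)
  qed
  also have "\<dots> = ?c / 2 * (near_energy 0 w - near_energy 0 ?v) + ?c * (far_energy 0 ?v ?v - far_energy 0 w w)"
    unfolding near_energy_def far_energy_def using far iv wD by simp
  also have "\<dots> = log_energy w - log_energy ?v"
    by (simp add: log_energy_def sqnorm_def algebra_simps)
  finally show "?c * ?d * ((LBINT x. ?v x)\<^sup>2 - (LBINT x. w x)\<^sup>2) \<le> log_energy w - log_energy ?v" .
qed

text \<open>The absolute value of \<open>w\<close> competes in the infimum with the same L2 norm, so
  the energy saved by passing to it cannot exceed the deficit of \<open>w\<close>.\<close>

lemma L1_deficit:
  assumes w: "w \<in> form_domain" and mean: "(LBINT x. w x) = 0"
  shows "log_const DIM('a) * diam powr (- real DIM('a)) * (LBINT x. \<bar>w x\<bar>)\<^sup>2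
      \<le> log_energy w - log_eigenvalue1 \<Omega> * sqnorm w"
proof -
  have "sqnorm (\<lambda>x. \<bar>w x\<bar>) = sqnorm w" by (simp add: sqnorm_def)
  with log_eigenvalue1_le[OF log_energy_abs(1)[OF w]] log_energy_abs(2)[OF w] mean show ?thesis by simp
qed

text \<open>The non-integrability of the kernel at the origin upgrades convergence in \<open>L\<^sup>1\<close> to \<open>L\<^sup>2\<close> for
  bounded energy: average \<open>w(x)\<^sup>2 \<le> 2 \<bar>w(x) w(y)\<bar> + (w(x) - w(y))\<^sup>2\<close> over \<open>d \<le> \<bar>x - y\<bar> \<le> 1\<close>.\<close>

lemma sqnorm_le_L1:
  assumes w: "w \<in> form_domain" and d: "0 < d" "d \<le> 1"
  shows "2 / log_const DIM('a) * ln (1 / d) * sqnorm w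
    \<le> 2 * d powr (- real DIM('a)) * (LBINT x. \<bar>w x\<bar>)\<^sup>2 + near_energy 0 w"
proof -
  note wD = form_domainD[OF w]
  note iw = L2_zero_integrable[OF wD(1)]
  let ?G = "\<lambda>r. indicator {d..1} r * r powr (- real DIM('a))"
  have c: "0 \<le> 2 / log_const DIM('a) * ln (1 / d)"
    using log_const_pos[of "DIM('a)"] d by (intro mult_nonneg_nonneg) auto
  have Gm: "?G \<in> borel_measurable borel" by measurable
  note hb = has_bochner_integral_radial_conv(1)[OF L2_zeroD(3)[OF wD(1)] _ Gm _ nn_integral_radial_annulus[OF d] c, simplified]
  note hb2 = has_bochner_integral_prod_lborel[OF iw(2) iw(2)]
  have "2 / log_const DIM('a) * ln (1 / d) * sqnorm w = (LBINT p. (w (fst p))\<^sup>2 * ?G (norm (fst p - snd p)))"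
    using hb by (simp add: has_bochner_integral_iff sqnorm_def)
  also have "\<dots> \<le> (LBINT p. 2 * d powr (- real DIM('a)) * (\<bar>w (fst p)\<bar> * \<bar>w (snd p)\<bar>) + near_density 0 w p)"
  proof (rule integral_mono)
    show "integrable lborel (\<lambda>p. (w (fst p))\<^sup>2 * ?G (norm (fst p - snd p)))"
      using hb by (simp add: has_bochner_integral_iff)
    show "integrable lborel (\<lambda>p. 2 * d powr (- real DIM('a)) * (\<bar>w (fst p)\<bar> * \<bar>w (snd p)\<bar>) + near_density 0 w p)"
      using hb2 wD by (simp add: has_bochner_integral_iff)
    fix p :: "'a \<times> 'a"
    let ?z = "fst p - snd p" and ?a = "w (fst p)" and ?b = "w (snd p)"
    show "?a\<^sup>2 * ?G (norm ?z) \<le> 2 * d powr (- real DIM('a)) * (\<bar>?a\<bar> * \<bar>?b\<bar>) + near_density 0 w p"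
    proof (cases "d \<le> norm ?z \<and> norm ?z \<le> 1")
      case True
      have r: "rkern 0 ?z \<le> d powr (- real DIM('a))"
        unfolding rkern_def using True d by (simp, intro powr_mono2') auto
      have "?a * ?b \<le> \<bar>?a\<bar> * \<bar>?b\<bar>" by (simp add: abs_mult[symmetric])
      then have "?a\<^sup>2 \<le> 2 * (\<bar>?a\<bar> * \<bar>?b\<bar>) + (?a - ?b)\<^sup>2"
        using zero_le_power2[of ?b] unfolding power2_diff by linarith
      then have "?a\<^sup>2 * rkern 0 ?z \<le> (2 * (\<bar>?a\<bar> * \<bar>?b\<bar>) + (?a - ?b)\<^sup>2) * rkern 0 ?z"
        by (intro mult_right_mono) auto
      also have "\<dots> = (2 * (\<bar>?a\<bar> * \<bar>?b\<bar>)) * rkern 0 ?z + near_density 0 w p"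
        using True by (simp add: near_density_def distrib_right)
      also have "\<dots> \<le> (2 * (\<bar>?a\<bar> * \<bar>?b\<bar>)) * d powr (- real DIM('a)) + near_density 0 w p"
        using r by (intro add_right_mono mult_left_mono) auto
      finally show ?thesis using True by (simp add: rkern_def mult_ac)
    next
      case False
      then have "?a\<^sup>2 * ?G (norm ?z) = 0" by auto
      moreover have "0 \<le> 2 * d powr (- real DIM('a)) * (\<bar>?a\<bar> * \<bar>?b\<bar>)" by simp
      ultimately show ?thesis using near_density_nonneg[of 0 w p] by linarith
    qed
  qed
  also have "\<dots> = 2 * d powr (- real DIM('a)) * (LBINT x. \<bar>w x\<bar>)\<^sup>2 + near_energy 0 w"
    using hb2 wD by (simp add: has_bochner_integral_iff near_energy_def power2_eq_square)
  finally show ?thesis .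
qed

text \<open>The error of replacing the far energy at \<open>s\<close> by the one at 0, uniform over
  normalized functions. Since it depends only on \<open>s\<close> and the domain, it applies to a
  family that varies with \<open>s\<close>.\<close>

definition far_defect :: "real \<Rightarrow> real" where
  "far_defect s = log_const DIM('a) * ((1 - diam powr (- 2 * s)) * vol)"

lemma far_defect_tendsto: "(far_defect \<longlongrightarrow> 0) (at_right 0)"
proof -
  have "((\<lambda>s. log_const DIM('a) * ((1 - diam powr (- 2 * s)) * vol)) \<longlongrightarrow> log_const DIM('a) * ((1 - diam powr (- 2 * 0)) * vol)) (at_right 0)"
    using diam_ge_1 by (intro tendsto_intros) auto
  then show ?thesis using diam_ge_1 by (simp add: far_defect_def[abs_def])
qed

lemma far_energy_defect:
  assumes "u \<in> L2_zero \<Omega>" "0 \<le> s"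
  shows "\<bar>log_const DIM('a) * far_energy s u u - log_const DIM('a) * far_energy 0 u u\<bar> \<le> far_defect s * sqnorm u"
proof -
  have c: "log_const DIM('a) > 0" by (simp add: log_const_pos)
  have "\<bar>log_const DIM('a) * far_energy s u u - log_const DIM('a) * far_energy 0 u u\<bar>
     = log_const DIM('a) * \<bar>far_energy s u u - far_energy 0 u u\<bar>"
    using c by (simp add: abs_mult flip: right_diff_distrib)
  also have "\<dots> \<le> log_const DIM('a) * ((1 - diam powr (- 2 * s)) * (vol * sqnorm u))"
    using far_energy_diff_le[OF assms] c by (intro mult_left_mono) auto
  finally show ?thesis by (simp add: far_defect_def mult_ac)
qed

text \<open>Serves twice: on \<open>C2c\<close> it bounds the fractional eigenvalue from below, and
  at the fractional eigenfunctions it bounds their logarithmic energy from above. For the second use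
  only the energy of exponent \<open>s\<close> itself is available.\<close>

lemma frac_form_ge:
  assumes u: "u \<in> L2_zero \<Omega>" and s: "0 < s" "s < 1" and near: "integrable lborel (near_density s u)"
    and norm: "sqnorm u = 1"
  shows "frac_ratio DIM('a) s * (1 + s * (log_energy u - log_rho DIM('a) - far_defect s)) \<le> frac_form s u u"
proof -
  have c: "log_const DIM('a) > 0" by (simp add: log_const_pos)
  have m: "u \<in> borel_measurable borel" using L2_zeroD[OF u] by simp
  have "near_energy 0 u \<le> near_energy s u"
    using integrable_near_density_mono(2)[OF less_imp_le[OF s(1)] near m] .
  then have "log_const DIM('a) / 2 * near_energy 0 u \<le> log_const DIM('a) / 2 * near_energy s u"
    using c by (intro mult_left_mono) auto
  then have "log_energy u - log_rho DIM('a) - far_defect s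
     \<le> log_const DIM('a) / 2 * near_energy s u - log_const DIM('a) * far_energy s u u"
    using far_energy_defect[OF u less_imp_le[OF s(1)]] norm by (simp add: log_energy_def)
  then show ?thesis
    unfolding frac_form_eq(1)[OF u s(1) near] norm
    using frac_ratio_pos[OF s, of "DIM('a)"] s by (intro mult_left_mono add_left_mono) auto
qed

text \<open>The price of the reverse comparison is the energy of exponent \<open>1/2\<close>, which
  is finite on \<open>C2c\<close> but need not be finite on \<open>form_domain\<close>.\<close>

lemma frac_form_le:
  assumes u: "u \<in> L2_zero \<Omega>" and s: "0 < s" "s \<le> 1/2" and near: "integrable lborel (near_density (1/2) u)"
    and norm: "sqnorm u = 1"
  shows "frac_form s u u \<le> frac_ratio DIM('a) s *
    (1 + s * (log_energy u - log_rho DIM('a) + s * log_const DIM('a) * near_energy (1/2) u + far_defect s))"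
proof -
  have c: "log_const DIM('a) > 0" by (simp add: log_const_pos)
  have m: "u \<in> borel_measurable borel" using L2_zeroD[OF u] by simp
  have near_s: "integrable lborel (near_density s u)"
    using integrable_near_density_mono(1)[OF s(2) near m] .
  have "near_energy s u \<le> near_energy 0 u + 2 * s * near_energy (1/2) u"
    using near_energy_le_convex[OF _ s(2) near m] s by simp
  then have "log_const DIM('a) / 2 * near_energy s u \<le> log_const DIM('a) / 2 * (near_energy 0 u + 2 * s * near_energy (1/2) u)"
    using c by (intro mult_left_mono) auto
  then have "log_const DIM('a) / 2 * near_energy s u - log_const DIM('a) * far_energy s u u
     \<le> log_energy u - log_rho DIM('a) + s * log_const DIM('a) * near_energy (1/2) u + far_defect s"
    using far_energy_defect[OF u less_imp_le[OF s(1)]] norm by (simp add: log_energy_def algebra_simps)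
  then show ?thesis
    unfolding frac_form_eq(1)[OF u s(1) near_s] norm
    using frac_ratio_pos[of s "DIM('a)"] s by (intro mult_left_mono add_left_mono) auto
qed

end

section \<open>Convergence of the eigenfunctions\<close>

context bounded_open_set
begin

text \<open>Testing the eigenvalue equation with the eigenfunction itself identifies its fractional
  energy with the eigenvalue. Monotonicity of the kernels below distance 1 places it in
  \<open>form_domain\<close>.\<close>

lemma frac_eigenfunction1_version:
  assumes eig: "frac_eigenfunction1 s \<Omega> u'" and nn: "nonneg_normalized_on \<Omega> u'" and s: "0 < s"
  obtains u where "u \<in> form_domain" "integrable lborel (near_density s u)" "sqnorm u = 1"
    "AE x in lborel. 0 \<le> u x" "AE x in lborel. u' x = u x" "frac_form s u u = frac_eigenvalue1 s \<Omega>"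
proof -
  have Hs0: "u' \<in> Hs0_space s \<Omega>" and n1: "L2_norm_on \<Omega> u' = 1"
    using eig nn by (auto simp: frac_eigenfunction1_def nonneg_normalized_on_def)
  obtain u where u: "u \<in> L2_zero \<Omega>" "AE x in lborel. u' x = u x" "sqnorm u = 1"
    using L2_zero_version[OF _ _ n1] Hs0 by (auto simp: Hs0_space_def Hs_space_def)
  have m [measurable]: "u \<in> borel_measurable borel" using L2_zeroD[OF u(1)] by simp
  let ?F = "\<lambda>p. (u (fst p) - u (snd p))\<^sup>2 * rkern s (fst p - snd p)"
  have Fm: "?F \<in> borel_measurable borel" unfolding borel_prod[symmetric] by measurable
  have ae: "AE p in lborel. (case p of (x, y) \<Rightarrow> (u' x - u' y)\<^sup>2 / norm (x - y) powr (real DIM('a) + 2 * s)) = ?F p"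
    using AE_lborel_pair[OF u(2)]
    by eventually_elim (auto simp: rkern_def powr_minus divide_inverse simp del: minus_add_distrib)
  have intF: "integrable lborel ?F"
    using lebesgue_integral_AE_borel(2)[OF Fm ae] Hs0 by (simp add: Hs0_space_def Hs_space_def)
  have near: "integrable lborel (near_density s u)"
    by (rule Bochner_Integration.integrable_bound[OF intF]) (auto simp: near_density_def indicator_def)
  have near0: "integrable lborel (near_density 0 u)"
    using integrable_near_density_mono(1)[OF _ near m, of 0] s by simp
  have "AE x in lborel. 0 \<le> u' x"
    using nn by (simp add: nonneg_normalized_on_def AE_completion_iff)
  with u(2) have pos: "AE x in lborel. 0 \<le> u x" by eventually_elim simp
  have "frac_form s u' u' = frac_form s u u"
  proof -
    have eq: "(\<lambda>(x, y). (v x - v y) * (v x - v y) / norm (x - y) powr (real DIM('a) + 2 * s))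
      = (\<lambda>(x, y). (v x - v y)\<^sup>2 / norm (x - y) powr (real DIM('a) + 2 * s))" for v :: "'a \<Rightarrow> real"
      by (simp add: power2_eq_square)
    have ae': "AE p in lborel. (case p of (x, y) \<Rightarrow> (u x - u y)\<^sup>2 / norm (x - y) powr (real DIM('a) + 2 * s)) = ?F p"
      by (auto simp: rkern_def powr_minus divide_inverse simp del: minus_add_distrib)
    show ?thesis
      unfolding frac_form_def eq lebesgue_integral_AE_borel(1)[OF Fm ae] lebesgue_integral_AE_borel(1)[OF Fm ae'] ..
  qed
  moreover have "frac_form s u' u' = frac_eigenvalue1 s \<Omega>"
  proof -
    have "frac_form s u' u' = frac_eigenvalue1 s \<Omega> * (LINT x:\<Omega>|lebesgue. u' x * u' x)"
      using eig Hs0 by (auto simp: frac_eigenfunction1_def)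
    moreover have "(LINT x:\<Omega>|lebesgue. (u' x)\<^sup>2) = 1"
      using n1 by (simp add: L2_norm_on_def)
    ultimately show ?thesis by (simp add: power2_eq_square)
  qed
  ultimately show thesis
    using that[of u] u near near0 pos by (simp add: form_domain_def)
qed

text \<open>Here the equation is kept for all test functions \<open>w\<close>, because the shift
  along \<open>\<xi>\<close> in \<open>deficit_shift\<close> needs the cross term with
  \<open>w\<close>.\<close>

lemma log_eigenfunction1_version:
  assumes eig: "log_eigenfunction1 \<Omega> \<xi>'" and nn: "nonneg_normalized_on \<Omega> \<xi>'"
  obtains \<xi> where "\<xi> \<in> form_domain" "sqnorm \<xi> = 1" "AE x in lborel. 0 \<le> \<xi> x" "AE x in lborel. \<xi>' x = \<xi> x"
    "\<And>w. w \<in> form_domain \<Longrightarrow> log_form \<xi> w = log_eigenvalue1 \<Omega> * (LBINT x. \<xi> x * w x)"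
proof -
  have HL: "\<xi>' \<in> HL_space \<Omega>" and n1: "L2_norm_on \<Omega> \<xi>' = 1"
    using eig nn by (auto simp: log_eigenfunction1_def nonneg_normalized_on_def)
  obtain \<xi> where x: "\<xi> \<in> form_domain" "AE x in lborel. \<xi>' x = \<xi> x" "sqnorm \<xi> = 1"
    using HL_version[OF HL n1] .
  have "AE x in lborel. 0 \<le> \<xi>' x"
    using nn by (simp add: nonneg_normalized_on_def AE_completion_iff)
  with x(2) have pos: "AE x in lborel. 0 \<le> \<xi> x" by eventually_elim simp
  have "log_form \<xi> w = log_eigenvalue1 \<Omega> * (LBINT x. \<xi> x * w x)" if w: "w \<in> form_domain" for w
  proof -
    have m [measurable]: "\<xi> \<in> borel_measurable borel" "w \<in> borel_measurable borel" using form_domainD x w by auto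
    have "log_form \<xi> w = log_form \<xi>' w"
      using log_form_eq[OF form_domainD(1)[OF x(1)] form_domainD(1)[OF w], of \<xi>' w] x(2)
        log_form_eq[OF form_domainD(1)[OF x(1)] form_domainD(1)[OF w], of \<xi> w] by simp
    also have "\<dots> = log_eigenvalue1 \<Omega> * (LINT x:\<Omega>|lebesgue. \<xi>' x * w x)"
      using eig form_domain_HL[OF w] by (simp add: log_eigenfunction1_def)
    also have "(LINT x:\<Omega>|lebesgue. \<xi>' x * w x) = (LBINT x. \<xi> x * w x)"
      unfolding set_lebesgue_integral_def
    proof (rule lebesgue_integral_AE_borel(1))
      show "AE x in lborel. indicator \<Omega> x *\<^sub>R (\<xi>' x * w x) = \<xi> x * w x"
        using x(2)
      proof eventually_elim
        case (elim x)
        then show ?case using L2_zeroD(2)[OF form_domainD(1)[OF w], of x] by (auto simp: indicator_def)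
      qed
    qed measurable
    finally show ?thesis .
  qed
  with x pos show thesis using that by blast
qed

text \<open>By the eigenvalue equation the deficit \<open>log_energy u - \<lambda> * sqnorm u\<close> is invariant under
  \<open>u \<mapsto> u - t * \<xi>\<close>; choosing \<open>t\<close> so that the mean vanishes turns it into an \<open>L\<^sup>1\<close> bound.\<close>

lemma deficit_shift:
  assumes u: "u \<in> form_domain" "sqnorm u = 1" and x: "\<xi> \<in> form_domain" "sqnorm \<xi> = 1"
    and eig: "\<And>w. w \<in> form_domain \<Longrightarrow> log_form \<xi> w = log_eigenvalue1 \<Omega> * (LBINT x. \<xi> x * w x)"
    and mean: "(LBINT x. u x) = t * (LBINT x. \<xi> x)"
  shows "log_const DIM('a) * diam powr (- real DIM('a)) * (LBINT x. \<bar>u x - t * \<xi> x\<bar>)\<^sup>2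
      \<le> log_energy u - log_eigenvalue1 \<Omega>"
    and "sqnorm (\<lambda>x. u x - \<xi> x) = 2 - 2 * (LBINT x. \<xi> x * u x)"
    and "sqnorm (\<lambda>x. u x - t * \<xi> x) = 1 - 2 * t * (LBINT x. \<xi> x * u x) + t\<^sup>2"
proof -
  note uD = form_domainD[OF u(1)] and xD = form_domainD[OF x(1)]
  let ?w = "\<lambda>x. u x - t * \<xi> x" and ?a = "LBINT x. \<xi> x * u x"
  have w: "?w \<in> form_domain" using form_domain_linear[OF u(1) x(1), of 1 "- t"] by simp
  have sq: "sqnorm (\<lambda>x. u x - r * \<xi> x) = 1 - 2 * r * ?a + r\<^sup>2" for r
  proof -
    have "(\<lambda>x. (u x - r * \<xi> x)\<^sup>2) = (\<lambda>x. (u x)\<^sup>2 - 2 * r * (\<xi> x * u x) + r\<^sup>2 * (\<xi> x)\<^sup>2)"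
      by (rule ext) (simp add: power2_eq_square algebra_simps)
    then show ?thesis
      unfolding u(2)[symmetric] using x(2) L2_zeroD(3)[OF uD(1)] L2_zeroD(3)[OF xD(1)] integrable_prod[OF xD(1) uD(1)]
      by (simp add: sqnorm_def)
  qed
  show "sqnorm ?w = 1 - 2 * t * ?a + t\<^sup>2" by (rule sq)
  show "sqnorm (\<lambda>x. u x - \<xi> x) = 2 - 2 * ?a" using sq[of 1] by simp
  have "log_energy \<xi> = log_eigenvalue1 \<Omega>"
    using eig[OF x(1)] log_form_self[OF xD(1), of \<xi>] x(2) by (simp add: sqnorm_def power2_eq_square)
  then have "log_energy ?w = log_energy u - 2 * t * (log_eigenvalue1 \<Omega> * ?a) + t\<^sup>2 * log_eigenvalue1 \<Omega>"
    using log_energy_diff[OF uD(1) xD(1) uD(2) xD(2), of t] eig[OF u(1)] by simp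
  then have "log_energy ?w - log_eigenvalue1 \<Omega> * sqnorm ?w = log_energy u - log_eigenvalue1 \<Omega>"
    unfolding sq by (simp add: algebra_simps)
  moreover have "(LBINT x. ?w x) = 0"
    using L2_zero_integrable(1)[OF uD(1)] L2_zero_integrable(1)[OF xD(1)] mean by simp
  ultimately show "log_const DIM('a) * diam powr (- real DIM('a)) * (LBINT x. \<bar>?w x\<bar>)\<^sup>2
      \<le> log_energy u - log_eigenvalue1 \<Omega>"
    using L1_deficit[OF w] by simp
qed

text \<open>Nonnegative normalized functions whose energies tend to the minimum must tend to the
  ground state. The constants are fixed in this order: a bound \<open>M\<close> on the near energy
  of \<open>?w\<close>, then a scale \<open>d\<close> at which the logarithm beats \<open>M\<close>,
  then the tolerance \<open>\<eta>\<close> in energy that makes the L1 term harmless at that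
  scale.\<close>

lemma minimizing_family_converges:
  fixes u :: "real \<Rightarrow> 'a \<Rightarrow> real"
  assumes u: "eventually (\<lambda>s. u s \<in> form_domain \<and> sqnorm (u s) = 1 \<and> (AE x in lborel. 0 \<le> u s x)) F"
    and lim: "((\<lambda>s. log_energy (u s)) \<longlongrightarrow> log_eigenvalue1 \<Omega>) F"
    and x: "\<xi> \<in> form_domain" "sqnorm \<xi> = 1" "AE x in lborel. 0 \<le> \<xi> x"
    and eig: "\<And>w. w \<in> form_domain \<Longrightarrow> log_form \<xi> w = log_eigenvalue1 \<Omega> * (LBINT x. \<xi> x * w x)"
  shows "((\<lambda>s. sqnorm (\<lambda>x. u s x - \<xi> x)) \<longlongrightarrow> 0) F"
proof (rule tendstoI)
  fix e' :: real assume "e' > 0"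
  define e where "e = e' / 2"
  have e: "e > 0" "e < e'" using \<open>e' > 0\<close> by (auto simp: e_def)
  let ?N = "real DIM('a)" and ?c = "log_const DIM('a)" and ?l = "log_eigenvalue1 \<Omega>"
  have c: "?c > 0" by (simp add: log_const_pos)
  note xD = form_domainD[OF x(1)]
  have [measurable]: "\<xi> \<in> borel_measurable borel" by (rule xD)
  define b where "b = (LBINT x. \<xi> x)"
  \<comment> \<open>A nonnegative function of norm 1 has positive integral, which permits the
    division by \<open>b\<close> in the choice of \<open>t\<close>.\<close>
  have b: "b > 0"
  proof -
    have "b \<ge> 0" unfolding b_def by (rule integral_nonneg_AE[OF x(3)])
    moreover have "b \<noteq> 0"
    proof
      assume "b = 0"
      then have "AE x in lborel. \<xi> x = 0"
        using integral_nonneg_eq_0_iff_AE[OF L2_zero_integrable(1)[OF xD(1)] x(3)] by (simp add: b_def)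
      then have "AE x in lborel. (\<xi> x)\<^sup>2 = 0" by eventually_elim simp
      then have "sqnorm \<xi> = 0" unfolding sqnorm_def by (intro integral_eq_zero_AE)
      with x(2) show False by simp
    qed
    ultimately show ?thesis by simp
  qed
  \<comment> \<open>\<open>K\<close> bounds the weighted near energy of any \<open>g\<close> whose
    logarithmic energy is below \<open>?l + 1\<close>. \<open>M\<close> then bounds the near energy
    of \<open>g - t * \<xi>\<close>, using that the square of \<open>t\<close> is at most
    \<open>vol / b\<^sup>2\<close>.\<close>
  define K where "K = ?l + 1 + (?c * vol + \<bar>log_rho DIM('a)\<bar>)"
  define M where "M = 4 / ?c * K + 2 * (vol / b\<^sup>2) * near_energy 0 \<xi>"
  \<comment> \<open>\<open>R\<close> is the value of \<open>ln (1 / d)\<close> for which the bound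
    \<open>1 + \<bar>M\<bar>\<close> on the right of \<open>sqnorm_le_L1\<close> forces
    \<open>2 * sqnorm ?w \<le> e\<close>.\<close>
  define R where "R = (1 + \<bar>M\<bar>) * ?c / e"
  define d where "d = exp (- R)"
  have R: "R > 0" unfolding R_def using c e by (intro divide_pos_pos mult_pos_pos) auto
  have d: "0 < d" "d \<le> 1" "ln (1 / d) = R" using R by (auto simp: d_def ln_div)
  define h where "h = ?c * diam powr (- ?N)"
  have h: "h > 0" using c diam_ge_1 by (simp add: h_def)
  \<comment> \<open>The 1 matches the \<open>?l + 1\<close> in \<open>K\<close>; the other entry
    makes the L1 term of \<open>sqnorm_le_L1\<close> at most 1.\<close>
  define \<eta> where "\<eta> = min 1 (h / (2 * d powr (- ?N)))"
  have \<eta>: "\<eta> > 0" unfolding \<eta>_def using h d by auto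
  have "eventually (\<lambda>s. dist (log_energy (u s)) ?l < \<eta>) F"
    using lim \<eta> by (rule tendstoD)
  with u show "eventually (\<lambda>s. dist (sqnorm (\<lambda>x. u s x - \<xi> x)) 0 < e') F"
  proof eventually_elim
    case (elim s)
    define g where "g = u s"
    have g: "g \<in> form_domain" "sqnorm g = 1" "AE x in lborel. 0 \<le> g x" and le: "log_energy g < ?l + \<eta>"
      using elim by (auto simp: g_def dist_real_def)
    note gD = form_domainD[OF g(1)]
    define t where "t = (LBINT x. g x) / b"
    have mean: "(LBINT x. g x) = t * (LBINT x. \<xi> x)" using b by (simp add: t_def b_def)
    note sh = deficit_shift[OF g(1,2) x(1,2) eig mean]
    let ?w = "\<lambda>x. g x - t * \<xi> x"
    let ?a = "LBINT x. \<xi> x * g x"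
    let ?L = "LBINT x. \<bar>?w x\<bar>"
    have w: "?w \<in> form_domain" using form_domain_linear[OF g(1) x(1), of 1 "- t"] by simp
    have "h * ?L\<^sup>2 \<le> \<eta>" using sh(1) le by (simp add: h_def)
    also have "\<dots> \<le> h / (2 * d powr (- ?N))" by (simp add: \<eta>_def)
    finally have "h * ?L\<^sup>2 \<le> h * (1 / (2 * d powr (- ?N)))" by simp
    then have "?L\<^sup>2 \<le> 1 / (2 * d powr (- ?N))" using h by (simp only: mult_le_cancel_left_pos)
    then have L: "2 * d powr (- ?N) * ?L\<^sup>2 \<le> 1" using d by (simp add: field_simps)
    have "t\<^sup>2 \<le> vol / b\<^sup>2"
    proof -
      have "(LBINT x. g x)\<^sup>2 \<le> (LBINT x. \<bar>g x\<bar>)\<^sup>2"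
        using integral_abs_bound[of lborel g] by (simp add: abs_le_square_iff[symmetric])
      also have "\<dots> \<le> vol" using L1_le_L2[OF gD(1)] g(2) by simp
      finally show ?thesis using b by (simp add: t_def power_divide divide_right_mono)
    qed
    then have "2 * t\<^sup>2 * near_energy 0 \<xi> \<le> 2 * (vol / b\<^sup>2) * near_energy 0 \<xi>"
      by (intro mult_right_mono near_energy_nonneg) auto
    moreover have "near_energy 0 ?w \<le> 2 * near_energy 0 g + 2 * t\<^sup>2 * near_energy 0 \<xi>"
    proof -
      have "near_energy 0 ?w \<le> (LBINT p. 2 * near_density 0 g p + 2 * t\<^sup>2 * near_density 0 \<xi> p)"
        unfolding near_energy_def
        using near_density_add_le[of 0 1 g "- t" \<xi>] form_domainD(2)[OF w] gD(2) xD(2) by (intro integral_mono) auto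
      then show ?thesis unfolding near_energy_def using gD(2) xD(2) by simp
    qed
    moreover have "2 * near_energy 0 g \<le> 4 / ?c * K"
    proof -
      have "?c / 2 * near_energy 0 g \<le> K"
        using near_energy_le_log_energy[OF gD(1)] g(2) le by (simp add: K_def \<eta>_def)
      then show ?thesis using c by (simp add: field_simps)
    qed
    ultimately have "near_energy 0 ?w \<le> \<bar>M\<bar>" by (simp add: M_def)
    then have "2 / ?c * R * sqnorm ?w \<le> 1 + \<bar>M\<bar>"
      using sqnorm_le_L1[OF w d(1,2)] L d(3) by simp
    moreover have "2 / ?c * R * sqnorm ?w = 2 * sqnorm ?w * ((1 + \<bar>M\<bar>) / e)"
      using c by (simp add: R_def)
    ultimately have "2 * sqnorm ?w * ((1 + \<bar>M\<bar>) / e) \<le> 1 + \<bar>M\<bar>"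
      by simp
    then have "2 * sqnorm ?w * (1 + \<bar>M\<bar>) \<le> e * (1 + \<bar>M\<bar>)"
      using e by (simp add: field_simps)
    then have small: "2 * sqnorm ?w \<le> e" by (simp add: mult_le_cancel_right)
    \<comment> \<open>The signs of \<open>g\<close> and \<open>\<xi>\<close> enter here: they
      exclude that \<open>g\<close> is close to \<open>- \<xi>\<close>, which is just as near to the
      line spanned by \<open>\<xi>\<close>.\<close>
    have a0: "0 \<le> ?a"
      by (rule integral_nonneg_AE) (use x(3) g(3) in eventually_elim, simp)
    have "0 \<le> sqnorm (\<lambda>x. g x - \<xi> x)" by (rule sqnorm_nonneg)
    then have a1: "?a \<le> 1" using sh(2) by simp
    \<comment> \<open>The squared distance from \<open>g\<close> to the line spanned by
      \<open>\<xi>\<close> is \<open>1 - ?a\<^sup>2\<close>, and it dominates \<open>1 - ?a\<close>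
      because \<open>?a\<close> lies between 0 and 1.\<close>
    have "sqnorm ?w = (t - ?a)\<^sup>2 + (1 - ?a\<^sup>2)" using sh(3) by (simp add: power2_eq_square algebra_simps)
    then have "1 - ?a\<^sup>2 \<le> sqnorm ?w" by simp
    moreover have "?a * ?a \<le> ?a * 1" using a0 a1 by (intro mult_left_mono)
    ultimately have "sqnorm (\<lambda>x. g x - \<xi> x) \<le> 2 * sqnorm ?w"
      using sh(2) by (simp add: power2_eq_square)
    then show ?case using small e sqnorm_nonneg[of "\<lambda>x. g x - \<xi> x"] by (simp add: g_def)
  qed
qed

text \<open>The fractional eigenfunctions are a minimizing family for the logarithmic energy. From
  below this is the variational principle; from above, \<open>frac_form_ge\<close> at
  \<open>u s\<close> is solved for the logarithmic energy, and the limit of the difference quotient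
  of the eigenvalue makes both sides meet.\<close>

lemma eigenfunctions_converge:
  assumes ev: "((\<lambda>s. (frac_eigenvalue1 s \<Omega> - 1) / s) \<longlongrightarrow> log_eigenvalue1 \<Omega>) (at_right 0)"
    and u': "\<And>s. s \<in> {0<..<1} \<Longrightarrow> frac_eigenfunction1 s \<Omega> (u' s) \<and> nonneg_normalized_on \<Omega> (u' s)"
    and x': "log_eigenfunction1 \<Omega> \<xi>'" "nonneg_normalized_on \<Omega> \<xi>'"
  shows "((\<lambda>s. L2_norm_on \<Omega> (\<lambda>x. u' s x - \<xi>' x)) \<longlongrightarrow> 0) (at_right 0)"
proof -
  let ?l = "log_eigenvalue1 \<Omega>" and ?k = "frac_ratio DIM('a)"
  have N: "DIM('a) > 0" by simp
  obtain \<xi> where x: "\<xi> \<in> form_domain" "sqnorm \<xi> = 1" "AE x in lborel. 0 \<le> \<xi> x" "AE x in lborel. \<xi>' x = \<xi> x"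
    and eig: "\<And>w. w \<in> form_domain \<Longrightarrow> log_form \<xi> w = ?l * (LBINT x. \<xi> x * w x)"
    using log_eigenfunction1_version[OF x'] by blast
  have "\<exists>u. \<forall>s\<in>{0<..<1}. u s \<in> form_domain \<and> integrable lborel (near_density s (u s)) \<and> sqnorm (u s) = 1 \<and>
    (AE x in lborel. 0 \<le> u s x) \<and> (AE x in lborel. u' s x = u s x) \<and> frac_form s (u s) (u s) = frac_eigenvalue1 s \<Omega>"
  proof (rule bchoice, rule ballI)
    fix s :: real assume s: "s \<in> {0<..<1}"
    then have "0 < s" by simp
    then obtain u where "u \<in> form_domain" "integrable lborel (near_density s u)" "sqnorm u = 1"
      "AE x in lborel. 0 \<le> u x" "AE x in lborel. u' s x = u x" "frac_form s u u = frac_eigenvalue1 s \<Omega>"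
      by (rule frac_eigenfunction1_version[OF conjunct1[OF u'[OF s]] conjunct2[OF u'[OF s]]])
    then show "\<exists>u. u \<in> form_domain \<and> integrable lborel (near_density s u) \<and> sqnorm u = 1 \<and>
      (AE x in lborel. 0 \<le> u x) \<and> (AE x in lborel. u' s x = u x) \<and> frac_form s u u = frac_eigenvalue1 s \<Omega>"
      by blast
  qed
  then obtain u where u: "\<And>s. s \<in> {0<..<1} \<Longrightarrow> u s \<in> form_domain \<and> integrable lborel (near_density s (u s)) \<and> sqnorm (u s) = 1 \<and>
    (AE x in lborel. 0 \<le> u s x) \<and> (AE x in lborel. u' s x = u s x) \<and> frac_form s (u s) (u s) = frac_eigenvalue1 s \<Omega>"
    by blast
  have ev01: "eventually (\<lambda>s::real. s \<in> {0<..<1}) (at_right 0)"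
    by (rule eventually_at_right_real) simp
  have "((\<lambda>s. log_energy (u s)) \<longlongrightarrow> ?l) (at_right 0)"
  proof (rule tendsto_sandwich)
    show "eventually (\<lambda>s. ?l \<le> log_energy (u s)) (at_right 0)"
      using ev01 by eventually_elim (use u log_eigenvalue1_le in force)
    show "eventually (\<lambda>s. log_energy (u s) \<le>
      ((frac_eigenvalue1 s \<Omega> - 1) / s - (?k s - 1) / s) / ?k s + log_rho DIM('a) + far_defect s) (at_right 0)"
      using ev01
    proof eventually_elim
      case (elim s)
      then have s: "0 < s" "s < 1" by auto
      note k = frac_ratio_pos[OF s N]
      have "?k s * (1 + s * (log_energy (u s) - log_rho DIM('a) - far_defect s)) \<le> frac_eigenvalue1 s \<Omega>"
        using frac_form_ge[of "u s" s] u[OF elim] s form_domainD(1)[of "u s"] by simp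
      then have "?k s * (s * (log_energy (u s) - log_rho DIM('a) - far_defect s)) \<le> frac_eigenvalue1 s \<Omega> - ?k s"
        by (simp add: algebra_simps)
      then have "log_energy (u s) - log_rho DIM('a) - far_defect s \<le> (frac_eigenvalue1 s \<Omega> - ?k s) / (?k s * s)"
        using s k by (simp add: pos_le_divide_eq mult_ac)
      also have "\<dots> = ((frac_eigenvalue1 s \<Omega> - 1) / s - (?k s - 1) / s) / ?k s"
        using s k by (simp add: field_simps)
      finally show ?case by simp
    qed
    have "((\<lambda>s. ((frac_eigenvalue1 s \<Omega> - 1) / s - (?k s - 1) / s) / ?k s + log_rho DIM('a) + far_defect s)
        \<longlongrightarrow> (?l - log_rho DIM('a)) / 1 + log_rho DIM('a) + 0) (at_right 0)"
      by (intro tendsto_intros ev frac_ratio_tendsto N far_defect_tendsto) simp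
    then show "((\<lambda>s. ((frac_eigenvalue1 s \<Omega> - 1) / s - (?k s - 1) / s) / ?k s + log_rho DIM('a) + far_defect s)
        \<longlongrightarrow> ?l) (at_right 0)" by simp
  qed simp
  then have "((\<lambda>s. sqnorm (\<lambda>x. u s x - \<xi> x)) \<longlongrightarrow> 0) (at_right 0)"
    by (intro minimizing_family_converges x(1-3) eig) (use ev01 in eventually_elim, use u in auto)
  then have "((\<lambda>s. sqrt (sqnorm (\<lambda>x. u s x - \<xi> x))) \<longlongrightarrow> sqrt 0) (at_right 0)"
    by (rule tendsto_real_sqrt)
  then have "((\<lambda>s. sqrt (sqnorm (\<lambda>x. u s x - \<xi> x))) \<longlongrightarrow> 0) (at_right 0)" by simp
  then show ?thesis
  proof (rule Lim_transform_eventually)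
    show "eventually (\<lambda>s. sqrt (sqnorm (\<lambda>x. u s x - \<xi> x)) = L2_norm_on \<Omega> (\<lambda>x. u' s x - \<xi>' x)) (at_right 0)"
      using ev01
    proof eventually_elim
      case (elim s)
      have "AE x in lborel. u' s x - \<xi>' x = u s x - \<xi> x"
        using u[OF elim] x(4) by (auto elim: eventually_elim2)
      moreover have "(\<lambda>x. u s x - \<xi> x) \<in> L2_zero \<Omega>"
        using L2_zero_linear[of "u s" \<xi> 1 "-1"] u[OF elim] x form_domainD(1) by auto
      ultimately show ?case using L2_norm_on_eq(1) by simp
    qed
  qed
qed

end

section \<open>Cutoff at a Lipschitz boundary\<close>

text \<open>Sliding a strip of height \<open>2 * \<delta>\<close> in the direction \<open>e\<close> covers each point for a time at most \<open>2 * \<delta>\<close>.\<close>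

lemma emeasure_strip_le:
  fixes h :: "'a::euclidean_space \<Rightarrow> real"
  assumes S [measurable]: "S \<in> sets borel" and T: "T > 0" and d: "\<delta> \<ge> 0" and e: "norm e = 1"
    and S_strip: "\<And>x. x \<in> S \<Longrightarrow> \<bar>h x\<bar> \<le> \<delta>" and S_ball: "S \<subseteq> ball p r"
    and shift: "\<And>x t. h (x + t *\<^sub>R e) = h x + t"
  shows "ennreal T * emeasure lborel S \<le> ennreal (2 * \<delta>) * emeasure lborel (ball p (r + T))"
proof -
  \<comment> \<open>Tonelli for the pairs \<open>(x, t)\<close> with
    \<open>x - t *\<^sub>R e\<close> in \<open>S\<close>. Integrating over \<open>x\<close> first
    gives \<open>T\<close> times the volume of \<open>S\<close>; integrating over \<open>t\<close>
    first gives at most \<open>2 * \<delta>\<close> for each \<open>x\<close>, and 0 outside the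
    enlarged ball.\<close>
  let ?f = "\<lambda>(x, t). indicator {0..T} t * indicator S (x + (- t) *\<^sub>R e) :: ennreal"
  have m: "?f \<in> borel_measurable (lborel \<Otimes>\<^sub>M lborel)" by measurable
  have m' [measurable]: "(\<lambda>x. indicator S (x + c)) \<in> borel_measurable (borel :: 'a measure)" for c
    by measurable
  have "ennreal T * emeasure lborel S = (\<integral>\<^sup>+t. indicator {0..T} t * emeasure lborel S \<partial>lborel)"
    using T by (subst nn_integral_multc) auto
  also have "\<dots> = (\<integral>\<^sup>+t. (\<integral>\<^sup>+x. ?f (x, t) \<partial>lborel) \<partial>lborel)"
  proof (rule nn_integral_cong)
    fix t :: real
    have "(\<integral>\<^sup>+x. ?f (x, t) \<partial>lborel) = indicator {0..T} t * (\<integral>\<^sup>+x. indicator S (- t *\<^sub>R e + x) \<partial>lborel)"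
      by (subst nn_integral_cmult[symmetric]) (auto simp: add.commute)
    also have "(\<integral>\<^sup>+x. indicator S (- t *\<^sub>R e + x) \<partial>lborel) = emeasure lborel S"
      by (subst nn_integral_lborel_translate) auto
    finally show "indicator {0..T} t * emeasure lborel S = (\<integral>\<^sup>+x. ?f (x, t) \<partial>lborel)" by simp
  qed
  also have "\<dots> = (\<integral>\<^sup>+x. (\<integral>\<^sup>+t. ?f (x, t) \<partial>lborel) \<partial>lborel)"
    by (rule lborel_pair.Fubini'[symmetric]) (use m in simp)
  also have "\<dots> \<le> (\<integral>\<^sup>+x. ennreal (2 * \<delta>) * indicator (ball p (r + T)) x \<partial>lborel)"
  proof (rule nn_integral_mono)
    fix x :: 'a
    show "(\<integral>\<^sup>+t. ?f (x, t) \<partial>lborel) \<le> ennreal (2 * \<delta>) * indicator (ball p (r + T)) x"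
    proof (cases "x \<in> ball p (r + T)")
      case True
      have "(\<integral>\<^sup>+t. ?f (x, t) \<partial>lborel) \<le> (\<integral>\<^sup>+t. indicator {h x - \<delta> .. h x + \<delta>} t \<partial>lborel)"
      proof (rule nn_integral_mono)
        fix t :: real
        have "t \<in> {h x - \<delta> .. h x + \<delta>}" if "x + (- t) *\<^sub>R e \<in> S"
          using S_strip[OF that] shift[of x "- t"] by (auto simp: abs_le_iff)
        then show "?f (x, t) \<le> indicator {h x - \<delta> .. h x + \<delta>} t"
          by (auto simp: indicator_def)
      qed
      also have "\<dots> = ennreal (2 * \<delta>)" using d by simp
      finally show ?thesis using True by simp
    next
      case False
      have f0: "?f (x, t) = 0" for t
      proof (cases "t \<in> {0..T} \<and> x + (- t) *\<^sub>R e \<in> S")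
        case True
        then have "dist p (x + (- t) *\<^sub>R e) < r" using S_ball by auto
        moreover have "dist p x \<le> dist p (x + (- t) *\<^sub>R e) + norm (t *\<^sub>R e)"
          using dist_triangle[of p x "x + (- t) *\<^sub>R e"] by (simp add: dist_norm)
        ultimately have "dist p x < r + T" using True e by simp
        with False show ?thesis by simp
      qed auto
      have "(\<integral>\<^sup>+t. ?f (x, t) \<partial>lborel) = (\<integral>\<^sup>+t. 0 \<partial>(lborel :: real measure))"
        by (intro nn_integral_cong f0)
      also have "\<dots> \<le> ennreal (2 * \<delta>) * indicator (ball p (r + T)) x" by simp
      finally show ?thesis .
    qed
  qed
  also have "\<dots> = ennreal (2 * \<delta>) * emeasure lborel (ball p (r + T))"
    by (subst nn_integral_cmult_indicator) auto
  finally show ?thesis .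
qed

text \<open>The height \<open>?h\<close> above the graph vanishes on the boundary and is Lipschitz,
  so points within \<open>\<epsilon>\<close> of the boundary lie in a strip where
  \<open>\<bar>?h\<bar>\<close> is at most a multiple of \<open>\<epsilon>\<close>, and
  \<open>emeasure_strip_le\<close> measures that strip. A Borel superset \<open>S\<close> is
  produced so that measurability of the neighbourhood itself need not be discussed.\<close>

lemma lipschitz_boundary_chart:
  fixes \<Omega> :: "'a::euclidean_space set"
  assumes "open \<Omega>" "lipschitz_boundary \<Omega>" "p \<in> frontier \<Omega>"
  obtains r C where "r > 0" "C \<ge> 0"
    "\<And>\<epsilon>. 0 \<le> \<epsilon> \<Longrightarrow> \<epsilon> \<le> r \<Longrightarrow> \<exists>S\<in>sets borel. {x \<in> ball p (2 * r). \<exists>q\<in>frontier \<Omega> \<inter> ball p r. dist x q \<le> \<epsilon>} \<subseteq> S \<and> emeasure lborel S \<le> ennreal (C * \<epsilon>)"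
proof -
  obtain r0 e g L where r0: "r0 > 0" and e: "norm e = 1" and g: "L-lipschitz_on {y. y \<bullet> e = 0} (g :: 'a \<Rightarrow> real)"
    and chart: "\<Omega> \<inter> ball p r0 = {x \<in> ball p r0. x \<bullet> e > g (x - (x \<bullet> e) *\<^sub>R e)}"
    using assms by (auto simp: lipschitz_boundary_def)
  let ?P = "\<lambda>x. x - (x \<bullet> e) *\<^sub>R e"
  let ?h = "\<lambda>x. x \<bullet> e - g (?P x)"
  have ee: "e \<bullet> e = 1" using e by (simp add: norm_eq_1)
  have L: "L \<ge> 0" using g by (rule lipschitz_on_nonneg)
  have P: "?P x \<in> {y. y \<bullet> e = 0}" for x using ee by (simp add: inner_diff_left)
  have hlip: "\<bar>?h x - ?h y\<bar> \<le> (1 + 2 * L) * dist x y" for x y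
  proof -
    have 1: "\<bar>(x - y) \<bullet> e\<bar> \<le> dist x y"
      using Cauchy_Schwarz_ineq2[of "x - y" e] e by (simp add: dist_norm)
    have "dist (?P x) (?P y) = norm ((x - y) - ((x - y) \<bullet> e) *\<^sub>R e)"
      by (simp add: dist_norm algebra_simps)
    also have "\<dots> \<le> norm (x - y) + norm (((x - y) \<bullet> e) *\<^sub>R e)" by (rule norm_triangle_ineq4)
    also have "\<dots> \<le> 2 * dist x y" using 1 e by (simp add: dist_norm)
    finally have "dist (g (?P x)) (g (?P y)) \<le> L * (2 * dist x y)"
      using lipschitz_onD[OF g P P, of x y] L by (meson mult_left_mono order_trans)
    moreover have "?h x - ?h y = (x - y) \<bullet> e - (g (?P x) - g (?P y))"
      by (simp add: inner_diff_left)
    ultimately show ?thesis using 1 by (simp add: dist_real_def algebra_simps)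
  qed
  have "(1 + 2 * L)-lipschitz_on UNIV ?h"
    using hlip L by (intro lipschitz_onI) (auto simp: dist_real_def)
  then have hcont: "continuous_on UNIV ?h" by (rule lipschitz_on_continuous_on)
  have h0: "?h q = 0" if q: "q \<in> frontier \<Omega>" "q \<in> ball p r0" for q
  proof (rule ccontr)
    assume "?h q \<noteq> 0"
    then consider "?h q > 0" | "?h q < 0" by linarith
    then show False
    proof cases
      case 1
      then have "q \<in> \<Omega>" using q chart by auto
      then show False using q(1) assms(1) by (simp add: frontier_def interior_open)
    next
      case 2
      have "open {x. ?h x < 0}" using hcont by (intro open_Collect_less) auto
      then have "open ({x. ?h x < 0} \<inter> ball p r0)" by auto
      moreover have "q \<in> ({x. ?h x < 0} \<inter> ball p r0) \<inter> closure \<Omega>" using 2 q by (auto simp: frontier_def)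
      ultimately have "({x. ?h x < 0} \<inter> ball p r0) \<inter> \<Omega> \<noteq> {}"
        by (metis open_Int_closure_eq_empty empty_iff)
      then obtain y where "y \<in> \<Omega> \<inter> ball p r0" "?h y < 0" by blast
      then have "y \<in> {x \<in> ball p r0. x \<bullet> e > g (?P x)}" using chart by blast
      then show False using \<open>?h y < 0\<close> by simp
    qed
  qed
  \<comment> \<open>Points within \<open>\<epsilon> \<le> r\<close> of \<open>ball p r\<close> lie
    in \<open>ball p (2 * r)\<close>, and sliding by \<open>2 * r\<close> leads at most to
    \<open>ball p r0\<close>, whose volume is \<open>B\<close>. This explains the quarter and the
    denominator of \<open>C\<close>.\<close>
  define r where "r = r0 / 4"
  define B where "B = measure lborel (ball p r0)"
  define C where "C = 2 * (1 + 2 * L) * B / (2 * r)"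
  have r: "r > 0" using r0 by (simp add: r_def)
  have C: "C \<ge> 0" using L r by (simp add: C_def B_def)
  show thesis
  proof (rule that[OF r C])
    fix \<epsilon> :: real assume eps: "0 \<le> \<epsilon>" "\<epsilon> \<le> r"
    let ?S = "{x \<in> ball p (2 * r). \<bar>?h x\<bar> \<le> (1 + 2 * L) * \<epsilon>}"
    have "closed {x. \<bar>?h x\<bar> \<le> (1 + 2 * L) * \<epsilon>}"
      by (rule closed_Collect_le[OF continuous_on_rabs[OF hcont] continuous_on_const])
    moreover have "?S = ball p (2 * r) \<inter> {x. \<bar>?h x\<bar> \<le> (1 + 2 * L) * \<epsilon>}" by auto
    ultimately have S: "?S \<in> sets borel" by auto
    have "{x \<in> ball p (2 * r). \<exists>q\<in>frontier \<Omega> \<inter> ball p r. dist x q \<le> \<epsilon>} \<subseteq> ?S"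
      proof safe
        fix x q assume x: "x \<in> ball p (2 * r)" and q: "q \<in> frontier \<Omega>" "q \<in> ball p r" "dist x q \<le> \<epsilon>"
        have "?h q = 0" using q(2) r0 by (intro h0 q(1)) (auto simp: r_def)
        then have "\<bar>?h x\<bar> \<le> (1 + 2 * L) * dist x q" using hlip[of x q] by simp
        also have "\<dots> \<le> (1 + 2 * L) * \<epsilon>" using q(3) L by (intro mult_left_mono) auto
        finally show "\<bar>?h x\<bar> \<le> (1 + 2 * L) * \<epsilon>" .
      qed
    moreover have "emeasure lborel ?S \<le> ennreal (C * \<epsilon>)"
    proof -
      have fin: "emeasure lborel ?S < \<infinity>"
        by (rule order.strict_trans1[OF emeasure_mono emeasure_lborel_ball_finite[of p "2 * r"]]) auto
      have eqB: "emeasure lborel (ball p (2 * r + 2 * r)) = ennreal B"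
        unfolding B_def using emeasure_lborel_ball_finite[of p r0] by (simp add: r_def emeasure_eq_ennreal_measure)
      have "ennreal (2 * r) * emeasure lborel ?S \<le> ennreal (2 * ((1 + 2 * L) * \<epsilon>)) * emeasure lborel (ball p (2 * r + 2 * r))"
      proof (rule emeasure_strip_le[where h = ?h, OF S _ _ e])
        show "?h (x + t *\<^sub>R e) = ?h x + t" for x t
          using ee by (simp add: inner_add_left scaleR_add_left)
      qed (use r L eps in auto)
      also have "\<dots> = ennreal (2 * ((1 + 2 * L) * \<epsilon>) * B)"
        unfolding eqB using L eps by (subst ennreal_mult) (auto simp: B_def)
      also have "2 * ((1 + 2 * L) * \<epsilon>) * B = 2 * r * (C * \<epsilon>)"
        using r by (simp add: C_def)
      also have "ennreal (2 * r * (C * \<epsilon>)) = ennreal (2 * r) * ennreal (C * \<epsilon>)"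
        using r C eps by (intro ennreal_mult) auto
      finally show ?thesis
        using r by (simp add: ennreal_mult_le_mult_iff)
    qed
    ultimately show "\<exists>S\<in>sets borel. {x \<in> ball p (2 * r). \<exists>q\<in>frontier \<Omega> \<inter> ball p r. dist x q \<le> \<epsilon>} \<subseteq> S \<and> emeasure lborel S \<le> ennreal (C * \<epsilon>)"
      by (intro bexI[of _ ?S] conjI S)
  qed
qed

text \<open>Finitely many charts cover the compact frontier. The frontier point nearest to
  \<open>x\<close> lies in one of their balls, so \<open>x\<close> lies in the strip of that chart.
  The Lipschitz hypothesis is used later in this form.\<close>

lemma emeasure_boundary_strip:
  fixes \<Omega> :: "'a::euclidean_space set"
  assumes "open \<Omega>" "bounded \<Omega>" "\<Omega> \<noteq> {}" "lipschitz_boundary \<Omega>"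
  obtains r C where "r > 0" "C \<ge> 0"
    "\<And>\<epsilon>. 0 < \<epsilon> \<Longrightarrow> \<epsilon> \<le> r \<Longrightarrow> emeasure lborel {x. infdist x (frontier \<Omega>) < \<epsilon>} \<le> ennreal (C * \<epsilon>)"
proof -
  let ?F = "frontier \<Omega>"
  have F: "compact ?F" "?F \<noteq> {}"
    using assms by (auto simp: compact_frontier_bounded frontier_eq_empty)
  let ?good = "\<lambda>p r C. r > 0 \<and> C \<ge> 0 \<and> (\<forall>\<epsilon>. 0 \<le> \<epsilon> \<longrightarrow> \<epsilon> \<le> r \<longrightarrow>
      (\<exists>S\<in>sets borel. {x \<in> ball p (2 * r). \<exists>q\<in>?F \<inter> ball p r. dist x q \<le> \<epsilon>} \<subseteq> S \<and> emeasure lborel S \<le> ennreal (C * \<epsilon>)))"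
  have "\<forall>p\<in>?F. \<exists>rC. ?good p (fst rC) (snd rC)"
  proof
    fix p assume "p \<in> ?F"
    then obtain r C where "?good p r C"
      by (rule lipschitz_boundary_chart[OF assms(1,4)]) blast
    then show "\<exists>rC. ?good p (fst rC) (snd rC)" by (intro exI[of _ "(r, C)"]) simp
  qed
  from bchoice[OF this] obtain rC where rC: "\<forall>p\<in>?F. ?good p (fst (rC p)) (snd (rC p))" by blast
  define r C where "r p = fst (rC p)" and "C p = snd (rC p)" for p
  have r: "\<And>p. p \<in> ?F \<Longrightarrow> r p > 0" and C: "\<And>p. p \<in> ?F \<Longrightarrow> C p \<ge> 0"
    and strip: "\<And>p \<epsilon>. p \<in> ?F \<Longrightarrow> 0 \<le> \<epsilon> \<Longrightarrow> \<epsilon> \<le> r p \<Longrightarrow>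
      \<exists>S\<in>sets borel. {x \<in> ball p (2 * r p). \<exists>q\<in>?F \<inter> ball p (r p). dist x q \<le> \<epsilon>} \<subseteq> S \<and> emeasure lborel S \<le> ennreal (C p * \<epsilon>)"
    using rC by (auto simp: r_def C_def)
  have "?F \<subseteq> (\<Union>p\<in>?F. ball p (r p))" using r by auto
  then obtain A where A: "A \<subseteq> ?F" "finite A" "?F \<subseteq> (\<Union>p\<in>A. ball p (r p))"
    using compactE_image[OF F(1), of ?F "\<lambda>p. ball p (r p)"] by auto
  have "A \<noteq> {}" using A F by auto
  define r0 where "r0 = Min (r ` A)"
  have r0: "r0 > 0" unfolding r0_def using A \<open>A \<noteq> {}\<close> r by (subst Min_gr_iff) auto
  have r0_le: "r0 \<le> r p" if "p \<in> A" for p unfolding r0_def using A that by auto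
  show thesis
  proof (rule that[OF r0])
    show "0 \<le> (\<Sum>p\<in>A. C p)" using A C by (intro sum_nonneg) auto
    fix \<epsilon> :: real assume eps: "0 < \<epsilon>" "\<epsilon> \<le> r0"
    have "\<forall>p\<in>A. \<exists>S. S \<in> sets borel \<and> {x \<in> ball p (2 * r p). \<exists>q\<in>?F \<inter> ball p (r p). dist x q \<le> \<epsilon>} \<subseteq> S
        \<and> emeasure lborel S \<le> ennreal (C p * \<epsilon>)"
    proof
      fix p assume p: "p \<in> A"
      then have "p \<in> ?F" "\<epsilon> \<le> r p" using A(1) r0_le[OF p] eps by auto
      from strip[OF this(1) less_imp_le[OF eps(1)] this(2)]
      show "\<exists>S. S \<in> sets borel \<and> {x \<in> ball p (2 * r p). \<exists>q\<in>?F \<inter> ball p (r p). dist x q \<le> \<epsilon>} \<subseteq> S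
        \<and> emeasure lborel S \<le> ennreal (C p * \<epsilon>)" by blast
    qed
    from bchoice[OF this] obtain S where S: "\<And>p. p \<in> A \<Longrightarrow> S p \<in> sets borel"
      "\<And>p. p \<in> A \<Longrightarrow> {x \<in> ball p (2 * r p). \<exists>q\<in>?F \<inter> ball p (r p). dist x q \<le> \<epsilon>} \<subseteq> S p"
      "\<And>p. p \<in> A \<Longrightarrow> emeasure lborel (S p) \<le> ennreal (C p * \<epsilon>)"
      by blast
    have "emeasure lborel {x. infdist x ?F < \<epsilon>} \<le> emeasure lborel (\<Union>p\<in>A. S p)"
    proof (rule emeasure_mono)
      show "{x. infdist x ?F < \<epsilon>} \<subseteq> (\<Union>p\<in>A. S p)"
      proof
        fix x assume "x \<in> {x. infdist x ?F < \<epsilon>}"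
        moreover obtain q where q: "q \<in> ?F" "infdist x ?F = dist x q"
          using infdist_attains_inf[OF compact_imp_closed[OF F(1)] F(2)] by metis
        ultimately have d: "dist x q < \<epsilon>" by simp
        obtain p where p: "p \<in> A" "q \<in> ball p (r p)" using A q by auto
        have "dist p x < 2 * r p"
          using dist_triangle[of p x q] d p eps r0_le[OF p(1)] by (simp add: dist_commute)
        moreover have "\<exists>q\<in>?F \<inter> ball p (r p). dist x q \<le> \<epsilon>"
          using p(2) q(1) d by (intro bexI[of _ q]) auto
        ultimately have "x \<in> S p" by (intro subsetD[OF S(2)[OF p(1)]]) simp
        then show "x \<in> (\<Union>p\<in>A. S p)" using p(1) by blast
      qed
    qed (use A S in auto)
    also have "\<dots> \<le> (\<Sum>p\<in>A. emeasure lborel (S p))"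
      by (rule emeasure_subadditive_finite) (use A S in auto)
    also have "\<dots> \<le> (\<Sum>p\<in>A. ennreal (C p * \<epsilon>))"
      by (intro sum_mono S)
    also have "\<dots> = ennreal ((\<Sum>p\<in>A. C p) * \<epsilon>)"
      using A C eps by (subst sum_ennreal) (auto simp: sum_distrib_right)
    finally show "emeasure lborel {x. infdist x ?F < \<epsilon>} \<le> ennreal ((\<Sum>p\<in>A. C p) * \<epsilon>)" .
  qed
qed

lemma continuous_on_infdist_UNIV: "continuous_on UNIV (\<lambda>x. infdist x A)"
  by (intro continuous_intros)

text \<open>It vanishes on a whole neighbourhood of width \<open>\<epsilon>\<close> of the boundary,
  which leaves room for a mollification that stays inside the domain.\<close>

definition boundary_cutoff :: "'a::euclidean_space set \<Rightarrow> real \<Rightarrow> 'a \<Rightarrow> real" where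
  "boundary_cutoff F \<epsilon> x = max 0 (min 1 (infdist x F / \<epsilon> - 1))"

lemma boundary_cutoff_bounds: "0 \<le> boundary_cutoff F \<epsilon> x" "boundary_cutoff F \<epsilon> x \<le> 1"
  by (auto simp: boundary_cutoff_def)

lemma borel_measurable_boundary_cutoff [measurable]: "boundary_cutoff F \<epsilon> \<in> borel_measurable borel"
  unfolding boundary_cutoff_def
  by (intro borel_measurable_max borel_measurable_min borel_measurable_diff borel_measurable_divide borel_measurable_const
      borel_measurable_continuous_onI[OF continuous_on_infdist_UNIV])

lemma boundary_cutoff_eq_0: "\<epsilon> > 0 \<Longrightarrow> infdist x F \<le> \<epsilon> \<Longrightarrow> boundary_cutoff F \<epsilon> x = 0"
  by (simp add: boundary_cutoff_def field_simps)

lemma boundary_cutoff_eq_1: "\<epsilon> > 0 \<Longrightarrow> infdist x F \<ge> 2 * \<epsilon> \<Longrightarrow> boundary_cutoff F \<epsilon> x = 1"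
  by (simp add: boundary_cutoff_def field_simps)

lemma boundary_cutoff_lipschitz:
  assumes "\<epsilon> > 0"
  shows "\<bar>boundary_cutoff F \<epsilon> x - boundary_cutoff F \<epsilon> y\<bar> \<le> norm (x - y) / \<epsilon>"
proof -
  have "\<bar>boundary_cutoff F \<epsilon> x - boundary_cutoff F \<epsilon> y\<bar> \<le> \<bar>infdist x F / \<epsilon> - infdist y F / \<epsilon>\<bar>"
  proof -
    have "\<bar>max 0 (min 1 (a - 1)) - max 0 (min 1 (b - 1))\<bar> \<le> \<bar>a - b\<bar>" for a b :: real by linarith
    then show ?thesis unfolding boundary_cutoff_def .
  qed
  also have "\<dots> = \<bar>infdist x F - infdist y F\<bar> / \<epsilon>"
    using assms by (simp add: abs_divide flip: diff_divide_distrib)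
  also have "\<dots> \<le> norm (x - y) / \<epsilon>"
    using assms infdist_triangle_abs[of x F y] by (intro divide_right_mono) (auto simp: dist_norm)
  finally show ?thesis .
qed

text \<open>The exponent \<open>1/2\<close> is only chosen strictly between \<open>0\<close> and \<open>1\<close>: the square of the cutoff gradient
  costs \<open>\<epsilon> powr (- 1/2)\<close>, which the volume \<open>O(\<epsilon>)\<close> of the strip absorbs.\<close>

lemma boundary_cutoff_diff_square_le:
  assumes "\<epsilon> > 0"
  shows "(boundary_cutoff F \<epsilon> x - boundary_cutoff F \<epsilon> y)\<^sup>2
    \<le> (indicator {x. infdist x F < 2 * \<epsilon>} x + indicator {x. infdist x F < 2 * \<epsilon>} y)
      * (\<epsilon> powr (- 1/2) * norm (x - y) powr (1/2))"
proof (cases "infdist x F < 2 * \<epsilon> \<or> infdist y F < 2 * \<epsilon>")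
  case True
  let ?d = "\<bar>boundary_cutoff F \<epsilon> x - boundary_cutoff F \<epsilon> y\<bar>" and ?t = "norm (x - y) / \<epsilon>"
  have t: "?t \<ge> 0" using assms by simp
  have d: "?d \<le> 1" "?d \<le> ?t" "0 \<le> ?d"
    using boundary_cutoff_bounds[of F \<epsilon> x] boundary_cutoff_bounds[of F \<epsilon> y] boundary_cutoff_lipschitz[OF assms] by auto
  have "?d\<^sup>2 \<le> ?t powr (1/2)"
  proof (cases "?d = 0")
    case False
    then have "?d > 0" using d(3) by linarith
    then have "?d\<^sup>2 = ?d powr 2" by simp
    also have "\<dots> \<le> ?d powr (1/2)" using d \<open>?d > 0\<close> by (intro powr_mono') auto
    also have "\<dots> \<le> ?t powr (1/2)" using d by (intro powr_mono2) auto
    finally show ?thesis .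
  qed simp
  also have "\<dots> = \<epsilon> powr (- 1/2) * norm (x - y) powr (1/2)"
  proof -
    have "?t powr (1/2) = norm (x - y) powr (1/2) / \<epsilon> powr (1/2)"
      by (rule powr_divide)
    then show ?thesis by (simp add: powr_minus_divide)
  qed
  finally have "?d\<^sup>2 \<le> 1 * (\<epsilon> powr (- 1/2) * norm (x - y) powr (1/2))" by simp
  also have "\<dots> \<le> (indicator {x. infdist x F < 2 * \<epsilon>} x + indicator {x. infdist x F < 2 * \<epsilon>} y)
      * (\<epsilon> powr (- 1/2) * norm (x - y) powr (1/2))"
    using True by (intro mult_right_mono) (auto simp: indicator_def)
  finally show ?thesis by simp
next
  case False
  then show ?thesis using assms by (simp add: boundary_cutoff_eq_1)
qed

lemma measurable_infdist_less: "{x::'a::euclidean_space. infdist x F < r} \<in> sets borel"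
proof -
  have "open {x::'a. infdist x F < r}"
    by (rule open_Collect_less[OF continuous_on_infdist_UNIV continuous_on_const])
  then show ?thesis by simp
qed

section \<open>Truncation and boundary cutoff in the form domain\<close>

context bounded_open_set
begin

text \<open>Truncating the values is a contraction, so no difference \<open>u x - u y\<close> grows.
  A bound \<open>M\<close> is wanted because the error of the boundary cutoff is proportional to the
  square of \<open>M\<close>.\<close>

lemma truncate_approx:
  assumes u: "u \<in> form_domain" and e: "e > 0"
  obtains v M where "v \<in> form_domain" "\<And>x. \<bar>v x\<bar> \<le> M" "sqnorm (\<lambda>x. v x - u x) < e" "near_energy 0 v \<le> near_energy 0 u"
proof -
  note uD = form_domainD[OF u]
  have [measurable]: "u \<in> borel_measurable borel" by (rule uD)
  let ?v = "\<lambda>n x. max (- real n) (min (real n) (u x))"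
  have "(\<lambda>n. LBINT x. (?v n x - u x)\<^sup>2) \<longlonglongrightarrow> (LINT x|(lborel :: 'a measure). 0)"
  proof (rule integral_dominated_convergence)
    show "integrable lborel (\<lambda>x. (u x)\<^sup>2)" by (rule L2_zeroD(3)[OF uD(1)])
    show "AE x in lborel. (\<lambda>n. (?v n x - u x)\<^sup>2) \<longlonglongrightarrow> 0"
    proof (rule AE_I2)
      fix x :: 'a
      obtain m :: nat where m: "\<bar>u x\<bar> \<le> real m" using real_arch_simple by blast
      show "(\<lambda>n. (?v n x - u x)\<^sup>2) \<longlonglongrightarrow> 0"
      proof (rule tendsto_eventually, rule eventually_sequentiallyI)
        fix n assume "m \<le> n"
        then have "real m \<le> real n" by simp
        then show "(?v n x - u x)\<^sup>2 = 0" using m by auto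
      qed
    qed
    show "AE x in lborel. norm ((?v n x - u x)\<^sup>2) \<le> (u x)\<^sup>2" for n
    proof (rule AE_I2)
      fix x :: 'a
      have "\<bar>?v n x - u x\<bar> \<le> \<bar>u x\<bar>" by auto
      then show "norm ((?v n x - u x)\<^sup>2) \<le> (u x)\<^sup>2" by (simp add: abs_le_square_iff)
    qed
  qed measurable
  then have "(\<lambda>n. sqnorm (\<lambda>x. ?v n x - u x)) \<longlonglongrightarrow> 0" by (simp add: sqnorm_def)
  then have "eventually (\<lambda>n. sqnorm (\<lambda>x. ?v n x - u x) < e) sequentially"
    using e by (rule order_tendstoD)
  then obtain n where n: "sqnorm (\<lambda>x. ?v n x - u x) < e"
    by (meson eventually_sequentially order_refl)
  have vL: "?v n \<in> L2_zero \<Omega>" by (rule L2_zero_dominated[OF uD(1)]) auto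
  have le: "near_density 0 (?v n) p \<le> near_density 0 u p" for p
  proof -
    have "\<bar>?v n (fst p) - ?v n (snd p)\<bar> \<le> \<bar>u (fst p) - u (snd p)\<bar>" by auto
    then show ?thesis
      unfolding near_density_def by (intro mult_right_mono mult_left_mono) (auto simp: abs_le_square_iff)
  qed
  have iv: "integrable lborel (near_density 0 (?v n))"
    by (rule Bochner_Integration.integrable_bound[OF uD(2)]) (use le in \<open>auto simp: near_density_nonneg\<close>)
  show thesis
  proof (rule that[of "?v n" "real n"])
    show "near_energy 0 (?v n) \<le> near_energy 0 u"
      unfolding near_energy_def by (rule integral_mono[OF iv uD(2) le])
  qed (use vL iv n in \<open>auto simp: form_domain_def\<close>)
qed

text \<open>Product rule for differences: one term carries the difference of \<open>u\<close> times
  the cutoff, the other \<open>u\<close> times the difference of the cutoff. Young's inequality with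
  weight \<open>\<theta>\<close> keeps the coefficient of the first term close to 1; the second is
  concentrated near the strip and is integrated by
  \<open>boundary_cutoff_diff_square_le\<close>.\<close>

lemma cutoff_energy_bound:
  assumes u: "u \<in> form_domain" and M: "\<And>x. \<bar>u x\<bar> \<le> M" and eps: "\<epsilon> > 0" and \<theta>: "\<theta> > 0"
    and strip: "emeasure lborel {x. infdist x F < 2 * \<epsilon>} \<le> ennreal m" and m: "m \<ge> 0"
  defines "v \<equiv> (\<lambda>x. boundary_cutoff F \<epsilon> x * u x)"
  defines "I \<equiv> (LINT z|(lborel :: 'a measure). indicator {..1} (norm z) * norm z powr (1/2 - real DIM('a)))"
  shows "v \<in> form_domain" "sqnorm (\<lambda>x. v x - u x) \<le> M\<^sup>2 * m"
    "near_energy 0 v \<le> (1 + \<theta>) * near_energy 0 u + (1 + 1 / \<theta>) * M\<^sup>2 * \<epsilon> powr (- 1/2) * (2 * m * I)"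
proof -
  let ?T = "{x. infdist x F < 2 * \<epsilon>}" and ?\<psi> = "boundary_cutoff F \<epsilon>"
  note uD = form_domainD[OF u]
  have [measurable]: "u \<in> borel_measurable borel" "v \<in> borel_measurable borel" "?T \<in> sets borel"
    using uD measurable_infdist_less unfolding v_def by auto
  have M0: "M \<ge> 0" using M[of undefined] abs_ge_zero order_trans by blast
  have T: "integrable lborel (indicator ?T :: 'a \<Rightarrow> real)" "(LBINT x. indicator ?T x) \<le> m"
  proof -
    have "emeasure lborel ?T < \<infinity>" using strip by (rule order.strict_trans1) simp
    then show "integrable lborel (indicator ?T :: 'a \<Rightarrow> real)" by (intro integrable_real_indicator) auto
    show "(LBINT x. indicator ?T x) \<le> m"
      using strip m by (simp add: measure_def enn2real_leI)
  qed
  have \<psi>: "\<bar>?\<psi> x\<bar> \<le> 1" for x using boundary_cutoff_bounds[of F \<epsilon> x] by simp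
  have vle: "\<bar>v x\<bar> \<le> \<bar>u x\<bar>" for x
    using mult_right_mono[OF \<psi>[of x], of "\<bar>u x\<bar>"] by (simp add: v_def abs_mult)
  have vL: "v \<in> L2_zero \<Omega>" by (rule L2_zero_dominated[OF uD(1) _ vle]) simp
  have "sqnorm (\<lambda>x. v x - u x) \<le> (LBINT x. M\<^sup>2 * indicator ?T x)"
    unfolding sqnorm_def
  proof (rule integral_mono)
    have "(\<lambda>x. 1 * v x + (- 1) * u x) \<in> L2_zero \<Omega>" by (intro L2_zero_linear vL uD)
    then show "integrable lborel (\<lambda>x. (v x - u x)\<^sup>2)" by (auto dest: L2_zeroD(3))
    show "integrable lborel (\<lambda>x. M\<^sup>2 * indicator ?T x)" using T by simp
    fix x
    show "(v x - u x)\<^sup>2 \<le> M\<^sup>2 * indicator ?T x"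
    proof (cases "x \<in> ?T")
      case True
      have "v x - u x = - ((1 - ?\<psi> x) * u x)" by (simp add: v_def algebra_simps)
      then have "\<bar>v x - u x\<bar> = (1 - ?\<psi> x) * \<bar>u x\<bar>" using boundary_cutoff_bounds[of F \<epsilon> x] by (simp add: abs_mult)
      also have "\<dots> \<le> 1 * M" using boundary_cutoff_bounds[of F \<epsilon> x] M by (intro mult_mono) auto
      finally show ?thesis using True M0 by (simp add: abs_le_square_iff[symmetric])
    next
      case False
      then show ?thesis using eps by (simp add: v_def boundary_cutoff_eq_1)
    qed
  qed
  also have "\<dots> \<le> M\<^sup>2 * m" using T by (simp add: mult_left_mono)
  finally show "sqnorm (\<lambda>x. v x - u x) \<le> M\<^sup>2 * m" .
  let ?G = "\<lambda>r. indicator {..1} r * r powr (1/2 - real DIM('a))"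
  have iG: "integrable lborel (\<lambda>z::'a. ?G (norm z))"
    using integrable_radial_powr_cball[of "1/2", where 'a='a] by simp
  have I0: "I \<ge> 0" unfolding I_def by (intro integral_nonneg_AE) auto
  have G: "(\<integral>\<^sup>+z. ennreal (?G (norm (z::'a))) \<partial>lborel) = ennreal I"
    unfolding I_def by (subst nn_integral_eq_integral[OF iG]) auto
  have Gm: "?G \<in> borel_measurable borel" by measurable
  note hb = has_bochner_integral_radial_conv[OF T(1) _ Gm _ G I0, simplified]
  let ?c = "(1 + 1 / \<theta>) * M\<^sup>2 * \<epsilon> powr (- 1/2)"
  have c: "?c \<ge> 0" using \<theta> by simp
  let ?R = "\<lambda>p. (1 + \<theta>) * near_density 0 u p + ?c * (indicator ?T (fst p) * ?G (norm (fst p - snd p)) + indicator ?T (snd p) * ?G (norm (fst p - snd p)))"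
  have le: "near_density 0 v p \<le> ?R p" for p
  proof (cases "norm (fst p - snd p) \<le> 1")
    case True
    let ?x = "fst p" and ?y = "snd p"
    let ?k = "rkern 0 (?x - ?y)"
    define a b where "a = ?\<psi> ?y * (u ?x - u ?y)" and "b = u ?x * (?\<psi> ?x - ?\<psi> ?y)"
    have "v ?x - v ?y = a + b" by (simp add: v_def a_def b_def algebra_simps)
    moreover have "(a + b)\<^sup>2 \<le> (1 + \<theta>) * a\<^sup>2 + (1 + 1 / \<theta>) * b\<^sup>2"
    proof -
      have "0 \<le> (\<theta> * a - b)\<^sup>2 / \<theta>" using \<theta> by simp
      also have "\<dots> = \<theta> * a\<^sup>2 - 2 * (a * b) + b\<^sup>2 / \<theta>"
        using \<theta> by (simp add: field_simps power2_eq_square)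
      finally show ?thesis by (simp add: power2_sum algebra_simps)
    qed
    moreover have "a\<^sup>2 \<le> (u ?x - u ?y)\<^sup>2"
    proof -
      have "\<bar>a\<bar> \<le> 1 * \<bar>u ?x - u ?y\<bar>" unfolding a_def abs_mult by (intro mult_right_mono \<psi>) auto
      then show ?thesis by (simp add: abs_le_square_iff)
    qed
    moreover have "b\<^sup>2 \<le> M\<^sup>2 * (?\<psi> ?x - ?\<psi> ?y)\<^sup>2"
      unfolding b_def power_mult_distrib
      using M[of ?x] M0 by (intro mult_right_mono) (auto simp: abs_le_square_iff[symmetric])
    ultimately have "(v ?x - v ?y)\<^sup>2 \<le> (1 + \<theta>) * (u ?x - u ?y)\<^sup>2 + (1 + 1 / \<theta>) * (M\<^sup>2 * (?\<psi> ?x - ?\<psi> ?y)\<^sup>2)"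
      using \<theta> by (smt (verit) mult_left_mono divide_nonneg_nonneg)
    also have "\<dots> \<le> (1 + \<theta>) * (u ?x - u ?y)\<^sup>2 + (1 + 1 / \<theta>) * (M\<^sup>2 * ((indicator ?T ?x + indicator ?T ?y)
      * (\<epsilon> powr (- 1/2) * norm (?x - ?y) powr (1/2))))"
      using \<theta> by (intro add_left_mono mult_left_mono boundary_cutoff_diff_square_le eps) auto
    finally have "(v ?x - v ?y)\<^sup>2 * ?k \<le> ((1 + \<theta>) * (u ?x - u ?y)\<^sup>2 + (1 + 1 / \<theta>) * (M\<^sup>2 * ((indicator ?T ?x + indicator ?T ?y)
      * (\<epsilon> powr (- 1/2) * norm (?x - ?y) powr (1/2))))) * ?k"
      by (intro mult_right_mono) auto
    also have "\<dots> = (1 + \<theta>) * ((u ?x - u ?y)\<^sup>2 * ?k) + ?c * ((indicator ?T ?x + indicator ?T ?y) * (norm (?x - ?y) powr (1/2) * ?k))"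
      by (simp add: algebra_simps)
    also have "norm (?x - ?y) powr (1/2) * ?k = norm (?x - ?y) powr (1/2 - real DIM('a))"
      unfolding rkern_def by (simp flip: powr_add)
    finally show ?thesis using True by (simp add: near_density_def distrib_right)
  next
    case False
    then show ?thesis by (simp add: near_density_def)
  qed
  have iR: "integrable lborel ?R" using uD(2) hb by (simp add: has_bochner_integral_iff)
  have iv: "integrable lborel (near_density 0 v)"
  proof (rule Bochner_Integration.integrable_bound[OF iR])
    have "norm (near_density 0 v p) \<le> norm (?R p)" for p
      unfolding real_norm_def abs_of_nonneg[OF near_density_nonneg] by (rule order_trans[OF le abs_ge_self])
    then show "AE p in lborel. norm (near_density 0 v p) \<le> norm (?R p)" by (rule AE_I2)
  qed simp
  with vL show "v \<in> form_domain" by (simp add: form_domain_def)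
  have "near_energy 0 v \<le> (LBINT p. ?R p)"
    unfolding near_energy_def by (rule integral_mono[OF iv iR le])
  also have "\<dots> = (1 + \<theta>) * near_energy 0 u + ?c * ((LBINT x. indicator ?T x) * I + (LBINT x. indicator ?T x) * I)"
    unfolding near_energy_def using uD(2) hb by (simp add: has_bochner_integral_iff)
  also have "\<dots> \<le> (1 + \<theta>) * near_energy 0 u + ?c * (m * I + m * I)"
    using T(2) I0 c by (intro add_left_mono mult_left_mono add_mono mult_right_mono) auto
  also have "m * I + m * I = 2 * m * I" by simp
  finally show "near_energy 0 v \<le> (1 + \<theta>) * near_energy 0 u + ?c * (2 * m * I)" .
qed

lemma cutoff_approx:
  assumes lip: "lipschitz_boundary \<Omega>" and u: "u \<in> form_domain" and M: "\<And>x. \<bar>u x\<bar> \<le> M" and e: "e > 0"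
  obtains v K where "v \<in> form_domain" "\<And>x. \<bar>v x\<bar> \<le> M" "compact K" "K \<subseteq> \<Omega>" "\<And>x. x \<notin> K \<Longrightarrow> v x = 0"
    "sqnorm (\<lambda>x. v x - u x) < e" "near_energy 0 v < near_energy 0 u + e"
proof -
  let ?F = "frontier \<Omega>"
  define I where "I = (LINT z|(lborel :: 'a measure). indicator {..1} (norm z) * norm z powr (1/2 - real DIM('a)))"
  obtain r C where rC: "r > 0" "C \<ge> 0"
    "\<And>\<epsilon>. 0 < \<epsilon> \<Longrightarrow> \<epsilon> \<le> r \<Longrightarrow> emeasure lborel {x. infdist x ?F < \<epsilon>} \<le> ennreal (C * \<epsilon>)"
    using emeasure_boundary_strip[OF open_dom bounded_dom nonempty_dom lip] by blast
  define E where "E = near_energy 0 u"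
  have E: "E \<ge> 0" unfolding E_def by (rule near_energy_nonneg)
  \<comment> \<open>Chosen so that \<open>\<theta> * E\<close> takes at most half of the allowed
    error; the \<open>+ 1\<close> covers \<open>E = 0\<close>.\<close>
  define \<theta> where "\<theta> = e / (2 * (E + 1))"
  have \<theta>: "\<theta> > 0" using e E by (simp add: \<theta>_def)
  have "\<theta> * E \<le> \<theta> * (E + 1)" using \<theta> by (intro mult_left_mono) auto
  also have "\<dots> = e / 2"
  proof -
    have "e / (2 * t) * t = e / 2" if "t > 0" for t using that by simp
    then show ?thesis unfolding \<theta>_def using E by (metis add_nonneg_pos zero_less_one)
  qed
  finally have \<theta>E: "\<theta> * E \<le> e / 2" .
  \<comment> \<open>The factor \<open>4 * C * I\<close> is \<open>2 * m * I\<close> with the strip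
    volume \<open>m = C * (2 * \<epsilon>)\<close>; the power of \<open>\<epsilon>\<close> in it
    against \<open>\<epsilon> powr (- 1/2)\<close> leaves
    \<open>\<epsilon> powr (1/2)\<close>.\<close>
  have "((\<lambda>\<epsilon>. (1 + 1 / \<theta>) * M\<^sup>2 * (4 * C * I) * \<epsilon> powr (1/2)) \<longlongrightarrow> (1 + 1 / \<theta>) * M\<^sup>2 * (4 * C * I) * 0 powr (1/2)) (at_right 0)"
    by (intro tendsto_intros tendsto_powr') (auto simp: eventually_at_filter)
  then have "eventually (\<lambda>\<epsilon>. (1 + 1 / \<theta>) * M\<^sup>2 * (4 * C * I) * \<epsilon> powr (1/2) < e / 2) (at_right 0)"
    by (rule order_tendstoD(2)) (use e in simp)
  moreover have "((\<lambda>\<epsilon>. M\<^sup>2 * (C * (2 * \<epsilon>))) \<longlongrightarrow> M\<^sup>2 * (C * (2 * 0))) (at_right 0)"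
    by (intro tendsto_intros)
  then have "eventually (\<lambda>\<epsilon>. M\<^sup>2 * (C * (2 * \<epsilon>)) < e) (at_right 0)"
    by (rule order_tendstoD(2)) (use e in simp)
  moreover have "eventually (\<lambda>\<epsilon>. \<epsilon> \<in> {0<..<r / 2}) (at_right 0)"
    by (rule eventually_at_right_real) (use rC in simp)
  ultimately have "eventually (\<lambda>\<epsilon>. (1 + 1 / \<theta>) * M\<^sup>2 * (4 * C * I) * \<epsilon> powr (1/2) < e / 2 \<and> M\<^sup>2 * (C * (2 * \<epsilon>)) < e \<and> \<epsilon> \<in> {0<..<r / 2}) (at_right 0)"
    by eventually_elim simp
  then obtain \<epsilon> where eps: "(1 + 1 / \<theta>) * M\<^sup>2 * (4 * C * I) * \<epsilon> powr (1/2) < e / 2" "M\<^sup>2 * (C * (2 * \<epsilon>)) < e" "0 < \<epsilon>" "2 * \<epsilon> \<le> r"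
    using eventually_happens[of _ "at_right (0::real)"] by fastforce
  let ?v = "\<lambda>x. boundary_cutoff ?F \<epsilon> x * u x"
  have m: "0 \<le> C * (2 * \<epsilon>)" using rC eps by simp
  have strip: "emeasure lborel {x. infdist x ?F < 2 * \<epsilon>} \<le> ennreal (C * (2 * \<epsilon>))"
    using rC(3)[of "2 * \<epsilon>"] eps by simp
  note b = cutoff_energy_bound[OF u M eps(3) \<theta> strip m, folded I_def]
  let ?K = "closure \<Omega> \<inter> {x. \<epsilon> \<le> infdist x ?F}"
  show thesis
  proof (rule that[of ?v ?K])
    show "?v \<in> form_domain" by (rule b)
    show "\<bar>?v x\<bar> \<le> M" for x
    proof -
      have "\<bar>?v x\<bar> \<le> 1 * M"
        unfolding abs_mult using boundary_cutoff_bounds[of ?F \<epsilon> x] M by (intro mult_mono) auto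
      then show ?thesis by simp
    qed
    have "closed {x. \<epsilon> \<le> infdist x ?F}"
      by (rule closed_Collect_le[OF continuous_on_const continuous_on_infdist_UNIV])
    then show "compact ?K"
      using bounded_dom by (intro compact_Int_closed) (auto simp: compact_closure)
    show "?K \<subseteq> \<Omega>"
    proof
      fix x assume x: "x \<in> ?K"
      then have "x \<notin> ?F" using eps by (auto simp: infdist_zero)
      with x show "x \<in> \<Omega>" using open_dom by (auto simp: frontier_def interior_open)
    qed
    show "?v x = 0" if "x \<notin> ?K" for x
    proof (cases "x \<in> closure \<Omega>")
      case True
      with that have "infdist x ?F \<le> \<epsilon>" by auto
      then show ?thesis using eps by (simp add: boundary_cutoff_eq_0)
    next
      case False
      then have "x \<notin> \<Omega>" using closure_subset by blast
      then show ?thesis using L2_zeroD(2)[OF form_domainD(1)[OF u]] by simp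
    qed
    show "sqnorm (\<lambda>x. ?v x - u x) < e" using b(2) eps(2) by simp
    have pw: "\<epsilon> powr (- 1/2) * \<epsilon> = \<epsilon> powr (1/2)"
      using eps(3) by (simp add: powr_mult_base mult.commute)
    have "near_energy 0 ?v \<le> (1 + \<theta>) * E + (1 + 1 / \<theta>) * M\<^sup>2 * \<epsilon> powr (- 1/2) * (2 * (C * (2 * \<epsilon>)) * I)"
      using b(3) by (simp add: E_def)
    also have "(1 + 1 / \<theta>) * M\<^sup>2 * \<epsilon> powr (- 1/2) * (2 * (C * (2 * \<epsilon>)) * I) = (1 + 1 / \<theta>) * M\<^sup>2 * (4 * C * I) * (\<epsilon> powr (- 1/2) * \<epsilon>)"
      by simp
    also have "\<dots> = (1 + 1 / \<theta>) * M\<^sup>2 * (4 * C * I) * \<epsilon> powr (1/2)" unfolding pw ..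
    also note eps(1)
    finally have "near_energy 0 ?v < (1 + \<theta>) * E + e / 2" by simp
    also have "(1 + \<theta>) * E = E + \<theta> * E" by (simp add: distrib_right)
    finally show "near_energy 0 ?v < near_energy 0 u + e"
      using \<theta>E by (simp add: E_def)
  qed
qed

end

section \<open>Mollification\<close>

text \<open>An exponent of at least 2 makes the positive part differentiable also at its kink. The
  exponents 3 and 2 serve the first and second derivatives of \<open>bump\<close>.\<close>

lemma pos_part_power_has_derivative:
  "((\<lambda>t::real. (max 0 t) ^ Suc (Suc n)) has_real_derivative real (Suc (Suc n)) * (max 0 t) ^ Suc n) (at t)"
proof -
  consider "t > 0" | "t < 0" | "t = 0" by linarith
  then show ?thesis
  proof cases
    case 1
    have "((\<lambda>t::real. t ^ Suc (Suc n)) has_real_derivative real (Suc (Suc n)) * t ^ Suc n) (at t)"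
      by (rule derivative_eq_intros refl | simp)+
    moreover have "eventually (\<lambda>s. s \<in> {0<..}) (nhds t)" using 1 by (intro eventually_nhds_in_open) auto
    then have "eventually (\<lambda>s. (max 0 s) ^ Suc (Suc n) = s ^ Suc (Suc n)) (nhds t)"
      by eventually_elim simp
    ultimately show ?thesis using 1 by (subst DERIV_cong_ev[OF refl _ refl]) auto
  next
    case 2
    have "eventually (\<lambda>s. s \<in> {..<0}) (nhds t)" using 2 by (intro eventually_nhds_in_open) auto
    then have "eventually (\<lambda>s. (max 0 s) ^ Suc (Suc n) = 0) (nhds t)"
      by eventually_elim simp
    then show ?thesis using 2 by (subst DERIV_cong_ev[OF refl _ refl, of _ "\<lambda>_. 0"]) auto
  next
    case 3
    have "((\<lambda>h::real. (max 0 h) ^ Suc n) \<longlongrightarrow> (max 0 0) ^ Suc n) (at 0)"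
      by (intro tendsto_intros)
    then have "((\<lambda>h::real. (max 0 h) ^ Suc n) \<longlongrightarrow> 0) (at 0)" by simp
    moreover have "eventually (\<lambda>h::real. (max 0 h) ^ Suc n = ((max 0 (t + h)) ^ Suc (Suc n) - (max 0 t) ^ Suc (Suc n)) / h) (at 0)"
      unfolding eventually_at_filter
    proof (rule always_eventually, intro allI impI)
      fix h :: real assume "h \<noteq> 0"
      then show "(max 0 h) ^ Suc n = ((max 0 (t + h)) ^ Suc (Suc n) - (max 0 t) ^ Suc (Suc n)) / h"
        using 3 by (cases "h > 0") auto
    qed
    ultimately show ?thesis
      unfolding DERIV_def using 3 by (auto intro: Lim_transform_eventually)
  qed
qed

text \<open>\<open>H i\<close> is the gradient of the partial derivative in direction
  \<open>i\<close>. With vectors in place of bounded linear maps, all integrals in the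
  differentiation of a convolution take values in \<open>'a\<close> or in the reals.\<close>

lemma C2_functionI:
  fixes u :: "'a::euclidean_space \<Rightarrow> real" and G :: "'a \<Rightarrow> 'a" and H :: "'a \<Rightarrow> 'a \<Rightarrow> 'a"
  assumes G: "\<And>x. (u has_derivative (\<lambda>h. G x \<bullet> h)) (at x)"
    and H: "\<And>i x. i \<in> Basis \<Longrightarrow> ((\<lambda>x. G x \<bullet> i) has_derivative (\<lambda>h. H i x \<bullet> h)) (at x)"
    and cont: "\<And>i. i \<in> Basis \<Longrightarrow> continuous_on UNIV (H i)"
  shows "C2_function u"
  unfolding C2_function_def
proof (intro exI conjI allI)
  let ?D = "\<lambda>x. blinfun_inner_right (G x)"
  let ?D2 = "\<lambda>x. \<Sum>i\<in>Basis. blinfun_scaleR_left (blinfun_inner_right i) o\<^sub>L blinfun_inner_right (H i x)"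
  fix x
  show "(u has_derivative blinfun_apply (?D x)) (at x)" using G by simp
  have "?D = (\<lambda>x. \<Sum>i\<in>Basis. (G x \<bullet> i) *\<^sub>R blinfun_inner_right i)"
  proof
    fix x
    have "G x = (\<Sum>i\<in>Basis. (G x \<bullet> i) *\<^sub>R i)" by (rule euclidean_representation[symmetric])
    then have "?D x = blinfun_inner_right (\<Sum>i\<in>Basis. (G x \<bullet> i) *\<^sub>R i)" by simp
    also have "\<dots> = (\<Sum>i\<in>Basis. (G x \<bullet> i) *\<^sub>R blinfun_inner_right i)"
      by (simp add: linear_sum[OF bounded_linear.linear[OF bounded_linear_blinfun_inner_right]]
          linear_scale[OF bounded_linear.linear[OF bounded_linear_blinfun_inner_right]])
    finally show "?D x = (\<Sum>i\<in>Basis. (G x \<bullet> i) *\<^sub>R blinfun_inner_right i)" .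
  qed
  moreover have "((\<lambda>x. \<Sum>i\<in>Basis. (G x \<bullet> i) *\<^sub>R (blinfun_inner_right i :: 'a \<Rightarrow>\<^sub>L real)) has_derivative
      (\<lambda>h. \<Sum>i\<in>Basis. (H i x \<bullet> h) *\<^sub>R blinfun_inner_right i)) (at x)"
    by (intro has_derivative_sum has_derivative_scaleR_left H)
  moreover have "blinfun_apply (?D2 x) = (\<lambda>h. \<Sum>i\<in>Basis. (H i x \<bullet> h) *\<^sub>R blinfun_inner_right i)"
    by (rule ext) (simp add: blinfun.sum_left)
  ultimately show "(?D has_derivative blinfun_apply (?D2 x)) (at x)" by simp
next
  show "continuous_on UNIV (\<lambda>x. \<Sum>i\<in>Basis. blinfun_scaleR_left (blinfun_inner_right i) o\<^sub>L blinfun_inner_right (H i x))"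
    by (intro continuous_on_sum bounded_bilinear.continuous_on[OF bounded_bilinear_blinfun_compose] continuous_on_const
        bounded_linear.continuous_on[OF bounded_linear_blinfun_inner_right] cont)
qed

lemma integrable_conv:
  fixes k :: "'a::euclidean_space \<Rightarrow> 'b::{banach, second_countable_topology}"
  assumes [measurable]: "k \<in> borel_measurable borel" and B: "\<And>z. norm (k z) \<le> B" and v: "integrable lborel v"
  shows "integrable lborel (\<lambda>y. v y *\<^sub>R k (x - y))"
proof (rule Bochner_Integration.integrable_bound)
  have [measurable]: "v \<in> borel_measurable borel" using v by auto
  show "integrable lborel (\<lambda>y. B * \<bar>v y\<bar>)" using v by simp
  show "(\<lambda>y. v y *\<^sub>R k (x - y)) \<in> borel_measurable lborel" by measurable
  have "norm (v y *\<^sub>R k (x - y)) \<le> norm (B * \<bar>v y\<bar>)" for y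
    using mult_right_mono[OF B[of "x - y"], of "\<bar>v y\<bar>"] order_trans[OF norm_ge_zero B[of 0]]
    by (simp add: mult.commute abs_mult)
  then show "AE y in lborel. norm (v y *\<^sub>R k (x - y)) \<le> norm (B * \<bar>v y\<bar>)" by simp
qed

lemma continuous_on_conv:
  fixes k :: "'a::euclidean_space \<Rightarrow> 'b::{banach, second_countable_topology}"
  assumes k: "continuous_on UNIV k" and B: "\<And>z. norm (k z) \<le> B" and v: "integrable lborel v"
  shows "continuous_on UNIV (\<lambda>x. LBINT y. v y *\<^sub>R k (x - y))"
  unfolding continuous_on_sequentially
proof (intro allI ballI impI, elim conjE)
  have [measurable]: "k \<in> borel_measurable borel" using k by (rule borel_measurable_continuous_onI)
  have [measurable]: "v \<in> borel_measurable borel" using v by auto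
  fix X :: "nat \<Rightarrow> 'a" and x assume X: "X \<longlonglongrightarrow> x"
  have "(\<lambda>n. LBINT y. v y *\<^sub>R k (X n - y)) \<longlonglongrightarrow> (LBINT y. v y *\<^sub>R k (x - y))"
  proof (rule integral_dominated_convergence)
    show "integrable lborel (\<lambda>y. B * \<bar>v y\<bar>)" using v by simp
    show "AE y in lborel. (\<lambda>n. v y *\<^sub>R k (X n - y)) \<longlonglongrightarrow> v y *\<^sub>R k (x - y)"
    proof (rule AE_I2)
      fix y
      have "isCont k (x - y)" using k by (simp add: continuous_on_eq_continuous_at)
      then show "(\<lambda>n. v y *\<^sub>R k (X n - y)) \<longlonglongrightarrow> v y *\<^sub>R k (x - y)"
        by (intro tendsto_scaleR tendsto_const isCont_tendsto_compose[of "x - y" k] tendsto_diff X)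
    qed
    show "AE y in lborel. norm (v y *\<^sub>R k (X n - y)) \<le> B * \<bar>v y\<bar>" for n
    proof (rule AE_I2)
      fix y
      show "norm (v y *\<^sub>R k (X n - y)) \<le> B * \<bar>v y\<bar>"
        using mult_right_mono[OF B[of "X n - y"], of "\<bar>v y\<bar>"] by (simp add: mult.commute)
    qed
  qed measurable
  then show "((\<lambda>x. LBINT y. v y *\<^sub>R k (x - y)) \<circ> X) \<longlonglongrightarrow> (LBINT y. v y *\<^sub>R k (x - y))"
    by (simp add: comp_def)
qed

text \<open>Differentiation under the integral sign. The normalized remainder tends to 0 pointwise
  and is dominated by \<open>2 * B * \<bar>v y\<bar>\<close>, half of it from the mean value
  inequality for \<open>k\<close> and half from the bound on \<open>G\<close>.\<close>

lemma conv_has_derivative: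
  fixes k :: "'a::euclidean_space \<Rightarrow> real" and G :: "'a \<Rightarrow> 'a"
  assumes G: "\<And>z. (k has_derivative (\<lambda>h. G z \<bullet> h)) (at z)" and cont: "continuous_on UNIV G"
    and B: "\<And>z. \<bar>k z\<bar> \<le> B" "\<And>z. norm (G z) \<le> B" and v: "integrable lborel v"
  shows "((\<lambda>x. LBINT y. v y *\<^sub>R k (x - y)) has_derivative (\<lambda>h. (LBINT y. v y *\<^sub>R G (x - y)) \<bullet> h)) (at x)"
proof -
  have "continuous_on UNIV k"
    using G by (auto intro!: has_derivative_continuous continuous_at_imp_continuous_on)
  then have km [measurable]: "k \<in> borel_measurable borel" by (rule borel_measurable_continuous_onI)
  have Gm [measurable]: "G \<in> borel_measurable borel" using cont by (rule borel_measurable_continuous_onI)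
  have [measurable]: "v \<in> borel_measurable borel" using v by auto
  let ?f = "\<lambda>x. LBINT y. v y *\<^sub>R k (x - y)" and ?g = "LBINT y. v y *\<^sub>R G (x - y)"
  have ik: "integrable lborel (\<lambda>y. v y *\<^sub>R k (x - y))" for x
    by (rule integrable_conv[OF km _ v, of B]) (use B in auto)
  have iG: "integrable lborel (\<lambda>y. v y *\<^sub>R G (x - y))"
    by (rule integrable_conv[OF Gm _ v, of B]) (use B in auto)
  have lip: "\<bar>k a - k b\<bar> \<le> B * norm (a - b)" for a b
  proof -
    have "norm (k a - k b) \<le> B * norm (a - b)"
    proof (rule differentiable_bound[where S = UNIV and f' = "\<lambda>z h. G z \<bullet> h"])
      show "onorm (\<lambda>h. G z \<bullet> h) \<le> B" for z
      proof (rule onorm_le)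
        fix h
        have "\<bar>G z \<bullet> h\<bar> \<le> norm (G z) * norm h" by (rule Cauchy_Schwarz_ineq2)
        also have "\<dots> \<le> B * norm h" using B by (intro mult_right_mono) auto
        finally show "norm (G z \<bullet> h) \<le> B * norm h" by simp
      qed
    qed (use G in auto)
    then show ?thesis by simp
  qed
  have "((\<lambda>y. norm ((?f y - ?f x) - ?g \<bullet> (y - x)) / norm (y - x)) \<longlongrightarrow> 0) (at x)"
    unfolding tendsto_at_iff_sequentially
  proof (intro allI impI)
    fix X :: "nat \<Rightarrow> 'a" assume X0: "\<forall>i. X i \<in> UNIV - {x}" and X: "X \<longlonglongrightarrow> x"
    let ?q = "\<lambda>n y. v y * ((k (X n - y) - k (x - y) - G (x - y) \<bullet> (X n - x)) / norm (X n - x))"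
    have "(\<lambda>n. LBINT y. ?q n y) \<longlonglongrightarrow> (LINT y|(lborel :: 'a measure). 0)"
    proof (rule integral_dominated_convergence)
      show "integrable lborel (\<lambda>y. 2 * B * \<bar>v y\<bar>)" using v by simp
      show "AE y in lborel. (\<lambda>n. ?q n y) \<longlonglongrightarrow> 0"
      proof (rule AE_I2)
        fix y
        have lim: "((\<lambda>z. norm (k z - k (x - y) - G (x - y) \<bullet> (z - (x - y))) / norm (z - (x - y))) \<longlongrightarrow> 0) (at (x - y))"
          using G[of "x - y"] by (simp add: has_derivative_iff_norm)
        have X1: "\<forall>i. X i - y \<in> UNIV - {x - y}" using X0 by auto
        have X2: "(\<lambda>i. X i - y) \<longlonglongrightarrow> x - y" by (intro tendsto_intros X)
        have "((\<lambda>z. norm (k z - k (x - y) - G (x - y) \<bullet> (z - (x - y))) / norm (z - (x - y))) \<circ> (\<lambda>i. X i - y)) \<longlonglongrightarrow> 0"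
          by (rule lim[unfolded tendsto_at_iff_sequentially, THEN spec, THEN mp, THEN mp, OF X1 X2])
        then have "(\<lambda>n. \<bar>(k (X n - y) - k (x - y) - G (x - y) \<bullet> (X n - x)) / norm (X n - x)\<bar>) \<longlonglongrightarrow> 0"
          by (simp add: comp_def)
        then have "(\<lambda>n. (k (X n - y) - k (x - y) - G (x - y) \<bullet> (X n - x)) / norm (X n - x)) \<longlonglongrightarrow> 0"
          by (simp only: tendsto_rabs_zero_iff)
        from tendsto_mult[OF tendsto_const this, of "v y"] show "(\<lambda>n. ?q n y) \<longlonglongrightarrow> 0" by simp
      qed
      show "AE y in lborel. norm (?q n y) \<le> 2 * B * \<bar>v y\<bar>" for n
      proof (rule AE_I2)
        fix y
        have n0: "norm (X n - x) > 0" using X0 by simp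
        have "\<bar>k (X n - y) - k (x - y)\<bar> \<le> B * norm (X n - x)" using lip[of "X n - y" "x - y"] by simp
        moreover have "\<bar>G (x - y) \<bullet> (X n - x)\<bar> \<le> B * norm (X n - x)"
          by (rule order_trans[OF Cauchy_Schwarz_ineq2]) (use B in \<open>intro mult_right_mono; auto\<close>)
        ultimately have "\<bar>k (X n - y) - k (x - y) - G (x - y) \<bullet> (X n - x)\<bar> \<le> 2 * B * norm (X n - x)" by linarith
        then have "\<bar>(k (X n - y) - k (x - y) - G (x - y) \<bullet> (X n - x)) / norm (X n - x)\<bar> \<le> 2 * B"
          using n0 by (simp add: abs_divide pos_divide_le_eq)
        from mult_left_mono[OF this, of "\<bar>v y\<bar>"] show "norm (?q n y) \<le> 2 * B * \<bar>v y\<bar>"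
          unfolding real_norm_def abs_mult[of "v y"] by (simp only: mult_ac)
      qed
    qed measurable
    then have "(\<lambda>n. LBINT y. ?q n y) \<longlonglongrightarrow> 0" by (simp only: Bochner_Integration.integral_zero)
    then have "(\<lambda>n. norm (LBINT y. ?q n y)) \<longlonglongrightarrow> 0" by (rule tendsto_norm_zero)
    moreover have "norm (LBINT y. ?q n y) = norm ((?f (X n) - ?f x) - ?g \<bullet> (X n - x)) / norm (X n - x)" for n
    proof -
      have "(LBINT y. ?q n y) = (LBINT y. (v y *\<^sub>R k (X n - y) - v y *\<^sub>R k (x - y) - (v y *\<^sub>R G (x - y)) \<bullet> (X n - x)) / norm (X n - x))"
        by (simp add: right_diff_distrib)
      also have "\<dots> = ((?f (X n) - ?f x) - ?g \<bullet> (X n - x)) / norm (X n - x)"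
        using ik iG by (simp del: real_scaleR_def inner_scaleR_left)
      finally show ?thesis by (simp only: real_norm_def abs_divide abs_norm_cancel)
    qed
    ultimately show "((\<lambda>y. norm ((?f y - ?f x) - ?g \<bullet> (y - x)) / norm (y - x)) \<circ> X) \<longlonglongrightarrow> 0"
      by (simp only: comp_def)
  qed
  then show ?thesis
    by (simp add: has_derivative_iff_norm bounded_linear_inner_right)
qed

text \<open>Class C^2 is all that \<open>C2c\<close> asks for, and the third power is the least
  integer power that is twice continuously differentiable across the sphere of radius
  \<open>d\<close>.\<close>

definition bump :: "real \<Rightarrow> 'a::euclidean_space \<Rightarrow> real" where
  "bump d z = (max 0 (d\<^sup>2 - z \<bullet> z)) ^ 3"

definition bump_grad :: "real \<Rightarrow> 'a::euclidean_space \<Rightarrow> 'a" where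
  "bump_grad d z = (- 6 * (max 0 (d\<^sup>2 - z \<bullet> z))\<^sup>2) *\<^sub>R z"

definition bump_hess :: "real \<Rightarrow> 'a::euclidean_space \<Rightarrow> 'a \<Rightarrow> 'a" where
  "bump_hess d i z = (24 * max 0 (d\<^sup>2 - z \<bullet> z) * (z \<bullet> i)) *\<^sub>R z - (6 * (max 0 (d\<^sup>2 - z \<bullet> z))\<^sup>2) *\<^sub>R i"

lemma bump_has_derivative: "(bump d has_derivative (\<lambda>h. bump_grad d z \<bullet> h)) (at z)"
proof -
  have 1: "((\<lambda>z::'a. d\<^sup>2 - z \<bullet> z) has_derivative (\<lambda>h. - 2 * (z \<bullet> h))) (at z)"
    by (rule derivative_eq_intros refl | simp add: inner_commute)+
  have "((\<lambda>t::real. (max 0 t) ^ 3) has_derivative (*) (3 * (max 0 (d\<^sup>2 - z \<bullet> z))\<^sup>2)) (at (d\<^sup>2 - z \<bullet> z))"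
    using pos_part_power_has_derivative[of 1 "d\<^sup>2 - z \<bullet> z"] by (simp add: has_field_derivative_def numeral_eq_Suc)
  from has_derivative_compose[OF 1 this] show ?thesis
    unfolding bump_def bump_grad_def by (rule has_derivative_eq_rhs) (simp add: fun_eq_iff)
qed

lemma bump_grad_has_derivative: "((\<lambda>z. bump_grad d z \<bullet> i) has_derivative (\<lambda>h. bump_hess d i z \<bullet> h)) (at z)"
proof -
  have 1: "((\<lambda>z::'a. d\<^sup>2 - z \<bullet> z) has_derivative (\<lambda>h. - 2 * (z \<bullet> h))) (at z)"
    by (rule derivative_eq_intros refl | simp add: inner_commute)+
  have "((\<lambda>t::real. (max 0 t) ^ 2) has_derivative (*) (2 * max 0 (d\<^sup>2 - z \<bullet> z))) (at (d\<^sup>2 - z \<bullet> z))"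
    using pos_part_power_has_derivative[of 0 "d\<^sup>2 - z \<bullet> z"] by (simp add: has_field_derivative_def numeral_eq_Suc)
  note 2 = has_derivative_compose[OF 1 this]
  have "((\<lambda>z::'a. - 6 * ((max 0 (d\<^sup>2 - z \<bullet> z))\<^sup>2 * (z \<bullet> i))) has_derivative
     (\<lambda>h. - 6 * ((max 0 (d\<^sup>2 - z \<bullet> z))\<^sup>2 * (h \<bullet> i) + 2 * max 0 (d\<^sup>2 - z \<bullet> z) * (- 2 * (z \<bullet> h)) * (z \<bullet> i)))) (at z)"
    by (intro has_derivative_mult_right has_derivative_mult 2 has_derivative_inner_left has_derivative_ident)
  moreover have "(\<lambda>z::'a. - 6 * ((max 0 (d\<^sup>2 - z \<bullet> z))\<^sup>2 * (z \<bullet> i))) = (\<lambda>z. bump_grad d z \<bullet> i)"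
    by (simp add: bump_grad_def mult.assoc)
  moreover have "(\<lambda>h. - 6 * ((max 0 (d\<^sup>2 - z \<bullet> z))\<^sup>2 * (h \<bullet> i) + 2 * max 0 (d\<^sup>2 - z \<bullet> z) * (- 2 * (z \<bullet> h)) * (z \<bullet> i)))
      = (\<lambda>h. bump_hess d i z \<bullet> h)"
    by (simp add: bump_hess_def fun_eq_iff inner_diff_left inner_commute[of i] algebra_simps)
  ultimately show ?thesis by simp
qed

lemma continuous_on_bump: "continuous_on UNIV (bump d)"
  unfolding bump_def by (intro continuous_intros)

lemma continuous_on_bump_grad: "continuous_on UNIV (bump_grad d)"
  unfolding bump_grad_def by (intro continuous_intros)

lemma continuous_on_bump_hess: "continuous_on UNIV (bump_hess d i)"
  unfolding bump_hess_def by (intro continuous_intros)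

lemma bump_outside:
  assumes "d > 0" "norm z \<ge> d"
  shows "bump d z = 0" "bump_grad d z = 0" "bump_hess d i z = 0"
proof -
  have "d\<^sup>2 \<le> (norm z)\<^sup>2" using assms by (intro power_mono) auto
  then have "max 0 (d\<^sup>2 - z \<bullet> z) = 0" by (simp add: power2_norm_eq_inner)
  then show "bump d z = 0" "bump_grad d z = 0" "bump_hess d i z = 0"
    by (simp_all add: bump_def bump_grad_def bump_hess_def)
qed

lemma bounded_if_compact_support:
  fixes f :: "'a::euclidean_space \<Rightarrow> 'b::real_normed_vector"
  assumes "continuous_on UNIV f" "\<And>z. norm z \<ge> d \<Longrightarrow> f z = 0"
  obtains B where "\<And>z. norm (f z) \<le> B"
proof -
  have "compact (f ` cball 0 d)"
    using assms(1) by (intro compact_continuous_image) (auto intro: continuous_on_subset)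
  then have "bounded (f ` cball 0 d)" by (rule compact_imp_bounded)
  then obtain B where B: "B > 0" "\<And>z. z \<in> cball 0 d \<Longrightarrow> norm (f z) \<le> B"
    unfolding bounded_pos by auto
  have "norm (f z) \<le> B" for z
    using B assms(2)[of z] by (cases "norm z \<le> d") auto
  then show thesis by (rule that)
qed

lemma C2_function_conv_bump:
  fixes v :: "'a::euclidean_space \<Rightarrow> real"
  assumes d: "d > 0" and v: "integrable lborel v"
  shows "C2_function (\<lambda>x. LBINT y. v y *\<^sub>R bump d (x - y))"
proof -
  obtain B1 where B1: "\<And>z::'a. norm (bump d z) \<le> B1"
    using bounded_if_compact_support[OF continuous_on_bump, of d d] bump_outside[OF d] by metis
  obtain B2 where B2: "\<And>z::'a. norm (bump_grad d z) \<le> B2"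
    using bounded_if_compact_support[OF continuous_on_bump_grad, of d d] bump_outside[OF d] by metis
  show ?thesis
  proof (rule C2_functionI)
    fix x :: 'a
    show "((\<lambda>x. LBINT y. v y *\<^sub>R bump d (x - y)) has_derivative (\<lambda>h. (LBINT y. v y *\<^sub>R bump_grad d (x - y)) \<bullet> h)) (at x)"
    proof (rule conv_has_derivative[where B = "max B1 B2", OF bump_has_derivative continuous_on_bump_grad _ _ v])
      show "\<bar>bump d z\<bar> \<le> max B1 B2" for z :: 'a using B1[of z] by simp
      show "norm (bump_grad d z) \<le> max B1 B2" for z :: 'a using B2[of z] by simp
    qed
  next
    fix i x :: 'a assume i: "i \<in> Basis"
    obtain B3 where B3: "\<And>z::'a. norm (bump_hess d i z) \<le> B3"
      using bounded_if_compact_support[OF continuous_on_bump_hess, of d d i] bump_outside[OF d] by metis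
    have "((\<lambda>x. LBINT y. v y *\<^sub>R (bump_grad d (x - y) \<bullet> i)) has_derivative
        (\<lambda>h. (LBINT y. v y *\<^sub>R bump_hess d i (x - y)) \<bullet> h)) (at x)"
    proof (rule conv_has_derivative[where B = "max B2 B3", OF bump_grad_has_derivative continuous_on_bump_hess _ _ v])
      show "\<bar>bump_grad d z \<bullet> i\<bar> \<le> max B2 B3" for z :: 'a
        using Cauchy_Schwarz_ineq2[of "bump_grad d z" i] i B2[of z] by (simp add: le_max_iff_disj)
      show "norm (bump_hess d i z) \<le> max B2 B3" for z :: 'a using B3[of z] by simp
    qed
    moreover have "(LBINT y. v y *\<^sub>R (bump_grad d (x - y) \<bullet> i)) = (LBINT y. v y *\<^sub>R bump_grad d (x - y)) \<bullet> i" for x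
    proof -
      have "integrable lborel (\<lambda>y. v y *\<^sub>R bump_grad d (x - y))"
        by (rule integrable_conv[OF borel_measurable_continuous_onI[OF continuous_on_bump_grad] B2 v])
      from integral_inner_left[OF this, of i] show ?thesis by simp
    qed
    ultimately show "((\<lambda>x. (LBINT y. v y *\<^sub>R bump_grad d (x - y)) \<bullet> i) has_derivative
        (\<lambda>h. (LBINT y. v y *\<^sub>R bump_hess d i (x - y)) \<bullet> h)) (at x)" by simp
  next
    fix i :: 'a
    obtain B3 where B3: "\<And>z::'a. norm (bump_hess d i z) \<le> B3"
      using bounded_if_compact_support[OF continuous_on_bump_hess, of d d i] bump_outside[OF d] by metis
    show "continuous_on UNIV (\<lambda>x. LBINT y. v y *\<^sub>R bump_hess d i (x - y))"
      by (rule continuous_on_conv[OF continuous_on_bump_hess B3 v])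
  qed
qed

lemma C2_function_mult:
  fixes u :: "'a::euclidean_space \<Rightarrow> real"
  assumes "C2_function u"
  shows "C2_function (\<lambda>x. c * u x)"
proof -
  obtain Du :: "'a \<Rightarrow> 'a \<Rightarrow>\<^sub>L real" and D2u :: "'a \<Rightarrow> 'a \<Rightarrow>\<^sub>L ('a \<Rightarrow>\<^sub>L real)" where
    D: "\<And>x. (u has_derivative blinfun_apply (Du x)) (at x)" "\<And>x. (Du has_derivative blinfun_apply (D2u x)) (at x)" "continuous_on UNIV D2u"
    using assms unfolding C2_function_def by blast
  show ?thesis
    unfolding C2_function_def
  proof (intro exI conjI allI)
    show "((\<lambda>x. c * u x) has_derivative blinfun_apply (c *\<^sub>R Du x)) (at x)" for x
      using has_derivative_mult_right[OF D(1), of c x] by (simp add: scaleR_blinfun.rep_eq)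
    show "((\<lambda>x. c *\<^sub>R Du x) has_derivative blinfun_apply (c *\<^sub>R D2u x)) (at x)" for x
      using has_derivative_scaleR_right[OF D(2), of c x] by (simp add: scaleR_blinfun.rep_eq)
    show "continuous_on UNIV (\<lambda>x. c *\<^sub>R D2u x)" by (intro continuous_intros D)
  qed
qed

lemma C2_function_lipschitz_on_cball:
  fixes u :: "'a::euclidean_space \<Rightarrow> real"
  assumes "C2_function u"
  obtains L where "L \<ge> 0" "\<And>x y. x \<in> cball 0 r \<Longrightarrow> y \<in> cball 0 r \<Longrightarrow> \<bar>u x - u y\<bar> \<le> L * norm (x - y)"
proof -
  obtain Du :: "'a \<Rightarrow> 'a \<Rightarrow>\<^sub>L real" and D2u :: "'a \<Rightarrow> 'a \<Rightarrow>\<^sub>L ('a \<Rightarrow>\<^sub>L real)" where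
    D: "\<And>x. (u has_derivative blinfun_apply (Du x)) (at x)" "\<And>x. (Du has_derivative blinfun_apply (D2u x)) (at x)"
    using assms unfolding C2_function_def by blast
  have "continuous_on (cball 0 r) Du"
    using D(2) by (auto intro!: has_derivative_continuous continuous_at_imp_continuous_on)
  then have "bounded (Du ` cball 0 r)"
    by (intro compact_imp_bounded compact_continuous_image) auto
  then obtain L where L: "L > 0" "\<And>x. x \<in> cball 0 r \<Longrightarrow> norm (Du x) \<le> L"
    unfolding bounded_pos by auto
  show thesis
  proof (rule that[of L])
    show "L \<ge> 0" using L by simp
    fix x y :: 'a assume xy: "x \<in> cball 0 r" "y \<in> cball 0 r"
    have "norm (u x - u y) \<le> L * norm (x - y)"
    proof (rule differentiable_bound[where S = "cball 0 r" and f' = "\<lambda>z. blinfun_apply (Du z)"])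
      show "onorm (blinfun_apply (Du z)) \<le> L" if "z \<in> cball 0 r" for z
        using L(2)[OF that] by (simp add: norm_blinfun.rep_eq)
    qed (use D(1) xy in \<open>auto intro: has_derivative_at_withinI\<close>)
    then show "\<bar>u x - u y\<bar> \<le> L * norm (x - y)" by simp
  qed
qed

lemma integral_lborel_translate:
  fixes f :: "'a::euclidean_space \<Rightarrow> real"
  assumes [measurable]: "f \<in> borel_measurable borel"
  shows "(LBINT x. f (c + x)) = (LBINT x. f x)"
proof -
  have "(LBINT x. f x) = (LINT x|distr lborel borel ((+) c). f x)"
    by (simp add: lborel_distr_plus)
  also have "\<dots> = (LBINT x. f (c + x))"
    by (subst integral_distr) auto
  finally show ?thesis by simp
qed

lemma bump_nonneg: "bump d z \<ge> 0"
  by (simp add: bump_def)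

lemma bump_even: "bump d (- z) = bump d z"
  by (simp add: bump_def)

lemma bump_le: "bump d z \<le> d ^ 6"
proof -
  have "max 0 (d\<^sup>2 - z \<bullet> z) ^ 3 \<le> (d\<^sup>2) ^ 3" by (intro power_mono) auto
  then show ?thesis by (simp add: bump_def flip: power_mult)
qed

lemma borel_measurable_bump [measurable]: "bump d \<in> borel_measurable borel"
  by (rule borel_measurable_continuous_onI[OF continuous_on_bump])

lemma integrable_bump:
  assumes "d > 0"
  shows "integrable lborel (bump d :: 'a::euclidean_space \<Rightarrow> real)"
proof (rule Bochner_Integration.integrable_bound)
  show "integrable lborel (\<lambda>z::'a. d ^ 6 * indicator (cball 0 d) z)"
    using emeasure_lborel_cball_finite[of "0::'a" d] by (intro integrable_mult_right integrable_real_indicator) auto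
  have "norm (bump d z) \<le> norm (d ^ 6 * indicator (cball 0 d) z)" for z :: 'a
    using bump_le[of d z] bump_nonneg[of d z] bump_outside(1)[OF assms, of z] by (cases "norm z \<le> d") auto
  then show "AE z in lborel. norm (bump d (z::'a)) \<le> norm (d ^ 6 * indicator (cball 0 d) z)" by simp
qed simp

definition bump_mass :: "'a::euclidean_space itself \<Rightarrow> real \<Rightarrow> real" where
  "bump_mass _ d = (LBINT z. bump d (z::'a))"

text \<open>On the ball of half the radius the bump is at least the cube of
  \<open>3 / 4 * d\<^sup>2\<close>. Together with \<open>bump_le\<close> this gives the size
  \<open>d powr (- N)\<close> of the mollifier without rescaling an integral.\<close>

lemma bump_mass_ge:
  assumes d: "d > 0"
  shows "27 / 64 * d ^ 6 * (unit_ball_vol DIM('a) * (d / 2) ^ DIM('a)) \<le> bump_mass TYPE('a::euclidean_space) d"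
proof -
  have fin: "emeasure lborel (cball (0::'a) (d / 2)) < \<infinity>" by (rule emeasure_lborel_cball_finite)
  have "27 / 64 * d ^ 6 * (unit_ball_vol DIM('a) * (d / 2) ^ DIM('a)) = (LBINT z. 27 / 64 * d ^ 6 * indicator (cball (0::'a) (d / 2)) z)"
    using d by (simp add: content_cball)
  also have "\<dots> \<le> bump_mass TYPE('a) d"
    unfolding bump_mass_def
  proof (rule integral_mono)
    show "integrable lborel (\<lambda>z. 27 / 64 * d ^ 6 * indicator (cball (0::'a) (d / 2)) z)"
      using fin by (intro integrable_mult_right integrable_real_indicator) auto
    show "integrable lborel (bump d :: 'a \<Rightarrow> real)" by (rule integrable_bump[OF d])
    fix z :: 'a
    show "27 / 64 * d ^ 6 * indicator (cball 0 (d / 2)) z \<le> bump d z"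
    proof (cases "z \<in> cball 0 (d / 2)")
      case True
      then have "(norm z)\<^sup>2 \<le> (d / 2)\<^sup>2" by (intro power_mono) auto
      then have "z \<bullet> z \<le> d\<^sup>2 / 4" by (simp add: power2_norm_eq_inner power_divide)
      then have "3 / 4 * d\<^sup>2 \<le> max 0 (d\<^sup>2 - z \<bullet> z)" by linarith
      then have A: "(3 / 4 * d\<^sup>2) ^ 3 \<le> bump d z" unfolding bump_def by (intro power_mono) auto
      have B: "(3 / 4 * d\<^sup>2) ^ 3 = 27 / 64 * d ^ 6"
        by (simp add: power_mult_distrib power_divide flip: power_mult)
      show ?thesis using True A[unfolded B] by simp
    next
      case False
      then show ?thesis by (simp add: bump_nonneg)
    qed
  qed
  finally show ?thesis .
qed

lemma bump_mass_pos:
  assumes d: "d > 0"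
  shows "bump_mass TYPE('a::euclidean_space) d > 0"
proof -
  have "0 < 27 / 64 * d ^ 6 * (unit_ball_vol DIM('a) * (d / 2) ^ DIM('a))"
    using d by (intro mult_pos_pos) auto
  then show ?thesis using bump_mass_ge[OF d, where 'a='a] by linarith
qed

section \<open>Mollifiers as probability densities\<close>

definition mollifier :: "real \<Rightarrow> 'a::euclidean_space \<Rightarrow> real" where
  "mollifier d z = bump d z / bump_mass TYPE('a) d"

lemma borel_measurable_mollifier [measurable]: "mollifier d \<in> borel_measurable borel"
  unfolding mollifier_def by measurable

lemma mollifier_nonneg: "d > 0 \<Longrightarrow> mollifier d (z::'a::euclidean_space) \<ge> 0"
  using bump_mass_pos[of d, where 'a='a] bump_nonneg[of d z] by (simp add: mollifier_def)

lemma integrable_mollifier: "d > 0 \<Longrightarrow> integrable lborel (mollifier d :: 'a::euclidean_space \<Rightarrow> real)"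
  unfolding mollifier_def by (intro integrable_divide integrable_bump)

lemma integral_mollifier: "d > 0 \<Longrightarrow> (LBINT z. mollifier d (z::'a::euclidean_space)) = 1"
  using bump_mass_pos[of d, where 'a='a] by (simp add: mollifier_def bump_mass_def)

text \<open>The reciprocal of the constant in \<open>bump_mass_ge\<close>; the power of 2 comes from
  the half radius.\<close>

definition moll_const :: "'a::euclidean_space itself \<Rightarrow> real" where
  "moll_const _ = 64 / 27 * 2 ^ DIM('a) / unit_ball_vol DIM('a)"

lemma moll_const_pos: "moll_const TYPE('a::euclidean_space) > 0"
  by (simp add: moll_const_def)

text \<open>The mollifier is dominated by the kernel uniformly in \<open>d\<close>, so finite energy alone controls the
  distance of a function to its mollification.\<close>

lemma mollifier_le_rkern:
  fixes z :: "'a::euclidean_space"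
  assumes d: "d > 0" and z: "z \<noteq> 0"
  shows "mollifier d z \<le> moll_const TYPE('a) * (indicator {..<d} (norm z) * rkern 0 z)"
proof (cases "norm z < d")
  case True
  let ?w = "unit_ball_vol DIM('a)" and ?A = "bump_mass TYPE('a) d"
  have w: "?w > 0" by simp
  have m: "0 < 27 / 64 * d ^ 6 * (?w * (d / 2) ^ DIM('a))"
    using d w by (intro mult_pos_pos) auto
  have "mollifier d z \<le> d ^ 6 / ?A"
    unfolding mollifier_def using bump_mass_pos[OF d, where 'a='a] by (intro divide_right_mono bump_le) auto
  also have "\<dots> \<le> d ^ 6 / (27 / 64 * d ^ 6 * (?w * (d / 2) ^ DIM('a)))"
    using d m bump_mass_pos[OF d, where 'a='a] bump_mass_ge[OF d, where 'a='a] by (intro divide_left_mono mult_pos_pos) auto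
  also have "\<dots> = moll_const TYPE('a) * (1 / d ^ DIM('a))"
    using d w by (simp add: moll_const_def field_simps power_divide)
  also have "1 / d ^ DIM('a) = d powr (- real DIM('a))"
    using d by (simp add: powr_minus_divide powr_realpow)
  also have "moll_const TYPE('a) * d powr (- real DIM('a)) \<le> moll_const TYPE('a) * rkern 0 z"
    unfolding rkern_def using moll_const_pos[where 'a='a] True z by (intro mult_left_mono) (auto intro!: powr_mono2')
  finally show ?thesis using True by simp
next
  case False
  then show ?thesis using bump_outside(1)[OF d, of z] by (simp add: mollifier_def)
qed

text \<open>The mollifier is a probability density, and the inequality says that the variance of
  \<open>f\<close> under it is nonnegative.\<close>

lemma mollifier_jensen:
  fixes f :: "'a::euclidean_space \<Rightarrow> real"
  assumes d: "d > 0" and [measurable]: "f \<in> borel_measurable borel" and B: "\<And>z. \<bar>f z\<bar> \<le> B"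
  shows "integrable lborel (\<lambda>z. mollifier d z * f z)" "integrable lborel (\<lambda>z. mollifier d z * (f z)\<^sup>2)"
    "(LBINT z. mollifier d z * f z)\<^sup>2 \<le> (LBINT z. mollifier d z * (f z)\<^sup>2)"
proof -
  have B0: "B \<ge> 0" using B[of 0] by linarith
  note J = mollifier_nonneg[OF d] integrable_mollifier[OF d, where 'a='a] integral_mollifier[OF d, where 'a='a]
  have i: "integrable lborel (\<lambda>z. mollifier d z * g z)"
    if [measurable]: "g \<in> borel_measurable borel" and C: "\<And>z. \<bar>g z\<bar> \<le> C" for g :: "'a \<Rightarrow> real" and C
  proof (rule Bochner_Integration.integrable_bound)
    show "integrable lborel (\<lambda>z::'a. mollifier d z * C)" using J by simp
    have "norm (mollifier d z * g z) \<le> norm (mollifier d z * C)" for z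
      using mult_left_mono[OF C J(1), of z z] J(1)[of z] C[of z] by (simp add: abs_mult)
    then show "AE z in lborel. norm (mollifier d z * g z) \<le> norm (mollifier d z * C)" by simp
  qed measurable
  show 1: "integrable lborel (\<lambda>z. mollifier d z * f z)" by (rule i[OF _ B]) simp
  show 2: "integrable lborel (\<lambda>z. mollifier d z * (f z)\<^sup>2)"
  proof (rule i)
    show "\<bar>(f z)\<^sup>2\<bar> \<le> B\<^sup>2" for z using B[of z] B0 by (simp add: abs_le_square_iff[symmetric])
  qed simp
  let ?m = "LBINT z. mollifier d z * f z"
  have "0 \<le> (LBINT z. mollifier d z * (f z - ?m)\<^sup>2)"
    by (intro integral_nonneg_AE AE_I2 mult_nonneg_nonneg J) simp
  also have "(\<lambda>z. mollifier d z * (f z - ?m)\<^sup>2) = (\<lambda>z. mollifier d z * (f z)\<^sup>2 - 2 * ?m * (mollifier d z * f z) + ?m\<^sup>2 * mollifier d z)"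
    by (rule ext) (simp add: power2_eq_square algebra_simps)
  also have "(LBINT z. mollifier d z * (f z)\<^sup>2 - 2 * ?m * (mollifier d z * f z) + ?m\<^sup>2 * mollifier d z)
      = (LBINT z. mollifier d z * (f z)\<^sup>2) - 2 * ?m * ?m + ?m\<^sup>2 * 1"
    using 1 2 J by simp
  finally show "?m\<^sup>2 \<le> (LBINT z. mollifier d z * (f z)\<^sup>2)" by (simp add: power2_eq_square)
qed

text \<open>The mollifier is even, so the sign of the shift is immaterial. With \<open>x + z\<close>
  the average runs over translates \<open>p + (z, z)\<close> of a pair of points, under which the
  kernel is invariant.\<close>

definition mollify :: "real \<Rightarrow> ('a::euclidean_space \<Rightarrow> real) \<Rightarrow> 'a \<Rightarrow> real" where
  "mollify d v x = (LBINT z. mollifier d z * v (x + z))"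

text \<open>The translation moves the dependence on \<open>x\<close> from \<open>v\<close> to the
  smooth factor, where derivatives can fall.\<close>

lemma mollify_eq_conv:
  fixes v :: "'a::euclidean_space \<Rightarrow> real"
  assumes [measurable]: "v \<in> borel_measurable borel"
  shows "mollify d v x = 1 / bump_mass TYPE('a) d * (LBINT y. v y *\<^sub>R bump d (x - y))"
proof -
  have "mollify d v x = (LBINT z. 1 / bump_mass TYPE('a) d * (v (x + z) *\<^sub>R bump d (x - (x + z))))"
    by (simp add: mollify_def mollifier_def bump_even mult.commute)
  also have "\<dots> = 1 / bump_mass TYPE('a) d * (LBINT z. v (x + z) *\<^sub>R bump d (x - (x + z)))"
    by (rule integral_mult_right_zero)
  also have "(LBINT z. v (x + z) *\<^sub>R bump d (x - (x + z))) = (LBINT y. v y *\<^sub>R bump d (x - y))"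
    by (rule integral_lborel_translate[where f = "\<lambda>y. v y *\<^sub>R bump d (x - y)"]) measurable
  finally show ?thesis .
qed

lemma C2_function_continuous:
  assumes "C2_function u"
  shows "continuous_on UNIV u"
proof -
  obtain Du where "\<And>x. (u has_derivative blinfun_apply (Du x)) (at x)"
    using assms unfolding C2_function_def by blast
  then show ?thesis
    by (auto intro: has_derivative_continuous continuous_at_imp_continuous_on)
qed

lemma borel_measurable_small_scale:
  fixes v :: "'a::euclidean_space \<Rightarrow> real"
  assumes v: "v \<in> borel_measurable borel"
  shows "(\<lambda>p. indicator {..<d} (norm (fst p - snd p)) * near_density 0 v p) \<in> borel_measurable borel"
proof (rule borel_measurable_times)
  show "(\<lambda>p::'a \<times> 'a. indicator {..<d} (norm (fst p - snd p)) :: real) \<in> borel_measurable borel"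
    by (rule borel_measurable_compose_diff[where u = "\<lambda>z. indicator {..<d} (norm z)"]) measurable
  show "near_density 0 v \<in> borel_measurable borel" by (rule borel_measurable_near_density[OF v])
qed

section \<open>Smooth compactly supported functions and mollification in the form domain\<close>

context bounded_open_set
begin

lemma bounded_L2_zero:
  assumes "u \<in> borel_measurable borel" "\<And>x. \<bar>u x\<bar> \<le> M" "\<And>x. x \<notin> \<Omega> \<Longrightarrow> u x = 0"
  shows "u \<in> L2_zero \<Omega>"
proof (rule L2_zero_dominated[OF L2_zero_mult[OF indicator_L2_zero, of M] assms(1)])
  fix x show "\<bar>u x\<bar> \<le> \<bar>M * indicator \<Omega> x\<bar>"
    using assms(2)[of x] assms(3)[of x] by (cases "x \<in> \<Omega>") auto
qed

lemma C2c_ball: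
  assumes "u \<in> C2c \<Omega>"
  obtains R where "R \<ge> 0" "\<And>x. norm x > R \<Longrightarrow> u x = 0"
proof -
  have "bounded (closure {x. u x \<noteq> 0})" using assms by (auto simp: C2c_def compact_imp_bounded)
  then obtain R where R: "R > 0" "\<And>x. x \<in> closure {x. u x \<noteq> 0} \<Longrightarrow> norm x \<le> R"
    unfolding bounded_pos by auto
  show thesis
  proof (rule that[of R])
    show "u x = 0" if "norm x > R" for x
      using R(2)[of x] that closure_subset[of "{x. u x \<noteq> 0}"] by fastforce
  qed (use R in simp)
qed

lemma C2c_L2_zero:
  assumes u: "u \<in> C2c \<Omega>"
  shows "u \<in> L2_zero \<Omega>"
proof -
  have cont: "continuous_on UNIV u" using u by (simp add: C2c_def C2_function_continuous)
  obtain R where R: "R \<ge> 0" "\<And>x. norm x > R \<Longrightarrow> u x = 0" using C2c_ball[OF u] by blast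
  obtain M where M: "\<And>x. norm (u x) \<le> M"
    using bounded_if_compact_support[OF cont, of "R + 1"] R(2) by (metis add.commute less_add_one order.strict_trans2)
  show ?thesis
  proof (rule bounded_L2_zero)
    show "u \<in> borel_measurable borel" by (rule borel_measurable_continuous_onI[OF cont])
    show "\<bar>u x\<bar> \<le> M" for x using M[of x] by simp
    show "u x = 0" if "x \<notin> \<Omega>" for x
      using u that closure_subset[of "{x. u x \<noteq> 0}"] by (auto simp: C2c_def)
  qed
qed

text \<open>The Lipschitz bound supplies two powers of the distance against a kernel of order
  \<open>DIM('a) + 1\<close>, which leaves the integrable power \<open>1 - DIM('a)\<close>. Pairs at
  distance at most 1 that meet the support lie in the ball of radius \<open>R + 1\<close>.\<close>

lemma C2c_integrable_near:
  assumes u: "u \<in> C2c \<Omega>"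
  shows "integrable lborel (near_density (1/2) u)"
proof -
  obtain R where R: "R \<ge> 0" "\<And>x. norm x > R \<Longrightarrow> u x = 0" using C2c_ball[OF u] by blast
  obtain L where L: "L \<ge> 0" "\<And>x y. x \<in> cball 0 (R + 1) \<Longrightarrow> y \<in> cball 0 (R + 1) \<Longrightarrow> \<bar>u x - u y\<bar> \<le> L * norm (x - y)"
    using C2_function_lipschitz_on_cball[of u] u by (auto simp: C2c_def)
  have [measurable]: "u \<in> borel_measurable borel" using L2_zeroD(1)[OF C2c_L2_zero[OF u]] .
  let ?G = "\<lambda>r. indicator {..1} r * r powr (1 - real DIM('a))"
  have iG: "integrable lborel (\<lambda>z::'a. ?G (norm z))"
    using integrable_radial_powr_cball[of 1, where 'a='a] by simp
  define I where "I = (LINT z|(lborel :: 'a measure). ?G (norm z))"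
  have I: "I \<ge> 0" unfolding I_def by (intro integral_nonneg_AE) auto
  have G: "(\<integral>\<^sup>+z. ennreal (?G (norm (z::'a))) \<partial>lborel) = ennreal I"
    unfolding I_def by (subst nn_integral_eq_integral[OF iG]) auto
  have Gm: "?G \<in> borel_measurable borel" by measurable
  have fi: "integrable lborel (indicator (cball 0 (R + 1)) :: 'a \<Rightarrow> real)"
    using emeasure_lborel_cball_finite[of "0::'a" "R + 1"] by (intro integrable_real_indicator) auto
  note hb = has_bochner_integral_radial_conv(1)[OF fi _ Gm _ G I, simplified]
  show ?thesis
  proof (rule Bochner_Integration.integrable_bound)
    show "integrable lborel (\<lambda>p. L\<^sup>2 * (indicator (cball 0 (R + 1)) (fst p) * ?G (norm (fst p - snd p :: 'a))))"
      using hb by (simp add: has_bochner_integral_iff)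
    have "near_density (1/2) u p \<le> L\<^sup>2 * (indicator (cball 0 (R + 1)) (fst p) * ?G (norm (fst p - snd p)))" for p
    proof (cases "norm (fst p - snd p) \<le> 1 \<and> u (fst p) \<noteq> u (snd p)")
      case True
      let ?x = "fst p" and ?y = "snd p"
      let ?z = "?x - ?y"
      have z: "norm ?z > 0" using True by auto
      have "norm ?x \<le> R \<or> norm ?y \<le> R" using R(2)[of ?x] R(2)[of ?y] True by fastforce
      moreover have "norm ?x \<le> norm ?y + norm ?z" "norm ?y \<le> norm ?x + norm ?z"
        using norm_triangle_ineq[of ?y ?z] norm_triangle_ineq[of ?x "- ?z"] by (auto simp: norm_minus_commute)
      ultimately have xy: "?x \<in> cball 0 (R + 1)" "?y \<in> cball 0 (R + 1)" using True by auto
      have "(u ?x - u ?y)\<^sup>2 \<le> (L * norm ?z)\<^sup>2"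
        using L(2)[OF xy] L(1) by (simp add: abs_le_square_iff[symmetric])
      then have "(u ?x - u ?y)\<^sup>2 * rkern (1/2) ?z \<le> (L * norm ?z)\<^sup>2 * rkern (1/2) ?z"
        by (intro mult_right_mono) auto
      also have "\<dots> = L\<^sup>2 * ((norm ?z)\<^sup>2 * rkern (1/2) ?z)"
        by (simp add: power_mult_distrib)
      also have "(norm ?z)\<^sup>2 * rkern (1/2) ?z = norm ?z powr (1 - real DIM('a))"
      proof -
        have "(norm ?z)\<^sup>2 * rkern (1/2) ?z = norm ?z powr (2 + (- (real DIM('a) + 2 * (1/2))))"
          unfolding rkern_def powr_add using z by simp
        also have "2 + (- (real DIM('a) + 2 * (1/2))) = 1 - real DIM('a)" by simp
        finally show ?thesis .
      qed
      finally show ?thesis using True xy by (simp add: near_density_def)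
    next
      case False
      then show ?thesis by (auto simp: near_density_def)
    qed
    then show "AE p in lborel. norm (near_density (1/2) u p) \<le> norm (L\<^sup>2 * (indicator (cball 0 (R + 1)) (fst p) * ?G (norm (fst p - snd p))))"
      by (intro AE_I2) (auto simp: near_density_nonneg abs_mult intro: order_trans)
  qed measurable
qed

lemma C2c_form_domain: "u \<in> C2c \<Omega> \<Longrightarrow> u \<in> form_domain"
  using C2c_L2_zero[of u] integrable_near_density_mono(1)[OF _ C2c_integrable_near[of u], of 0] L2_zeroD(1)[of u]
  by (simp add: form_domain_def)

lemma mollify_C2c:
  assumes v: "v \<in> L2_zero \<Omega>" and K: "compact K" "\<And>x. x \<notin> K \<Longrightarrow> v x = 0"
    and d: "d > 0" "(\<Union>x\<in>K. cball x d) \<subseteq> \<Omega>"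
  shows "mollify d v \<in> C2c \<Omega>"
proof -
  have [measurable]: "v \<in> borel_measurable borel" using v by (rule L2_zeroD)
  have eq: "mollify d v = (\<lambda>x. 1 / bump_mass TYPE('a) d * (LBINT y. v y *\<^sub>R bump d (x - y)))"
    by (rule ext, rule mollify_eq_conv) simp
  have "C2_function (mollify d v)"
    unfolding eq
    by (rule C2_function_mult[OF C2_function_conv_bump[OF d(1) L2_zero_integrable(1)[OF v]]])
  moreover have "compact (closure {x. mollify d v x \<noteq> 0}) \<and> closure {x. mollify d v x \<noteq> 0} \<subseteq> \<Omega>"
  \<comment> \<open>The distance \<open>infdist\<close> to the empty set is 0 by convention, so the
    neighbourhood of \<open>K\<close> used below would be the whole space.\<close>
  proof (cases "K = {}")
    case True
    then have "mollify d v x = 0" for x using K by (simp add: mollify_def)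
    then show ?thesis by simp
  next
    case False
    have "{x. mollify d v x \<noteq> 0} \<subseteq> {x. infdist x K \<le> d}"
    proof safe
      fix x assume nz: "mollify d v x \<noteq> 0"
      show "infdist x K \<le> d"
      proof (rule ccontr)
        assume far: "\<not> infdist x K \<le> d"
        have "mollifier d z * v (x + z) = 0" for z
        proof (cases "x + z \<in> K")
          case True
          then have "d < dist x (x + z)" using far infdist_le[of "x + z" K x] by linarith
          then show ?thesis using bump_outside(1)[OF d(1), of z] by (simp add: mollifier_def dist_norm)
        qed (use K in simp)
        then have "(\<lambda>z. mollifier d z * v (x + z)) = (\<lambda>z. 0)" by (rule ext)
        then show False using nz unfolding mollify_def by simp
      qed
    qed
    moreover have cK: "compact {x. infdist x K \<le> d}" by (rule compact_infdist_le[OF False K(1) d(1)])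
    ultimately have sub: "closure {x. mollify d v x \<noteq> 0} \<subseteq> {x. infdist x K \<le> d}"
      by (intro closure_minimal compact_imp_closed)
    have "{x. infdist x K \<le> d} \<subseteq> \<Omega>"
    proof safe
      fix x assume "infdist x K \<le> d"
      moreover obtain y where "y \<in> K" "infdist x K = dist x y"
        using infdist_attains_inf[OF compact_imp_closed[OF K(1)] False] by metis
      ultimately have "x \<in> (\<Union>x\<in>K. cball x d)" by (auto simp: dist_commute)
      then show "x \<in> \<Omega>" using d(2) by blast
    qed
    with sub show ?thesis
      using compact_Int_closed[OF cK closed_closure, of "{x. mollify d v x \<noteq> 0}"] by (simp add: Int_absorb1)
  qed
  ultimately show ?thesis by (simp add: C2c_def)
qed

text \<open>The near energy is convex and invariant under translations, and mollification is an
  average of translates: Jensen pointwise in the pair, then Tonelli.\<close>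

lemma mollify_energy_le:
  assumes v: "v \<in> form_domain" and M: "\<And>x. \<bar>v x\<bar> \<le> M" and d: "d > 0"
    and [measurable]: "mollify d v \<in> borel_measurable borel"
  shows "near_energy 0 (mollify d v) \<le> near_energy 0 v"
proof -
  note vD = form_domainD[OF v]
  have [measurable]: "v \<in> borel_measurable borel" by (rule vD)
  have M0: "M \<ge> 0" using M[of 0] by linarith
  note J = mollifier_nonneg[OF d] integrable_mollifier[OF d, where 'a='a] integral_mollifier[OF d, where 'a='a]
  have shift [measurable]: "(\<lambda>q::('a \<times> 'a) \<times> 'a. fst q + (snd q, snd q)) \<in> (lborel \<Otimes>\<^sub>M lborel) \<rightarrow>\<^sub>M borel"
    by measurable
  have le: "ennreal (near_density 0 (mollify d v) p) \<le> (\<integral>\<^sup>+z. ennreal (mollifier d z) * ennreal (near_density 0 v (p + (z, z))) \<partial>lborel)" for p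
  proof -
    let ?x = "fst p" and ?y = "snd p"
    let ?c = "indicator {..1} (norm (?x - ?y)) * rkern 0 (?x - ?y)"
    let ?f = "\<lambda>z. v (?x + z) - v (?y + z)"
    have B: "\<bar>?f z\<bar> \<le> 2 * M" for z using M[of "?x + z"] M[of "?y + z"] by linarith
    have fm: "?f \<in> borel_measurable borel" by measurable
    note je = mollifier_jensen[OF d fm B]
    have "mollify d v ?x - mollify d v ?y = (LBINT z. mollifier d z * ?f z)"
      using mollifier_jensen(1)[OF d, of "\<lambda>z. v (?x + z)" M] mollifier_jensen(1)[OF d, of "\<lambda>z. v (?y + z)" M] M
      by (simp add: mollify_def right_diff_distrib)
    then have "near_density 0 (mollify d v) p = ?c * (LBINT z. mollifier d z * ?f z)\<^sup>2"
      by (simp add: near_density_def)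
    also have "\<dots> \<le> ?c * (LBINT z. mollifier d z * (?f z)\<^sup>2)"
      by (rule mult_left_mono[OF je(3)]) simp
    also have "\<dots> = (LBINT z. mollifier d z * near_density 0 v (p + (z, z)))"
    proof -
      have "near_density 0 v (p + (z, z)) = ?c * (?f z)\<^sup>2" for z
        by (simp add: near_density_def)
      then show ?thesis by (simp add: mult.left_commute flip: integral_mult_right_zero)
    qed
    finally have "ennreal (near_density 0 (mollify d v) p) \<le> ennreal (LBINT z. mollifier d z * near_density 0 v (p + (z, z)))"
      by (rule ennreal_leI)
    also have "\<dots> = (\<integral>\<^sup>+z. ennreal (mollifier d z * near_density 0 v (p + (z, z))) \<partial>lborel)"
    proof (rule nn_integral_eq_integral[symmetric])
      have "(\<lambda>z. mollifier d z * near_density 0 v (p + (z, z))) = (\<lambda>z. ?c * (mollifier d z * (?f z)\<^sup>2))"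
        by (rule ext) (simp add: near_density_def mult_ac)
      then show "integrable lborel (\<lambda>z. mollifier d z * near_density 0 v (p + (z, z)))"
        using je(2) by simp
    qed (intro AE_I2 mult_nonneg_nonneg J near_density_nonneg)
    finally show ?thesis unfolding ennreal_mult[OF J(1) near_density_nonneg] .
  qed
  have "(\<integral>\<^sup>+p. ennreal (near_density 0 (mollify d v) p) \<partial>lborel)
    \<le> (\<integral>\<^sup>+p. (\<integral>\<^sup>+z. ennreal (mollifier d z) * ennreal (near_density 0 v (p + (z, z))) \<partial>lborel) \<partial>lborel)"
    by (rule nn_integral_mono[OF le])
  also have "\<dots> = (\<integral>\<^sup>+z. (\<integral>\<^sup>+p. ennreal (mollifier d z) * ennreal (near_density 0 v (p + (z, z))) \<partial>lborel) \<partial>lborel)"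
  proof (rule lborel_pair.Fubini'[symmetric])
    have "(\<lambda>q::('a \<times> 'a) \<times> 'a. ennreal (mollifier d (snd q)) * ennreal (near_density 0 v (fst q + (snd q, snd q)))) \<in> borel_measurable (lborel \<Otimes>\<^sub>M lborel)"
      by measurable
    then show "(\<lambda>(p::'a \<times> 'a, z). ennreal (mollifier d z) * ennreal (near_density 0 v (p + (z, z)))) \<in> borel_measurable (lborel \<Otimes>\<^sub>M lborel)"
      by (simp add: case_prod_beta')
  qed
  also have "\<dots> = (\<integral>\<^sup>+z. ennreal (mollifier d (z::'a)) * ennreal (near_energy 0 v) \<partial>lborel)"
  proof (rule nn_integral_cong)
    fix z :: 'a
    have "(\<integral>\<^sup>+p. ennreal (mollifier d z) * ennreal (near_density 0 v (p + (z, z))) \<partial>lborel)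
      = ennreal (mollifier d z) * (\<integral>\<^sup>+p. ennreal (near_density 0 v ((z, z) + p)) \<partial>lborel)"
      by (subst nn_integral_cmult[symmetric]) (auto simp: add.commute)
    also have "(\<integral>\<^sup>+p. ennreal (near_density 0 v ((z, z) + p)) \<partial>lborel) = (\<integral>\<^sup>+p. ennreal (near_density 0 v p) \<partial>lborel)"
      by (rule nn_integral_lborel_translate[where f = "\<lambda>p. ennreal (near_density 0 v p)"]) simp
    also have "\<dots> = ennreal (near_energy 0 v)"
      unfolding near_energy_def by (rule nn_integral_eq_integral[OF vD(2)]) (simp add: near_density_nonneg)
    finally show "(\<integral>\<^sup>+p. ennreal (mollifier d z) * ennreal (near_density 0 v (p + (z, z))) \<partial>lborel)
      = ennreal (mollifier d z) * ennreal (near_energy 0 v)" .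
  qed
  also have "\<dots> = ennreal (near_energy 0 v)"
    using nn_integral_eq_integral[OF J(2) AE_I2[OF J(1)]] J(3) by (subst nn_integral_multc) auto
  finally have *: "(\<integral>\<^sup>+p. ennreal (near_density 0 (mollify d v) p) \<partial>lborel) \<le> ennreal (near_energy 0 v)" .
  have "near_energy 0 (mollify d v) = enn2real (\<integral>\<^sup>+p. ennreal (near_density 0 (mollify d v) p) \<partial>lborel)"
    unfolding near_energy_def by (rule integral_eq_nn_integral) (auto simp: near_density_nonneg)
  also have "\<dots> \<le> near_energy 0 v"
    by (rule enn2real_leI[OF near_energy_nonneg *])
  finally show ?thesis .
qed

text \<open>By Jensen the error is at most the integral of the squared differences of
  \<open>v\<close> against the mollifier, and \<open>mollifier_le_rkern\<close> turns this into the
  part of the near energy carried by pairs closer than \<open>d\<close>.\<close>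

lemma mollify_sqnorm_le:
  assumes v: "v \<in> form_domain" and M: "\<And>x. \<bar>v x\<bar> \<le> M" and d: "0 < d" "d \<le> 1"
    and [measurable]: "mollify d v \<in> borel_measurable borel"
  shows "sqnorm (\<lambda>x. mollify d v x - v x)
    \<le> moll_const TYPE('a) * (LBINT p. indicator {..<d} (norm (fst p - snd p)) * near_density 0 v p)"
proof -
  note vD = form_domainD[OF v]
  have [measurable]: "v \<in> borel_measurable borel" by (rule vD)
  note J = mollifier_nonneg[OF d(1)] integrable_mollifier[OF d(1), where 'a='a] integral_mollifier[OF d(1), where 'a='a]
  have m1 [measurable]: "(\<lambda>p::'a \<times> 'a. mollifier d (snd p - fst p) * (v (snd p) - v (fst p))\<^sup>2) \<in> borel_measurable borel"
    unfolding borel_prod[symmetric] by measurable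
  have m2 [measurable]: "(\<lambda>p::'a \<times> 'a. indicator {..<d} (norm (fst p - snd p)) * near_density 0 v p) \<in> borel_measurable borel"
    by (rule borel_measurable_small_scale) fact
  have i2: "integrable lborel (\<lambda>p::'a \<times> 'a. indicator {..<d} (norm (fst p - snd p)) * near_density 0 v p)"
  proof (rule Bochner_Integration.integrable_bound[OF vD(2)])
    show "(\<lambda>p::'a \<times> 'a. indicator {..<d} (norm (fst p - snd p)) * near_density 0 v p) \<in> borel_measurable lborel"
      using m2 by simp
  qed (auto simp: indicator_def near_density_nonneg)
  have le: "ennreal ((mollify d v x - v x)\<^sup>2) \<le> (\<integral>\<^sup>+y. ennreal (mollifier d (y - x) * (v y - v x)\<^sup>2) \<partial>lborel)" for x
  proof -
    let ?f = "\<lambda>z. v (x + z) - v x"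
    have B: "\<bar>?f z\<bar> \<le> 2 * M" for z using M[of "x + z"] M[of x] by linarith
    have fm: "?f \<in> borel_measurable borel" by measurable
    note je = mollifier_jensen[OF d(1) fm B]
    have "mollify d v x - v x = (LBINT z. mollifier d z * v (x + z)) - (LBINT z. mollifier d (z::'a) * v x)"
      using J by (simp add: mollify_def)
    also have "\<dots> = (LBINT z. mollifier d z * ?f z)"
      using mollifier_jensen(1)[OF d(1), of "\<lambda>z. v (x + z)" M] M J by (simp add: right_diff_distrib)
    finally have "(mollify d v x - v x)\<^sup>2 \<le> (LBINT z. mollifier d z * (?f z)\<^sup>2)"
      using je(3) by simp
    then have "ennreal ((mollify d v x - v x)\<^sup>2) \<le> ennreal (LBINT z. mollifier d z * (?f z)\<^sup>2)"
      by (rule ennreal_leI)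
    also have "\<dots> = (\<integral>\<^sup>+z. ennreal (mollifier d z * (?f z)\<^sup>2) \<partial>lborel)"
      by (intro nn_integral_eq_integral[symmetric] je(2) AE_I2 mult_nonneg_nonneg J) simp
    also have "\<dots> = (\<integral>\<^sup>+y. ennreal (mollifier d (- x + y) * (v (x + (- x + y)) - v x)\<^sup>2) \<partial>lborel)"
      by (rule nn_integral_lborel_translate[symmetric, where f = "\<lambda>z. ennreal (mollifier d z * (v (x + z) - v x)\<^sup>2)"]) measurable
    finally show ?thesis by simp
  qed
  have "(\<integral>\<^sup>+x. ennreal ((mollify d v x - v x)\<^sup>2) \<partial>lborel) \<le> (\<integral>\<^sup>+x. (\<integral>\<^sup>+y. ennreal (mollifier d (y - x) * (v y - v x)\<^sup>2) \<partial>lborel) \<partial>lborel)"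
    by (rule nn_integral_mono[OF le])
  also have "\<dots> = (\<integral>\<^sup>+p. ennreal (mollifier d (snd p - fst p) * (v (snd p) - v (fst p))\<^sup>2) \<partial>lborel)"
    by (subst nn_integral_lborel_fst) auto
  also have "\<dots> \<le> (\<integral>\<^sup>+p. ennreal (moll_const TYPE('a) * (indicator {..<d} (norm (fst p - snd p)) * near_density 0 v p)) \<partial>lborel)"
  proof (intro nn_integral_mono ennreal_leI)
    fix p :: "'a \<times> 'a"
    show "mollifier d (snd p - fst p) * (v (snd p) - v (fst p))\<^sup>2 \<le> moll_const TYPE('a) * (indicator {..<d} (norm (fst p - snd p)) * near_density 0 v p)"
    proof (cases "fst p = snd p")
      case False
      then have "mollifier d (snd p - fst p) * (v (snd p) - v (fst p))\<^sup>2
         \<le> (moll_const TYPE('a) * (indicator {..<d} (norm (snd p - fst p)) * rkern 0 (snd p - fst p))) * (v (snd p) - v (fst p))\<^sup>2"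
        by (intro mult_right_mono mollifier_le_rkern d) auto
      also have "\<dots> = moll_const TYPE('a) * (indicator {..<d} (norm (fst p - snd p)) * near_density 0 v p)"
        using d by (auto simp: near_density_def indicator_def norm_minus_commute[of "snd p"] rkern_minus_commute[of 0 "snd p"] power2_commute[of "v (snd p)"])
      finally show ?thesis .
    qed (simp add: near_density_def)
  qed
  also have "\<dots> = ennreal (moll_const TYPE('a) * (LBINT p. indicator {..<d} (norm (fst p - snd p)) * near_density 0 v p))"
    by (subst nn_integral_eq_integral) (use i2 moll_const_pos[where 'a='a] in \<open>auto simp: near_density_nonneg less_imp_le\<close>)
  finally have *: "(\<integral>\<^sup>+x. ennreal ((mollify d v x - v x)\<^sup>2) \<partial>lborel) \<le> \<dots>" .
  have nn: "0 \<le> moll_const TYPE('a) * (LBINT p. indicator {..<d} (norm (fst p - snd p)) * near_density 0 v p)"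
    using moll_const_pos[where 'a='a] by (intro mult_nonneg_nonneg integral_nonneg_AE) (auto simp: near_density_nonneg)
  have "sqnorm (\<lambda>x. mollify d v x - v x) = enn2real (\<integral>\<^sup>+x. ennreal ((mollify d v x - v x)\<^sup>2) \<partial>lborel)"
    unfolding sqnorm_def by (rule integral_eq_nn_integral) auto
  also have "\<dots> \<le> moll_const TYPE('a) * (LBINT p. indicator {..<d} (norm (fst p - snd p)) * near_density 0 v p)"
    by (rule enn2real_leI[OF nn *])
  finally show ?thesis .
qed

text \<open>Dominated convergence with the near density itself as majorant; it is 0 on the diagonal,
  the only set that all the indicators retain.\<close>

lemma near_energy_small_scale:
  assumes v: "v \<in> form_domain"
  shows "(\<lambda>n. LBINT p. indicator {..<inverse (real (Suc n))} (norm (fst p - snd p)) * near_density 0 v p) \<longlonglongrightarrow> 0"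
proof -
  note vD = form_domainD[OF v]
  have "(\<lambda>n. LBINT p. indicator {..<inverse (real (Suc n))} (norm (fst p - snd p)) * near_density 0 v p) \<longlonglongrightarrow> (LINT p|(lborel :: ('a \<times> 'a) measure). 0)"
  proof (rule integral_dominated_convergence[OF _ _ vD(2)])
    show "(\<lambda>p. indicator {..<inverse (real (Suc n))} (norm (fst p - snd p)) * near_density 0 v p) \<in> borel_measurable lborel" for n
      using borel_measurable_small_scale[OF vD(3)] by simp
    show "AE p in lborel. (\<lambda>n. indicator {..<inverse (real (Suc n))} (norm (fst p - snd p)) * near_density 0 v p) \<longlonglongrightarrow> 0"
    proof (rule AE_I2)
      fix p :: "'a \<times> 'a"
      show "(\<lambda>n. indicator {..<inverse (real (Suc n))} (norm (fst p - snd p)) * near_density 0 v p) \<longlonglongrightarrow> 0"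
      proof (cases "fst p = snd p")
        case True
        then show ?thesis by (simp add: near_density_def)
      next
        case False
        have "eventually (\<lambda>n. inverse (real (Suc n)) < norm (fst p - snd p)) sequentially"
          by (rule order_tendstoD[OF LIMSEQ_inverse_real_of_nat]) (use False in simp)
        then have "eventually (\<lambda>n. indicator {..<inverse (real (Suc n))} (norm (fst p - snd p)) * near_density 0 v p = 0) sequentially"
          by eventually_elim simp
        then show ?thesis by (rule tendsto_eventually)
      qed
    qed
    show "AE p in lborel. norm (indicator {..<inverse (real (Suc n))} (norm (fst p - snd p)) * near_density 0 v p) \<le> near_density 0 v p" for n
      by (intro AE_I2) (auto simp: indicator_def near_density_nonneg)
  qed simp
  then show ?thesis by simp
qed

lemma mollify_approx:
  assumes v: "v \<in> form_domain" and M: "\<And>x. \<bar>v x\<bar> \<le> M" and K: "compact K" "K \<subseteq> \<Omega>" "\<And>x. x \<notin> K \<Longrightarrow> v x = 0"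
    and e: "e > 0"
  obtains w where "w \<in> C2c \<Omega>" "sqnorm (\<lambda>x. w x - v x) < e" "near_energy 0 w \<le> near_energy 0 v"
proof -
  obtain d0 where d0: "d0 > 0" "(\<Union>x\<in>K. cball x d0) \<subseteq> \<Omega>"
    using compact_subset_open_imp_cball_epsilon_subset[OF K(1) open_dom K(2)] by metis
  have "(\<lambda>n. moll_const TYPE('a) * (LBINT p. indicator {..<inverse (real (Suc n))} (norm (fst p - snd p)) * near_density 0 v p)) \<longlonglongrightarrow> moll_const TYPE('a) * 0"
    by (intro tendsto_intros near_energy_small_scale v)
  then have "eventually (\<lambda>n. moll_const TYPE('a) * (LBINT p. indicator {..<inverse (real (Suc n))} (norm (fst p - snd p)) * near_density 0 v p) < e) sequentially"
    by (rule order_tendstoD(2)) (use e in simp)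
  moreover have "eventually (\<lambda>n. inverse (real (Suc n)) < d0) sequentially"
    by (rule order_tendstoD(2)[OF LIMSEQ_inverse_real_of_nat d0(1)])
  ultimately have "eventually (\<lambda>n. moll_const TYPE('a) * (LBINT p. indicator {..<inverse (real (Suc n))} (norm (fst p - snd p)) * near_density 0 v p) < e
      \<and> inverse (real (Suc n)) < d0) sequentially" by eventually_elim simp
  from eventually_happens'[OF sequentially_bot this] obtain n where n: "moll_const TYPE('a) * (LBINT p. indicator {..<inverse (real (Suc n))} (norm (fst p - snd p)) * near_density 0 v p) < e"
    "inverse (real (Suc n)) < d0"
    by blast
  define d where "d = inverse (real (Suc n))"
  have d: "0 < d" "d \<le> 1" "d < d0" using n(2) by (auto simp: d_def inverse_le_1_iff)
  have sub: "(\<Union>x\<in>K. cball x d) \<subseteq> \<Omega>" using d0(2) d(3) by fastforce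
  have C: "mollify d v \<in> C2c \<Omega>"
    by (rule mollify_C2c[OF form_domainD(1)[OF v] K(1,3) d(1) sub])
  have m: "mollify d v \<in> borel_measurable borel" using L2_zeroD(1)[OF C2c_L2_zero[OF C]] .
  show thesis
  proof (rule that[OF C])
    show "sqnorm (\<lambda>x. mollify d v x - v x) < e"
      using mollify_sqnorm_le[OF v M d(1,2) m] n(1) by (simp add: d_def)
    show "near_energy 0 (mollify d v) \<le> near_energy 0 v" by (rule mollify_energy_le[OF v M d(1) m])
  qed
qed

text \<open>This keeps the sets in the infima nonempty, as \<open>cInf_greatest\<close>
  demands.\<close>

lemma C2c_nontrivial: "\<exists>u\<in>C2c \<Omega>. sqnorm u > 0"
proof -
  obtain x0 r where r: "r > 0" "cball x0 (2 * r) \<subseteq> \<Omega>"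
  proof -
    obtain x0 where "x0 \<in> \<Omega>" using nonempty_dom by blast
    then obtain e where "e > 0" "cball x0 e \<subseteq> \<Omega>" using open_dom open_contains_cball by blast
    then show thesis using that[of "e / 2" x0] by simp
  qed
  let ?v = "indicator (cball x0 r) :: 'a \<Rightarrow> real"
  have sub: "cball x0 r \<subseteq> \<Omega>" using r by (auto intro: order_trans[OF subset_cball])
  have vL: "?v \<in> L2_zero \<Omega>"
  proof (rule bounded_L2_zero)
    show "?v \<in> borel_measurable borel" by (intro borel_measurable_indicator) auto
    show "\<bar>?v x\<bar> \<le> 1" for x by (simp add: indicator_def)
    show "?v x = 0" if "x \<notin> \<Omega>" for x using sub that by (auto simp: indicator_def)
  qed
  have C: "mollify (r / 2) ?v \<in> C2c \<Omega>"
  proof (rule mollify_C2c[OF vL compact_cball])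
    show "(\<Union>x\<in>cball x0 r. cball x (r / 2)) \<subseteq> \<Omega>"
    proof safe
      fix x y assume "x \<in> cball x0 r" "y \<in> cball x (r / 2)"
      then have "y \<in> cball x0 (2 * r)" using dist_triangle[of x0 y x] r by auto
      then show "y \<in> \<Omega>" using r by auto
    qed
  qed (use r in auto)
  have one: "mollify (r / 2) ?v x = 1" if x: "x \<in> cball x0 (r / 2)" for x
  proof -
    have "mollifier (r / 2) z * ?v (x + z) = mollifier (r / 2) z" for z
    proof (cases "norm z \<le> r / 2")
      case True
      have "dist x0 (x + z) \<le> dist x0 x + norm z" using dist_triangle[of x0 "x + z" x] by (simp add: dist_norm)
      then have "x + z \<in> cball x0 r" using x True by simp
      then show ?thesis by simp
    next
      case False
      then show ?thesis using bump_outside(1)[of "r / 2" z] r by (simp add: mollifier_def)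
    qed
    then have "(\<lambda>z. mollifier (r / 2) z * ?v (x + z)) = mollifier (r / 2)" by (rule ext)
    then show ?thesis using integral_mollifier[of "r / 2", where 'a='a] r by (simp only: mollify_def)
  qed
  have "0 < (LBINT x. indicator (cball x0 (r / 2)) x :: real)"
    using r by (simp add: content_cball_gt_0_iff)
  also have "\<dots> \<le> sqnorm (mollify (r / 2) ?v)"
    unfolding sqnorm_def
  proof (rule integral_mono)
    show "integrable lborel (indicator (cball x0 (r / 2)) :: 'a \<Rightarrow> real)"
      using emeasure_lborel_cball_finite[of x0 "r / 2"] by (intro integrable_real_indicator) auto
    show "integrable lborel (\<lambda>x. (mollify (r / 2) ?v x)\<^sup>2)" by (rule L2_zeroD(3)[OF C2c_L2_zero[OF C]])
    show "indicator (cball x0 (r / 2)) x \<le> (mollify (r / 2) ?v x)\<^sup>2" for x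
      using one[of x] by (auto simp: indicator_def)
  qed
  finally show ?thesis using C by blast
qed

end

section \<open>Density and the derivative of the eigenvalue\<close>

context bounded_open_set
begin

lemma C2c_approx:
  assumes lip: "lipschitz_boundary \<Omega>" and u: "u \<in> form_domain" and e: "e > 0"
  obtains w where "w \<in> C2c \<Omega>" "sqnorm (\<lambda>x. w x - u x) < e" "near_energy 0 w < near_energy 0 u + e"
proof -
  \<comment> \<open>Three errors, each multiplied by 3 when the square of a sum of three terms is
    bounded by squares.\<close>
  have e9: "e / 9 > 0" using e by simp
  obtain v1 M where v1: "v1 \<in> form_domain" "\<And>x. \<bar>v1 x\<bar> \<le> M" "sqnorm (\<lambda>x. v1 x - u x) < e / 9" "near_energy 0 v1 \<le> near_energy 0 u"
    using truncate_approx[OF u e9] by blast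
  obtain v2 K where v2: "v2 \<in> form_domain" "\<And>x. \<bar>v2 x\<bar> \<le> M" "compact K" "K \<subseteq> \<Omega>" "\<And>x. x \<notin> K \<Longrightarrow> v2 x = 0"
    "sqnorm (\<lambda>x. v2 x - v1 x) < e / 9" "near_energy 0 v2 < near_energy 0 v1 + e / 9"
    using cutoff_approx[OF lip v1(1,2) e9] by blast
  obtain w where w: "w \<in> C2c \<Omega>" "sqnorm (\<lambda>x. w x - v2 x) < e / 9" "near_energy 0 w \<le> near_energy 0 v2"
    using mollify_approx[OF v2(1,2,3,4,5) e9] by blast
  note L = form_domainD(1)[OF u] form_domainD(1)[OF v1(1)] form_domainD(1)[OF v2(1)] C2c_L2_zero[OF w(1)]
  have diff: "integrable lborel (\<lambda>x. (f x - g x)\<^sup>2)" if "f \<in> L2_zero \<Omega>" "g \<in> L2_zero \<Omega>" for f g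
    using L2_zeroD(3)[OF L2_zero_linear[OF that, of 1 "- 1"]] by simp
  have "sqnorm (\<lambda>x. w x - u x) \<le> (LBINT x. 3 * (w x - v2 x)\<^sup>2 + 3 * (v2 x - v1 x)\<^sup>2 + 3 * (v1 x - u x)\<^sup>2)"
    unfolding sqnorm_def
  proof (rule integral_mono)
    show "integrable lborel (\<lambda>x. (w x - u x)\<^sup>2)" by (intro diff L)
    show "integrable lborel (\<lambda>x. 3 * (w x - v2 x)\<^sup>2 + 3 * (v2 x - v1 x)\<^sup>2 + 3 * (v1 x - u x)\<^sup>2)"
      by (intro Bochner_Integration.integrable_add integrable_mult_right diff L)
    fix x
    have "(a + b + c)\<^sup>2 \<le> 3 * a\<^sup>2 + 3 * b\<^sup>2 + 3 * c\<^sup>2" for a b c :: real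
    proof -
      have "3 * a\<^sup>2 + 3 * b\<^sup>2 + 3 * c\<^sup>2 - (a + b + c)\<^sup>2 = (a - b)\<^sup>2 + (b - c)\<^sup>2 + (a - c)\<^sup>2"
        by (simp add: power2_eq_square algebra_simps)
      moreover have "0 \<le> (a - b)\<^sup>2 + (b - c)\<^sup>2 + (a - c)\<^sup>2" by simp
      ultimately show ?thesis by linarith
    qed
    from this[of "w x - v2 x" "v2 x - v1 x" "v1 x - u x"]
    show "(w x - u x)\<^sup>2 \<le> 3 * (w x - v2 x)\<^sup>2 + 3 * (v2 x - v1 x)\<^sup>2 + 3 * (v1 x - u x)\<^sup>2" by simp
  qed
  also have "\<dots> = 3 * sqnorm (\<lambda>x. w x - v2 x) + 3 * sqnorm (\<lambda>x. v2 x - v1 x) + 3 * sqnorm (\<lambda>x. v1 x - u x)"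
    unfolding sqnorm_def using diff[OF L(4,3)] diff[OF L(3,2)] diff[OF L(2,1)] by simp
  also have "\<dots> < e" using v1(3) v2(6) w(2) by simp
  finally have "sqnorm (\<lambda>x. w x - u x) < e" .
  moreover have "near_energy 0 w < near_energy 0 u + e" using v1(4) v2(7) w(3) e by simp
  ultimately show thesis using that w(1) by blast
qed

text \<open>The far kernel is at most 1, so the far energy is continuous in L1 and, on a domain of
  finite volume, in L2. Thus the near energy is the only term of the logarithmic energy that L2
  convergence does not control.\<close>

lemma sqnorm_far_energy_tendsto:
  fixes w :: "nat \<Rightarrow> 'a \<Rightarrow> real"
  assumes w: "\<And>n. w n \<in> L2_zero \<Omega>" and u: "u \<in> L2_zero \<Omega>" and lim: "(\<lambda>n. sqnorm (\<lambda>x. w n x - u x)) \<longlonglongrightarrow> 0"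
  shows "(\<lambda>n. sqnorm (w n)) \<longlonglongrightarrow> sqnorm u" "(\<lambda>n. far_energy 0 (w n) (w n)) \<longlonglongrightarrow> far_energy 0 u u"
proof -
  define g where "g = (\<lambda>n x. w n x - u x)"
  have g: "g n \<in> L2_zero \<Omega>" for n
    using L2_zero_linear[OF w u, of 1 n "- 1"] by (simp add: g_def)
  have wg: "w n = (\<lambda>x. 1 * u x + 1 * g n x)" for n by (simp add: g_def)
  define a where "a = (\<lambda>n. LBINT x. \<bar>g n x\<bar>)"
  have a0: "a n \<ge> 0" for n unfolding a_def by (intro integral_nonneg_AE) auto
  have S: "(\<lambda>n. sqnorm (g n)) \<longlonglongrightarrow> 0" using lim by (simp add: g_def)
  have "(\<lambda>n. sqrt (vol * sqnorm (g n))) \<longlonglongrightarrow> sqrt (vol * 0)" by (intro tendsto_intros S)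
  then have sq0: "(\<lambda>n. sqrt (vol * sqnorm (g n))) \<longlonglongrightarrow> 0" by simp
  have a_le: "a n \<le> sqrt (vol * sqnorm (g n))" for n
    using L1_le_L2[OF g[of n]] by (intro real_le_rsqrt) (simp add: a_def)
  have a_lim: "a \<longlonglongrightarrow> 0"
    by (rule tendsto_sandwich[OF _ _ tendsto_const sq0]) (use a0 a_le in auto)
  let ?b = "LBINT x. \<bar>u x\<bar>"
  note iu = L2_zero_integrable[OF u] and ig = L2_zero_integrable[OF g]
  have far: "far_energy 0 (w n) (w n) = far_energy 0 u u + far_energy 0 u (g n) + far_energy 0 (g n) u + far_energy 0 (g n) (g n)" for n
  proof -
    have "integrable lborel (\<lambda>x. 1 * u x + 1 * g n x)" using iu(1) ig(1)[of n] by simp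
    from far_energy_linear[OF order.refl iu(1) ig(1)[of n] this, of 1 1]
    show ?thesis
      using far_energy_linear2[OF order.refl iu(1) ig(1)[of n] iu(1), of 1 1] far_energy_linear2[OF order.refl iu(1) ig(1)[of n] ig(1)[of n], of 1 1]
      by (simp add: wg[of n])
  qed
  have z1: "(\<lambda>n. far_energy 0 u (g n)) \<longlonglongrightarrow> 0"
  proof (rule Lim_null_comparison)
    show "eventually (\<lambda>n. norm (far_energy 0 u (g n)) \<le> ?b * a n) sequentially"
      using abs_far_energy_le[OF order.refl iu(1) ig(1)] by (simp add: a_def)
    show "(\<lambda>n. ?b * a n) \<longlonglongrightarrow> 0" using a_lim by (rule tendsto_mult_right_zero)
  qed
  have z2: "(\<lambda>n. far_energy 0 (g n) u) \<longlonglongrightarrow> 0"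
    using z1 far_energy_swap[OF L2_zeroD(1)[OF u] L2_zeroD(1)[OF g]] by simp
  have z3: "(\<lambda>n. far_energy 0 (g n) (g n)) \<longlonglongrightarrow> 0"
  proof (rule Lim_null_comparison)
    show "eventually (\<lambda>n. norm (far_energy 0 (g n) (g n)) \<le> a n * a n) sequentially"
      using abs_far_energy_le[OF order.refl ig(1) ig(1)] by (simp add: a_def)
    show "(\<lambda>n. a n * a n) \<longlonglongrightarrow> 0" using tendsto_mult[OF a_lim a_lim] by simp
  qed
  have "(\<lambda>n. far_energy 0 u u + far_energy 0 u (g n) + far_energy 0 (g n) u + far_energy 0 (g n) (g n)) \<longlonglongrightarrow> far_energy 0 u u + 0 + 0 + 0"
    by (intro tendsto_intros z1 z2 z3)
  then show "(\<lambda>n. far_energy 0 (w n) (w n)) \<longlonglongrightarrow> far_energy 0 u u" unfolding far by simp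
  have sq: "sqnorm (w n) = sqnorm u + 2 * (LBINT x. u x * g n x) + sqnorm (g n)" for n
  proof -
    have "(\<lambda>x. (1 * u x + 1 * g n x)\<^sup>2) = (\<lambda>x. (u x)\<^sup>2 + 2 * (u x * g n x) + (g n x)\<^sup>2)"
      by (rule ext) (simp add: power2_eq_square algebra_simps)
    then show ?thesis
      unfolding wg[of n] sqnorm_def
      using L2_zeroD(3)[OF u] L2_zeroD(3)[OF g[of n]] integrable_prod[OF u g[of n]] by simp
  qed
  have "(\<lambda>n. LBINT x. u x * g n x) \<longlonglongrightarrow> 0"
  proof (rule tendstoI)
    fix e :: real assume e: "e > 0"
    \<comment> \<open>Weight in Young's inequality for the cross term: it makes the part with
      \<open>u\<close> at most \<open>e / 2\<close>, after which the part with \<open>g n\<close>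
      becomes small for large \<open>n\<close>.\<close>
    define t where "t = e / (2 * (sqnorm u + 1))"
    have su: "sqnorm u \<ge> 0" by (rule sqnorm_nonneg)
    have t: "t > 0" using e su by (simp add: t_def)
    have "t * sqnorm u \<le> t * (sqnorm u + 1)" using t by (intro mult_left_mono) auto
    also have "\<dots> = e / 2"
    proof -
      have "e / (2 * r) * r = e / 2" if "r > 0" for r using that by simp
      then show ?thesis unfolding t_def using su by (metis add_nonneg_pos zero_less_one)
    qed
    finally have tu: "t * sqnorm u \<le> e / 2" .
    have "eventually (\<lambda>n. sqnorm (g n) < e / 2 * t) sequentially"
      by (rule order_tendstoD(2)[OF S]) (use e t in simp)
    then show "eventually (\<lambda>n. dist (LBINT x. u x * g n x) 0 < e) sequentially"
    proof eventually_elim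
      case (elim n)
      have "\<bar>LBINT x. u x * g n x\<bar> \<le> (LBINT x. \<bar>u x * g n x\<bar>)" by (rule integral_abs_bound)
      also have "\<dots> \<le> (LBINT x. t * (u x)\<^sup>2 + 1 / t * (g n x)\<^sup>2)"
      proof (rule integral_mono)
        show "integrable lborel (\<lambda>x. \<bar>u x * g n x\<bar>)" using integrable_prod[OF u g[of n]] by simp
        show "integrable lborel (\<lambda>x. t * (u x)\<^sup>2 + 1 / t * (g n x)\<^sup>2)"
          using L2_zeroD(3)[OF u] L2_zeroD(3)[OF g[of n]] by simp
        fix x
        have "\<bar>(sqrt t * u x) * (g n x / sqrt t)\<bar> \<le> (sqrt t * u x)\<^sup>2 + (g n x / sqrt t)\<^sup>2"
          by (rule abs_mult_le_sum_squares)
        then show "\<bar>u x * g n x\<bar> \<le> t * (u x)\<^sup>2 + 1 / t * (g n x)\<^sup>2"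
          using t by (simp add: power_mult_distrib power_divide)
      qed
      also have "\<dots> = t * sqnorm u + sqnorm (g n) / t"
        unfolding sqnorm_def using L2_zeroD(3)[OF u] L2_zeroD(3)[OF g[of n]] by simp
      also have "sqnorm (g n) / t < e / 2" using elim t by (simp add: pos_divide_less_eq)
      finally show ?case using tu by simp
    qed
  qed
  then have "(\<lambda>n. sqnorm u + 2 * (LBINT x. u x * g n x) + sqnorm (g n)) \<longlonglongrightarrow> sqnorm u + 2 * 0 + 0"
    by (intro tendsto_intros S)
  then show "(\<lambda>n. sqnorm (w n)) \<longlonglongrightarrow> sqnorm u" unfolding sq by simp
qed

text \<open>Density, expressed as the passage of a lower bound from \<open>C2c\<close> to the form
  domain. Being homogeneous, the bound can be tested on approximants that are not normalized, and
  only their near energies from above enter.\<close>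

lemma C2c_lower_bound_extends:
  assumes lip: "lipschitz_boundary \<Omega>" and u: "u \<in> form_domain"
    and m: "\<And>w. w \<in> C2c \<Omega> \<Longrightarrow> m * sqnorm w \<le> log_energy w"
  shows "m * sqnorm u \<le> log_energy u"
proof -
  let ?c = "log_const DIM('a)" and ?r = "log_rho DIM('a)"
  have c: "?c > 0" by (simp add: log_const_pos)
  have "\<exists>w. w \<in> C2c \<Omega> \<and> sqnorm (\<lambda>x. w x - u x) < inverse (real (Suc n)) \<and> near_energy 0 w < near_energy 0 u + inverse (real (Suc n))" for n
  proof -
    have "inverse (real (Suc n)) > 0" by simp
    from C2c_approx[OF lip u this] show ?thesis by blast
  qed
  then obtain w where w: "\<And>n. w n \<in> C2c \<Omega>" "\<And>n. sqnorm (\<lambda>x. w n x - u x) < inverse (real (Suc n))"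
    "\<And>n. near_energy 0 (w n) < near_energy 0 u + inverse (real (Suc n))"
    by metis
  have "(\<lambda>n. sqnorm (\<lambda>x. w n x - u x)) \<longlonglongrightarrow> 0"
    by (rule tendsto_sandwich[OF _ _ tendsto_const LIMSEQ_inverse_real_of_nat];
        intro always_eventually allI sqnorm_nonneg less_imp_le w(2))
  note lims = sqnorm_far_energy_tendsto[OF C2c_L2_zero[OF w(1)] form_domainD(1)[OF u] this]
  have R: "(\<lambda>n. ?c / 2 * (near_energy 0 u + inverse (real (Suc n))) - ?c * far_energy 0 (w n) (w n) + ?r * sqnorm (w n))
      \<longlonglongrightarrow> ?c / 2 * (near_energy 0 u + 0) - ?c * far_energy 0 u u + ?r * sqnorm u"
    by (intro tendsto_intros lims LIMSEQ_inverse_real_of_nat)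
  have L: "(\<lambda>n. m * sqnorm (w n)) \<longlonglongrightarrow> m * sqnorm u" by (intro tendsto_intros lims)
  have "m * sqnorm (w n) \<le> ?c / 2 * (near_energy 0 u + inverse (real (Suc n))) - ?c * far_energy 0 (w n) (w n) + ?r * sqnorm (w n)" for n
  proof -
    have "?c / 2 * near_energy 0 (w n) \<le> ?c / 2 * (near_energy 0 u + inverse (real (Suc n)))"
      using w(3)[of n] c by (intro mult_left_mono) auto
    then show ?thesis using m[OF w(1)[of n]] by (simp add: log_energy_def)
  qed
  then have "m * sqnorm u \<le> ?c / 2 * (near_energy 0 u + 0) - ?c * far_energy 0 u u + ?r * sqnorm u"
    by (intro LIMSEQ_le[OF L R]) blast
  then show ?thesis by (simp add: log_energy_def)
qed

lemma C2c_normalize: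
  assumes w: "w \<in> C2c \<Omega>" and pos: "sqnorm w > 0"
  shows "(\<lambda>x. 1 / sqrt (sqnorm w) * w x) \<in> C2c \<Omega>" "sqnorm (\<lambda>x. 1 / sqrt (sqnorm w) * w x) = 1"
    "log_energy (\<lambda>x. 1 / sqrt (sqnorm w) * w x) = log_energy w / sqnorm w"
proof -
  have "{x. 1 / sqrt (sqnorm w) * w x \<noteq> 0} = {x. w x \<noteq> 0}" using pos by auto
  then show "(\<lambda>x. 1 / sqrt (sqnorm w) * w x) \<in> C2c \<Omega>"
    using w C2_function_mult[of w "1 / sqrt (sqnorm w)"] unfolding C2c_def by simp
  have sq: "(1 / sqrt (sqnorm w))\<^sup>2 = 1 / sqnorm w" using pos by (simp add: power_divide)
  show "sqnorm (\<lambda>x. 1 / sqrt (sqnorm w) * w x) = 1" unfolding sqnorm_mult sq using pos by simp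
  show "log_energy (\<lambda>x. 1 / sqrt (sqnorm w) * w x) = log_energy w / sqnorm w"
    unfolding log_energy_mult[OF C2c_L2_zero[OF w]] sq by simp
qed

text \<open>If no quotient on \<open>C2c\<close> were below \<open>a\<close>, then \<open>a\<close>
  would bound all quotients on the form domain from below and could not exceed their
  infimum.\<close>

lemma log_eigenvalue1_C2c_approx:
  assumes lip: "lipschitz_boundary \<Omega>" and a: "log_eigenvalue1 \<Omega> < a"
  obtains w where "w \<in> C2c \<Omega>" "sqnorm w = 1" "log_energy w < a"
proof -
  have "\<exists>w\<in>C2c \<Omega>. log_energy w < a * sqnorm w"
  proof (rule ccontr)
    assume "\<not> ?thesis"
    then have m: "\<And>w. w \<in> C2c \<Omega> \<Longrightarrow> a * sqnorm w \<le> log_energy w" by force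
    obtain w0 where w0: "w0 \<in> C2c \<Omega>" "sqnorm w0 > 0" using C2c_nontrivial by blast
    have "a \<le> log_eigenvalue1 \<Omega>"
      unfolding log_eigenvalue1_eq
    proof (rule cInf_greatest)
      show "{log_energy u | u. u \<in> form_domain \<and> sqnorm u = 1} \<noteq> {}"
        using C2c_normalize[OF w0] C2c_form_domain by blast
      fix y assume "y \<in> {log_energy u | u. u \<in> form_domain \<and> sqnorm u = 1}"
      then obtain u where "y = log_energy u" "u \<in> form_domain" "sqnorm u = 1" by blast
      then show "a \<le> y" using C2c_lower_bound_extends[OF lip _ m, of u] by simp
    qed
    with a show False by simp
  qed
  then obtain w where w: "w \<in> C2c \<Omega>" "log_energy w < a * sqnorm w" by blast
  have pos: "sqnorm w > 0"
  proof (rule ccontr)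
    assume "\<not> sqnorm w > 0"
    then have "sqnorm w = 0" using sqnorm_nonneg[of w] by simp
    then show False using w(2) log_energy_ge[OF C2c_L2_zero[OF w(1)]] by simp
  qed
  have "log_energy (\<lambda>x. 1 / sqrt (sqnorm w) * w x) < a"
    unfolding C2c_normalize(3)[OF w(1) pos] using w(2) pos by (simp add: pos_divide_less_eq)
  then show thesis
    by (rule that[OF C2c_normalize(1,2)[OF w(1) pos]])
qed

lemma frac_eigenvalue1_eq:
  "frac_eigenvalue1 s \<Omega> = Inf {frac_form s u u | u. u \<in> C2c \<Omega> \<and> sqnorm u = 1}"
proof -
  have "(u \<in> C2c \<Omega> \<and> L2_norm_on UNIV u = 1) \<longleftrightarrow> (u \<in> C2c \<Omega> \<and> sqnorm u = 1)" for u
    using L2_norm_on_eq(2)[OF C2c_L2_zero, of u u] by auto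
  then show ?thesis by (simp add: frac_eigenvalue1_def)
qed

text \<open>In \<open>frac_form_ge\<close> everything except \<open>log_energy u\<close> is
  independent of the test function, so the estimate survives the infimum.\<close>

lemma frac_eigenvalue1_ge:
  assumes s: "0 < s" "s \<le> 1/2"
  shows "(frac_ratio DIM('a) s - 1) / s + frac_ratio DIM('a) s * (log_eigenvalue1 \<Omega> - log_rho DIM('a) - far_defect s)
    \<le> (frac_eigenvalue1 s \<Omega> - 1) / s"
proof -
  let ?k = "frac_ratio DIM('a) s"
  have k: "?k > 0" using s by (intro frac_ratio_pos) auto
  obtain w0 where w0: "w0 \<in> C2c \<Omega>" "sqnorm w0 > 0" using C2c_nontrivial by blast
  have "?k * (1 + s * (log_eigenvalue1 \<Omega> - log_rho DIM('a) - far_defect s)) \<le> frac_eigenvalue1 s \<Omega>"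
    unfolding frac_eigenvalue1_eq
  proof (rule cInf_greatest)
    show "{frac_form s u u | u. u \<in> C2c \<Omega> \<and> sqnorm u = 1} \<noteq> {}" using C2c_normalize[OF w0] by blast
    fix y assume "y \<in> {frac_form s u u | u. u \<in> C2c \<Omega> \<and> sqnorm u = 1}"
    then obtain u where u: "y = frac_form s u u" "u \<in> C2c \<Omega>" "sqnorm u = 1" by blast
    have near: "integrable lborel (near_density s u)"
      using integrable_near_density_mono(1)[OF s(2) C2c_integrable_near[OF u(2)]] L2_zeroD(1)[OF C2c_L2_zero[OF u(2)]] by simp
    have "?k * (1 + s * (log_eigenvalue1 \<Omega> - log_rho DIM('a) - far_defect s)) \<le> ?k * (1 + s * (log_energy u - log_rho DIM('a) - far_defect s))"
      using log_eigenvalue1_le[OF C2c_form_domain[OF u(2)]] u(3) k s by (intro mult_left_mono add_left_mono diff_right_mono) auto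
    also have "\<dots> \<le> y"
      unfolding u(1) using s by (intro frac_form_ge C2c_L2_zero u near) auto
    finally show "?k * (1 + s * (log_eigenvalue1 \<Omega> - log_rho DIM('a) - far_defect s)) \<le> y" .
  qed
  then have "(?k * (1 + s * (log_eigenvalue1 \<Omega> - log_rho DIM('a) - far_defect s)) - 1) / s \<le> (frac_eigenvalue1 s \<Omega> - 1) / s"
    using s by (intro divide_right_mono) auto
  moreover have "(?k * (1 + s * X) - 1) / s = (?k - 1) / s + ?k * X" for X
    using s by (simp add: field_simps)
  ultimately show ?thesis by simp
qed

text \<open>The error contains the energy of exponent \<open>1/2\<close> of \<open>w\<close>, over
  which there is no uniform control. Therefore \<open>w\<close> is chosen first, with logarithmic
  energy close to the minimum, and only then does \<open>s\<close> tend to 0.\<close>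

lemma frac_eigenvalue1_le:
  assumes s: "0 < s" "s \<le> 1/2" and w: "w \<in> C2c \<Omega>" "sqnorm w = 1"
  shows "(frac_eigenvalue1 s \<Omega> - 1) / s \<le> (frac_ratio DIM('a) s - 1) / s +
    frac_ratio DIM('a) s * (log_energy w - log_rho DIM('a) + s * log_const DIM('a) * near_energy (1/2) w + far_defect s)"
proof -
  let ?k = "frac_ratio DIM('a) s"
  have "frac_eigenvalue1 s \<Omega> \<le> frac_form s w w"
    unfolding frac_eigenvalue1_eq
  proof (rule cInf_lower)
    have "0 \<le> y" if "y \<in> {frac_form s u u | u. u \<in> C2c \<Omega> \<and> sqnorm u = 1}" for y
    proof -
      from that obtain u :: "'a \<Rightarrow> real" where u: "y = frac_form s u u" by blast
      have "frac_const DIM('a) s > 0"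
        using frac_ratio_pos[of s "DIM('a)"] s mult_pos_pos[OF s(1) log_const_pos[of "DIM('a)"]]
        by (auto simp: frac_ratio_def zero_less_divide_iff)
      then show ?thesis
        unfolding u frac_form_def by (intro mult_nonneg_nonneg integral_nonneg_AE AE_I2) (auto split: prod.splits)
    qed
    then show "bdd_below {frac_form s u u | u. u \<in> C2c \<Omega> \<and> sqnorm u = 1}" by (rule bdd_belowI)
  qed (use w in blast)
  also have "\<dots> \<le> ?k * (1 + s * (log_energy w - log_rho DIM('a) + s * log_const DIM('a) * near_energy (1/2) w + far_defect s))"
    by (intro frac_form_le C2c_L2_zero C2c_integrable_near w s)
  finally have "(frac_eigenvalue1 s \<Omega> - 1) / s \<le> (?k * (1 + s * (log_energy w - log_rho DIM('a) + s * log_const DIM('a) * near_energy (1/2) w + far_defect s)) - 1) / s"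
    using s by (intro divide_right_mono) auto
  moreover have "(?k * (1 + s * X) - 1) / s = (?k - 1) / s + ?k * X" for X
    using s by (simp add: field_simps)
  ultimately show ?thesis by simp
qed

lemma frac_eigenvalue1_derivative:
  assumes lip: "lipschitz_boundary \<Omega>"
  shows "((\<lambda>s. (frac_eigenvalue1 s \<Omega> - 1) / s) \<longlongrightarrow> log_eigenvalue1 \<Omega>) (at_right 0)"
proof (rule order_tendstoI)
  let ?k = "frac_ratio DIM('a)" and ?l = "log_eigenvalue1 \<Omega>" and ?r = "log_rho DIM('a)"
  have N: "DIM('a) > 0" by simp
  have ev: "eventually (\<lambda>s::real. s \<in> {0<..<1/2}) (at_right 0)"
    by (rule eventually_at_right_real) simp
  {
    fix a assume a: "a < ?l"
    have "((\<lambda>s. (?k s - 1) / s + ?k s * (?l - ?r - far_defect s)) \<longlongrightarrow> ?r + 1 * (?l - ?r - 0)) (at_right 0)"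
      by (intro tendsto_intros frac_ratio_tendsto N far_defect_tendsto)
    then have "eventually (\<lambda>s. a < (?k s - 1) / s + ?k s * (?l - ?r - far_defect s)) (at_right 0)"
      by (rule order_tendstoD(1)) (use a in simp)
    with ev show "eventually (\<lambda>s. a < (frac_eigenvalue1 s \<Omega> - 1) / s) (at_right 0)"
      by eventually_elim (use frac_eigenvalue1_ge in force)
  next
    fix a assume a: "?l < a"
    obtain w where w: "w \<in> C2c \<Omega>" "sqnorm w = 1" "log_energy w < a"
      using log_eigenvalue1_C2c_approx[OF lip a] by blast
    have "((\<lambda>s. (?k s - 1) / s + ?k s * (log_energy w - ?r + s * log_const DIM('a) * near_energy (1/2) w + far_defect s))
      \<longlongrightarrow> ?r + 1 * (log_energy w - ?r + 0 * log_const DIM('a) * near_energy (1/2) w + 0)) (at_right 0)"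
      by (intro tendsto_intros frac_ratio_tendsto N far_defect_tendsto)
    then have "eventually (\<lambda>s. (?k s - 1) / s + ?k s * (log_energy w - ?r + s * log_const DIM('a) * near_energy (1/2) w + far_defect s) < a) (at_right 0)"
      by (rule order_tendstoD(2)) (use w(3) in simp)
    with ev show "eventually (\<lambda>s. (frac_eigenvalue1 s \<Omega> - 1) / s < a) (at_right 0)"
    proof eventually_elim
      case (elim s)
      have "(frac_eigenvalue1 s \<Omega> - 1) / s \<le> (?k s - 1) / s + ?k s * (log_energy w - ?r + s * log_const DIM('a) * near_energy (1/2) w + far_defect s)"
        using elim by (intro frac_eigenvalue1_le w) auto
      with elim show ?case by linarith
    qed
  }
qed

end

theorem theorem1p5:
  fixes \<Omega> :: "'a::euclidean_space set"
  assumes "bounded_lipschitz_domain \<Omega>"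
  shows "((\<lambda>s. (frac_eigenvalue1 s \<Omega> - 1) / s) \<longlongrightarrow> log_eigenvalue1 \<Omega>) (at_right 0) \<and>
    (\<forall>(u :: real \<Rightarrow> 'a \<Rightarrow> real) (\<xi> :: 'a \<Rightarrow> real).
       (\<forall>s\<in>{0<..<1}. frac_eigenfunction1 s \<Omega> (u s) \<and> nonneg_normalized_on \<Omega> (u s)) \<longrightarrow>
       log_eigenfunction1 \<Omega> \<xi> \<and> nonneg_normalized_on \<Omega> \<xi> \<longrightarrow>
       ((\<lambda>s. L2_norm_on \<Omega> (\<lambda>x. u s x - \<xi> x)) \<longlongrightarrow> 0) (at_right 0))"
proof -
  interpret bounded_open_set \<Omega>
    using assms by unfold_locales (auto simp: bounded_lipschitz_domain_def)
  have lip: "lipschitz_boundary \<Omega>" using assms by (simp add: bounded_lipschitz_domain_def)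
  note ev = frac_eigenvalue1_derivative[OF lip]
  show ?thesis
  proof (intro conjI allI impI ev)
    fix u :: "real \<Rightarrow> 'a \<Rightarrow> real" and \<xi> :: "'a \<Rightarrow> real"
    assume u: "\<forall>s\<in>{0<..<1}. frac_eigenfunction1 s \<Omega> (u s) \<and> nonneg_normalized_on \<Omega> (u s)"
      and x: "log_eigenfunction1 \<Omega> \<xi> \<and> nonneg_normalized_on \<Omega> \<xi>"
    show "((\<lambda>s. L2_norm_on \<Omega> (\<lambda>x. u s x - \<xi> x)) \<longlongrightarrow> 0) (at_right 0)"
      by (rule eigenfunctions_converge[OF ev]) (use u x in auto)
  qed
qed

end
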